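(* Let $d\ge1$ and fix $p\in\mathbb{N}$, $p\ge1$. Assume that for some $\Omega\in\mathbb{R}\setminus[-4d,0]$ there is a real $\mathcal{A}\in\ell^2(\mathbb{Z}^d)$ with $\Omega\mathcal{A}+\gamma_p|\mathcal{A}|^{2p}\mathcal{A}=\Delta\mathcal{A}$, such that $J_\Omega:=\Omega+(1+2p)\gamma_p|\mathcal{A}|^{2p}-\Delta$ has trivial null space in $\ell^2(\mathbb{Z}^d)$. For small $\epsilon>0$ let $\omega(\epsilon)$ and $U=U(\cdot,\epsilon)$ be the associated Klein--Gordon breather branch described in the context. Assume that $\Lambda\in\mathbb{C}$ is a simple isolated eigenvalue of the dNLS spectral problem $$\begin{pmatrix} 0 & -(\Omega-\Delta+\gamma_p\mathcal{A}^{2p}) \\ \Omega-\Delta+\gamma_p(1+2p)\mathcal{A}^{2p} & 0 \end{pmatrix} \begin{pmatrix} b_+ \\ b_- \end{pmatrix} = 2\Lambda \begin{pmatrix} b_+ \\ b_- \end{pmatrix}$$ with eigenvector $(b_+,b_-)\in\ell^2(\mathbb{Z}^d)\times\ell^2(\mathbb{Z}^d)$, and that $2\Lambda\notin\{i[\Omega,\Omega+4d]\}\cup\{-i[\Omega,\Omega+4d]\}$. Then there exist $\epsilon_0>0$ and $C_0>0$ such that for every $\epsilon\in(0,\epsilon_0)$ the spectral problem $$\left[1+(\lambda+im\omega(\epsilon))^2\right]B^{(m)}+\frac{\epsilon(1+2p)}{2\pi}\int_{-\pi}^{\pi}U^{2p}(\tau)W(\tau)e^{-im\tau}\,d\tau=\epsilon\Delta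 B^{(m)},\quad m\in\mathbb{Z},\qquad W(\tau)=\sum_{m\in\mathbb{Z}}B^{(m)}e^{im\tau},$$ admits a unique (up to scalar normalization of the eigenvector) analytic branch, in $\epsilon$, of eigenvalue--eigenvector pairs with $\lambda(\epsilon)\in\mathbb{C}$ and $\{B^{(m)}(\epsilon)\}_{m\in\mathbb{Z}}\in\ell^{2,2}(\mathbb{Z};\ell^2(\mathbb{Z}^d))$ satisfying $$|\lambda(\epsilon)-\epsilon\Lambda|\le C_0\epsilon^2,$$ $$\|B^{(1)}-b_+-ib_-\|_{\ell^2(\mathbb{Z}^d)}+\|B^{(-1)}-b_++ib_-\|_{\ell^2(\mathbb{Z}^d)}\le C_0\epsilon,$$ $$\|B^{(0)}\|_{\ell^2(\mathbb{Z}^d)}+\sum_{|m|\ge2}\|B^{(m)}\|_{\ell^2(\mathbb{Z}^d)}\le C_0\epsilon$$ for every $\epsilon\in(0,\epsilon_0)$.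
   Context: $\Delta$ is the discrete Laplacian, $(\Delta u)_n=\sum_{|k-n|=1}(u_k-u_n)$ on $\ell^2(\mathbb{Z}^d)$, with spectrum $[-4d,0]$; products and powers of sequences are componentwise; $\gamma_p=\frac{(2p+1)!}{p!(p+1)!}$. The space $\ell^{2,2}(\mathbb{Z};\ell^2(\mathbb{Z}^d))$ has norm $\big(\sum_{m\in\mathbb{Z}}(1+|m|^2)^2\|B^{(m)}\|^2_{\ell^2(\mathbb{Z}^d)}\big)^{1/2}$; the sequences $b_\pm$, $B^{(m)}$ are complex-valued. Breather branch: under the stated assumptions on $\mathcal{A}$, for all sufficiently small $\epsilon>0$ there is a unique analytic branch of solutions of $\omega^2U''+U+\epsilon U^{1+2p}=\epsilon\Delta U$ with $\omega(\epsilon)=\sqrt{1-\epsilon\Omega}$ and $U(\tau,\epsilon)=\sum_{m\in\mathbb{Z}}A^{(m)}(\epsilon)e^{im\tau}\in H^2_{\rm per}([-\pi,\pi];\ell^2(\mathbb{Z}^d))$, $A^{(m)}=A^{(-m)}$ real, such that $\|A^{(0)}\|_{\ell^2}+\|A^{(1)}-\mathcal{A}\|_{\ell^2}+\sum_{m\ge2}\|A^{(m)}\|_{\ell^2}\le C\epsilon$. The second spectral problem is the Fourier form of $\omega^2W''+2\lambda\omega W'+\lambda^2W+W+\epsilon(1+2p)U^{2p}W=\epsilon\Delta W$, obtained by substituting $w(t)=W(\omega t)e^{\lambda t}$ in the linearization of $\ddot u+u+\epsilon u^{1+2p}=\epsilon\Delta u$ at the breather $U$. The set $\{i[\Omega,\Omega+4d]\}\cup\{-i[\Omega,\Omega+4d]\}$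 is the continuous spectrum of the $2\times2$ matrix operator in the dNLS spectral problem. "Simple" means algebraic multiplicity one. *)

theory Defs
  imports "HOL-Analysis.Analysis"
begin

section \<open>Square-summable sequences\<close>

definition ell2 :: "('n \<Rightarrow> 'a::real_normed_vector) set" where
  "ell2 = {u. (\<lambda>n. (norm (u n))\<^sup>2) summable_on UNIV}"

definition ell2_norm :: "('n \<Rightarrow> 'a::real_normed_vector) \<Rightarrow> real" where
  "ell2_norm u = sqrt (\<Sum>\<^sub>\<infinity>n. (norm (u n))\<^sup>2)"

text \<open>
  The weighted space of families \<open>B m\<close> (\<open>m\<close> an integer) of complex square-summable sequences.
  By Parseval it is the space of Fourier coefficients of 2 pi-periodic \<open>H\<^sup>2\<close> functions with
  values in \<^const>\<open>ell2\<close>.  By Cauchy-Schwarz its members satisfy that the norms of the \<open>B m\<close>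
  are summable over \<open>m\<close>, so the series \<open>fourier_series\<close> and the sums of norms below converge.
\<close>

definition ell22 :: "(int \<Rightarrow> 'n \<Rightarrow> complex) set" where
  "ell22 = {B. (\<forall>m. B m \<in> ell2) \<and>
     (\<lambda>m. (1 + \<bar>real_of_int m\<bar>\<^sup>2)\<^sup>2 * (ell2_norm (B m))\<^sup>2) summable_on UNIV}"

definition ell22_norm :: "(int \<Rightarrow> 'n \<Rightarrow> complex) \<Rightarrow> real" where
  "ell22_norm B = sqrt (\<Sum>\<^sub>\<infinity>m. (1 + \<bar>real_of_int m\<bar>\<^sup>2)\<^sup>2 * (ell2_norm (B m))\<^sup>2)"

definition fourier_series :: "(int \<Rightarrow> 'n \<Rightarrow> complex) \<Rightarrow> real \<Rightarrow> 'n \<Rightarrow> complex" where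
  "fourier_series B \<tau> n = (\<Sum>\<^sub>\<infinity>m. B m n * cis (of_int m * \<tau>))"

text \<open>
  Analytic dependence on a real parameter: near each point of the (open) parameter set the
  map is the sum of a power series, convergent in the norm of the target space.
\<close>

definition real_analytic_complex :: "(real \<Rightarrow> complex) \<Rightarrow> real set \<Rightarrow> bool" where
  "real_analytic_complex f S \<longleftrightarrow> (\<forall>x\<^sub>0\<in>S. \<exists>r>0. \<exists>a. \<forall>x\<in>S. \<bar>x - x\<^sub>0\<bar> < r \<longrightarrow>
     (\<lambda>k. complex_of_real ((x - x\<^sub>0) ^ k) * a k) sums f x)"

definition real_analytic_ell22 :: "(real \<Rightarrow> int \<Rightarrow> 'n \<Rightarrow> complex) \<Rightarrow> real set \<Rightarrow> bool" where
  "real_analytic_ell22 F S \<longleftrightarrow> (\<forall>x\<^sub>0\<in>S. \<exists>r>0. \<exists>a. (\<forall>k. a k \<in> ell22) \<and>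
     (\<forall>x\<in>S. \<bar>x - x\<^sub>0\<bar> < r \<longrightarrow> F x \<in> ell22 \<and>
       (\<lambda>N. ell22_norm (\<lambda>m n. F x m n - (\<Sum>k<N. complex_of_real ((x - x\<^sub>0) ^ k) * a k m n)))
         \<longlonglongrightarrow> 0))"

section \<open>The discrete Laplacian\<close>

text \<open>Lattice points are vectors of type \<^typ>\<open>int ^ 'd\<close>; the dimension is \<open>CARD('d) \<ge> 1\<close>.\<close>

definition neighbours :: "int ^ 'd \<Rightarrow> (int ^ 'd) set" where
  "neighbours n = {k. (\<Sum>i\<in>UNIV. \<bar>k $ i - n $ i\<bar>) = 1}"

definition laplacian :: "(int ^ 'd \<Rightarrow> 'a::ab_group_add) \<Rightarrow> int ^ 'd \<Rightarrow> 'a" where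
  "laplacian u n = (\<Sum>k\<in>neighbours n. u k - u n)"

lemma finite_neighbours: "finite (neighbours n)"
proof -
  have "neighbours n \<subseteq> vec_lambda ` (Pi\<^sub>E UNIV (\<lambda>i. {n $ i - 1..n $ i + 1}))"
  proof
    fix k assume "k \<in> neighbours n"
    then have s: "(\<Sum>i\<in>UNIV. \<bar>k $ i - n $ i\<bar>) = 1"
      by (simp add: neighbours_def)
    have "\<bar>k $ i - n $ i\<bar> \<le> 1" for i
      using member_le_sum[of i UNIV "\<lambda>i. \<bar>k $ i - n $ i\<bar>"] s by simp
    then have "k $ i \<in> {n $ i - 1..n $ i + 1}" for i
      by (smt (verit) atLeastAtMost_iff)
    then have "vec_nth k \<in> Pi\<^sub>E UNIV (\<lambda>i. {n $ i - 1..n $ i + 1})"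
      by (simp add: PiE_UNIV_domain)
    then show "k \<in> vec_lambda ` (Pi\<^sub>E UNIV (\<lambda>i. {n $ i - 1..n $ i + 1}))"
      by (metis image_eqI vec_nth_inverse)
  qed
  then show ?thesis
    by (rule finite_subset) (intro finite_imageI finite_PiE, auto)
qed

section \<open>The stationary dNLS equation and its linearization\<close>

definition gamma_coeff :: "nat \<Rightarrow> real" where
  "gamma_coeff p = fact (2 * p + 1) / (fact p * fact (p + 1))"

definition dnls_stationary :: "nat \<Rightarrow> real \<Rightarrow> (int ^ 'd \<Rightarrow> real) \<Rightarrow> bool" where
  "dnls_stationary p \<Omega> \<A> \<longleftrightarrow>
     (\<forall>n. \<Omega> * \<A> n + gamma_coeff p * \<bar>\<A> n\<bar> ^ (2 * p) * \<A> n = laplacian \<A> n)"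

definition J_op ::
  "nat \<Rightarrow> real \<Rightarrow> (int ^ 'd \<Rightarrow> real) \<Rightarrow> (int ^ 'd \<Rightarrow> complex) \<Rightarrow> int ^ 'd \<Rightarrow> complex" where
  "J_op p \<Omega> \<A> u n = of_real \<Omega> * u n
     + of_real ((1 + 2 * real p) * gamma_coeff p * \<bar>\<A> n\<bar> ^ (2 * p)) * u n - laplacian u n"

type_synonym 'n cpair = "('n \<Rightarrow> complex) \<times> ('n \<Rightarrow> complex)"

definition dnls_matrix ::
  "nat \<Rightarrow> real \<Rightarrow> (int ^ 'd \<Rightarrow> real) \<Rightarrow> (int ^ 'd) cpair \<Rightarrow> (int ^ 'd) cpair" where
  "dnls_matrix p \<Omega> \<A> b =
     ((\<lambda>n. - (of_real \<Omega> * snd b n - laplacian (snd b) n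
              + of_real (gamma_coeff p * \<A> n ^ (2 * p)) * snd b n)),
      (\<lambda>n. of_real \<Omega> * fst b n - laplacian (fst b) n
              + of_real (gamma_coeff p * (1 + 2 * real p) * \<A> n ^ (2 * p)) * fst b n))"

section \<open>Spectral notions for operators on pairs of square-summable sequences\<close>

definition pair_zero :: "'n cpair" where
  "pair_zero = ((\<lambda>n. 0), (\<lambda>n. 0))"

definition pair_scale :: "complex \<Rightarrow> 'n cpair \<Rightarrow> 'n cpair" where
  "pair_scale c b = ((\<lambda>n. c * fst b n), (\<lambda>n. c * snd b n))"

definition pair_norm :: "'n cpair \<Rightarrow> real" where
  "pair_norm b = sqrt ((ell2_norm (fst b))\<^sup>2 + (ell2_norm (snd b))\<^sup>2)"

definition shifted :: "('n cpair \<Rightarrow> 'n cpair) \<Rightarrow> complex \<Rightarrow> 'n cpair \<Rightarrow> 'n cpair" where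
  "shifted T \<mu> b = ((\<lambda>n. fst (T b) n - \<mu> * fst b n), (\<lambda>n. snd (T b) n - \<mu> * snd b n))"

definition resolvent_set :: "('n cpair \<Rightarrow> 'n cpair) \<Rightarrow> complex set" where
  "resolvent_set T = {\<mu>. bij_betw (shifted T \<mu>) (ell2 \<times> ell2) (ell2 \<times> ell2) \<and>
     (\<exists>K. \<forall>b\<in>ell2 \<times> ell2. pair_norm b \<le> K * pair_norm (shifted T \<mu> b))}"

definition eigenpair :: "('n cpair \<Rightarrow> 'n cpair) \<Rightarrow> complex \<Rightarrow> 'n cpair \<Rightarrow> bool" where
  "eigenpair T \<mu> b \<longleftrightarrow> b \<in> ell2 \<times> ell2 \<and> b \<noteq> pair_zero \<and> T b = pair_scale \<mu> b"

definition generalized_eigenspace :: "('n cpair \<Rightarrow> 'n cpair) \<Rightarrow> complex \<Rightarrow> 'n cpair set" where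
  "generalized_eigenspace T \<mu> = {b \<in> ell2 \<times> ell2. \<exists>k. (shifted T \<mu> ^^ k) b = pair_zero}"

text \<open>Algebraic multiplicity one: the generalized eigenspace is a complex line.\<close>

definition simple_eigenvalue :: "('n cpair \<Rightarrow> 'n cpair) \<Rightarrow> complex \<Rightarrow> bool" where
  "simple_eigenvalue T \<mu> \<longleftrightarrow>
     (\<exists>v. eigenpair T \<mu> v \<and> generalized_eigenspace T \<mu> = {pair_scale c v | c. True})"

definition isolated_in_spectrum :: "('n cpair \<Rightarrow> 'n cpair) \<Rightarrow> complex \<Rightarrow> bool" where
  "isolated_in_spectrum T \<mu> \<longleftrightarrow> \<mu> \<notin> resolvent_set T \<and>
     (\<exists>r>0. \<forall>\<nu>. 0 < cmod (\<nu> - \<mu>) \<and> cmod (\<nu> - \<mu>) < r \<longrightarrow> \<nu> \<in> resolvent_set T)"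

section \<open>Klein--Gordon breathers\<close>

definition breather_freq :: "real \<Rightarrow> real \<Rightarrow> real" where
  "breather_freq \<Omega> \<epsilon> = sqrt (1 - \<epsilon> * \<Omega>)"

text \<open>
  The equation holds in the classical sense at every site: for an \<open>H\<^sup>2\<close> solution the second
  derivative is determined by the remaining terms, which are continuous in time.
\<close>

definition kg_solution ::
  "nat \<Rightarrow> real \<Rightarrow> real \<Rightarrow> (real \<Rightarrow> int ^ 'd \<Rightarrow> complex) \<Rightarrow> bool" where
  "kg_solution p \<epsilon> \<omega> U \<longleftrightarrow> (\<exists>U' U''. \<forall>\<tau> n.
     ((\<lambda>t. U t n) has_vector_derivative U' \<tau> n) (at \<tau>) \<and>
     ((\<lambda>t. U' t n) has_vector_derivative U'' \<tau> n) (at \<tau>) \<and>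
     of_real (\<omega>\<^sup>2) * U'' \<tau> n + U \<tau> n + of_real \<epsilon> * U \<tau> n ^ (1 + 2 * p)
       = of_real \<epsilon> * laplacian (U \<tau>) n)"

text \<open>
  \<open>A \<epsilon> m\<close> is the \<open>m\<close>-th Fourier coefficient of the breather \<open>U(\<cdot>, \<epsilon>)\<close>; the branch is defined
  for \<open>0 < \<epsilon> < \<epsilon>\<^sub>1\<close> and \<open>C\<close> is the constant in its leading-order approximation.
\<close>

definition breather_branch ::
  "nat \<Rightarrow> real \<Rightarrow> (int ^ 'd \<Rightarrow> real) \<Rightarrow> real \<Rightarrow> real \<Rightarrow> (real \<Rightarrow> int \<Rightarrow> int ^ 'd \<Rightarrow> complex) \<Rightarrow> bool" where
  "breather_branch p \<Omega> \<A> \<epsilon>\<^sub>1 C A \<longleftrightarrow>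
     real_analytic_ell22 A {0<..<\<epsilon>\<^sub>1} \<and>
     (\<forall>\<epsilon>\<in>{0<..<\<epsilon>\<^sub>1}.
        A \<epsilon> \<in> ell22 \<and>
        (\<forall>m n. A \<epsilon> m n \<in> \<real> \<and> A \<epsilon> m n = A \<epsilon> (- m) n) \<and>
        kg_solution p \<epsilon> (breather_freq \<Omega> \<epsilon>) (fourier_series (A \<epsilon>)) \<and>
        ell2_norm (A \<epsilon> 0) + ell2_norm (\<lambda>n. A \<epsilon> 1 n - of_real (\<A> n))
          + (\<Sum>\<^sub>\<infinity>m\<in>{2..}. ell2_norm (A \<epsilon> m)) \<le> C * \<epsilon>)"

section \<open>The Klein--Gordon spectral problem\<close>

definition kg_eigenpair ::
  "nat \<Rightarrow> real \<Rightarrow> real \<Rightarrow> (real \<Rightarrow> int ^ 'd \<Rightarrow> complex) \<Rightarrow> complex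
     \<Rightarrow> (int \<Rightarrow> int ^ 'd \<Rightarrow> complex) \<Rightarrow> bool" where
  "kg_eigenpair p \<epsilon> \<omega> U ev B \<longleftrightarrow>
     B \<in> ell22 \<and> B \<noteq> (\<lambda>m n. 0) \<and>
     (\<forall>m n. (1 + (ev + \<i> * of_int m * of_real \<omega>)\<^sup>2) * B m n
        + of_real (\<epsilon> * (1 + 2 * real p) / (2 * pi)) *
            integral {-pi..pi}
              (\<lambda>\<tau>. U \<tau> n ^ (2 * p) * fourier_series B \<tau> n * cis (- (of_int m * \<tau>)))
        = of_real \<epsilon> * laplacian (B m) n)"

definition kg_spectral_branch ::
  "nat \<Rightarrow> real \<Rightarrow> (real \<Rightarrow> int \<Rightarrow> int ^ 'd \<Rightarrow> complex) \<Rightarrow> complex \<Rightarrow> (int ^ 'd) cpair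
     \<Rightarrow> real \<Rightarrow> real \<Rightarrow> (real \<Rightarrow> complex) \<Rightarrow> (real \<Rightarrow> int \<Rightarrow> int ^ 'd \<Rightarrow> complex) \<Rightarrow> bool" where
  "kg_spectral_branch p \<Omega> A \<Lambda> b \<epsilon>\<^sub>0 C\<^sub>0 ev B \<longleftrightarrow>
     real_analytic_complex ev {0<..<\<epsilon>\<^sub>0} \<and>
     real_analytic_ell22 B {0<..<\<epsilon>\<^sub>0} \<and>
     (\<forall>\<epsilon>\<in>{0<..<\<epsilon>\<^sub>0}.
        kg_eigenpair p \<epsilon> (breather_freq \<Omega> \<epsilon>) (fourier_series (A \<epsilon>)) (ev \<epsilon>) (B \<epsilon>) \<and>
        cmod (ev \<epsilon> - of_real \<epsilon> * \<Lambda>) \<le> C\<^sub>0 * \<epsilon>\<^sup>2 \<and>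
        ell2_norm (\<lambda>n. B \<epsilon> 1 n - fst b n - \<i> * snd b n)
          + ell2_norm (\<lambda>n. B \<epsilon> (-1) n - fst b n + \<i> * snd b n) \<le> C\<^sub>0 * \<epsilon> \<and>
        ell2_norm (B \<epsilon> 0) + (\<Sum>\<^sub>\<infinity>m\<in>{m. 2 \<le> \<bar>m\<bar>}. ell2_norm (B \<epsilon> m)) \<le> C\<^sub>0 * \<epsilon>)"

end

theory Submission
  imports Defs
begin

text \<open>
  Put \<open>X m = (1 + m\<^sup>2) B m\<close>, an element of the Hilbert space of square-summable sequences over
  modes and sites, and \<open>\<lambda> = \<epsilon> \<mu>\<close>.  After dividing the modes \<open>m = \<plusminus>1\<close> by \<open>\<epsilon>\<close> the spectral problem
  becomes \<open>G(\<epsilon>, \<mu>) X = 0\<close> with a bounded pencil, quadratic in \<open>\<mu>\<close>, that extends continuously to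
  \<open>\<epsilon> = 0\<close>; there the modes \<open>m \<noteq> \<plusminus>1\<close> vanish and the modes \<open>\<plusminus>1\<close> satisfy the dNLS spectral problem.
  Adding to the limit a rank-one term along \<open>\<partial>\<^sub>\<mu> G\<close> gives an operator that is coercive, by the
  location of \<open>2 \<Lambda>\<close> off the continuous spectrum, up to small and finite-rank terms, because the
  potential \<open>\<A>\<^sup>2\<^sup>p\<close> decays; it is injective because \<open>2 \<Lambda>\<close> is simple, hence invertible.  The pair
  \<open>(\<mu>, X)\<close>, with one coordinate of \<open>X\<close> normalized, is then found by a quasi-Newton contraction.
  The contraction is run in a Banach space of power series in the increment of \<open>\<epsilon>\<close>, which gives
  existence, uniqueness and analyticity at the same time.
\<close>

section \<open>Square-summable sequences as a Hilbert space\<close>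

text \<open>Since \<omega>^2 = 1 - \<epsilon>\<Omega>, the symbol 1 + (\<epsilon>\<mu> + i m
  \<omega>)^2 is 1 - m^2 plus a multiple of \<epsilon>. It degenerates exactly at m = 1 and m = -1
  and grows like m^2 elsewhere; the division by \<epsilon> and the weight cure these two defects.
  The obstacle is the endpoint \<epsilon> = 0: the breather is analytic for \<epsilon> > 0 and
  approaches its leading term at rate O(\<epsilon>), so there is no expansion at 0 to start from.
  The limit problem therefore enters only through one fixed inverse of its linearization, the
  preconditioner for all small \<epsilon>, while the power series are centred at positive
  \<epsilon>. The contraction thresholds depend on the limit alone, so the range of \<epsilon> does
  not shrink with the radii of convergence. The rank-one term borders a singular operator: the limit
  pencil kills the eigenvector, and the derivative applied to it supplies a direction that is
  missing from the range because no Jordan chain starts there. The coefficients of the dNLS matrix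
  arise since (2 cos \<tau>)^(2p), compressed to the modes 1 and -1, has two neighbouring binomial
  coefficients as entries.\<close>

typedef 'i l2 = "ell2 :: ('i \<Rightarrow> complex) set" morphisms coord Abs_l2
  by (rule exI[of _ "\<lambda>i. 0"]) (simp add: ell2_def)

setup_lifting type_definition_l2

lemma ell2_iff: "u \<in> ell2 \<longleftrightarrow> (\<lambda>i. (norm (u i))\<^sup>2) summable_on UNIV"
  by (simp add: ell2_def)

lemma coord_summable: "(\<lambda>i. (cmod (coord x i))\<^sup>2) summable_on UNIV"
  using coord[of x] by (simp add: ell2_iff)

lemma ell2_dominated:
  fixes u :: "'i \<Rightarrow> 'a::real_normed_vector" and w :: "'i \<Rightarrow> 'b::real_normed_vector"
  assumes "w \<in> ell2" "\<And>i. norm (u i) \<le> K * norm (w i)"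
  shows "u \<in> ell2"
proof -
  have "(\<lambda>i. K\<^sup>2 * (norm (w i))\<^sup>2) summable_on UNIV"
    using assms(1) by (intro summable_on_cmult_right) (simp add: ell2_iff)
  moreover have "(norm (u i))\<^sup>2 \<le> K\<^sup>2 * (norm (w i))\<^sup>2" for i
    using power_mono[OF assms(2)[of i], of 2] by (simp add: power_mult_distrib)
  ultimately show ?thesis
    unfolding ell2_iff by (rule summable_on_comparison_test) auto
qed

lemma norm_add_square_le:
  fixes a b :: "'a::real_normed_vector"
  shows "(norm (a + b))\<^sup>2 \<le> 2 * (norm a)\<^sup>2 + 2 * (norm b)\<^sup>2"
proof -
  have "(norm (a + b))\<^sup>2 \<le> (norm a + norm b)\<^sup>2"
    by (intro power_mono norm_triangle_ineq) simp
  also have "\<dots> \<le> 2 * (norm a)\<^sup>2 + 2 * (norm b)\<^sup>2"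
    using zero_le_power2[of "norm a - norm b"] by (simp add: power2_eq_square algebra_simps)
  finally show ?thesis .
qed

lemma ell2_add:
  fixes u w :: "'i \<Rightarrow> 'a::real_normed_vector"
  assumes "u \<in> ell2" "w \<in> ell2"
  shows "(\<lambda>i. u i + w i) \<in> ell2"
proof -
  have "(\<lambda>i. 2 * (norm (u i))\<^sup>2 + 2 * (norm (w i))\<^sup>2) summable_on UNIV"
    using assms by (intro summable_on_add summable_on_cmult_right) (auto simp: ell2_iff)
  then show ?thesis
    unfolding ell2_iff by (rule summable_on_comparison_test) (auto simp: norm_add_square_le)
qed

lemma ell2_norm_nonneg: "0 \<le> ell2_norm u"
  by (simp add: ell2_norm_def infsum_nonneg)

lemma ell2_norm_square: "(ell2_norm u)\<^sup>2 = (\<Sum>\<^sub>\<infinity>i. (norm (u i))\<^sup>2)"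
  by (simp add: ell2_norm_def infsum_nonneg)

lemma ell2_zero [simp]: "(\<lambda>i. 0) \<in> ell2"
  by (simp add: ell2_iff)

lemma ell2_norm_coord_le:
  assumes "u \<in> ell2"
  shows "norm (u i) \<le> ell2_norm u"
proof -
  have "(\<Sum>j\<in>{i}. (norm (u j))\<^sup>2) \<le> (\<Sum>\<^sub>\<infinity>j. (norm (u j))\<^sup>2)"
    using assms by (intro finite_sum_le_infsum) (auto simp: ell2_iff)
  then show ?thesis
    unfolding ell2_norm_def by (intro real_le_rsqrt) simp
qed

instantiation l2 :: (type) real_vector
begin

lift_definition zero_l2 :: "'a l2" is "\<lambda>i. 0" by simp
lift_definition plus_l2 :: "'a l2 \<Rightarrow> 'a l2 \<Rightarrow> 'a l2" is "\<lambda>u w i. u i + w i" by (rule ell2_add)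
lift_definition uminus_l2 :: "'a l2 \<Rightarrow> 'a l2" is "\<lambda>u i. - u i" by (simp add: ell2_iff)
lift_definition minus_l2 :: "'a l2 \<Rightarrow> 'a l2 \<Rightarrow> 'a l2" is "\<lambda>u w i. u i - w i"
proof -
  fix u w :: "'a \<Rightarrow> complex" assume "u \<in> ell2" "w \<in> ell2"
  then show "(\<lambda>i. u i - w i) \<in> ell2"
    using ell2_add[of u "\<lambda>i. - w i"] by (simp add: ell2_iff)
qed
lift_definition scaleR_l2 :: "real \<Rightarrow> 'a l2 \<Rightarrow> 'a l2" is "\<lambda>r u i. r *\<^sub>R u i"
  by (rule ell2_dominated[where K = "\<bar>r\<bar>" for r]) auto

instance
  by standard (transfer; simp add: algebra_simps fun_eq_iff)+

end

lemma inner_summable: "(\<lambda>i. coord x i \<bullet> coord y i) summable_on UNIV"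
proof -
  have "(\<lambda>i. (cmod (coord x i))\<^sup>2 + (cmod (coord y i))\<^sup>2) summable_on UNIV"
    by (intro summable_on_add coord_summable)
  moreover have "\<bar>a \<bullet> b\<bar> \<le> (cmod a)\<^sup>2 + (cmod b)\<^sup>2" for a b :: complex
  proof -
    have "\<bar>a \<bullet> b\<bar> \<le> cmod a * cmod b" by (rule Cauchy_Schwarz_ineq2)
    also have "\<dots> \<le> (cmod a)\<^sup>2 + (cmod b)\<^sup>2"
      using zero_le_power2[of "cmod a - cmod b"] mult_nonneg_nonneg[OF norm_ge_zero[of a] norm_ge_zero[of b]]
      by (simp add: power2_eq_square algebra_simps del: mult_nonneg_nonneg)
    finally show ?thesis .
  qed
  ultimately have "(\<lambda>i. \<bar>coord x i \<bullet> coord y i\<bar>) summable_on UNIV"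
    by (rule summable_on_comparison_test) auto
  then show ?thesis
    using summable_on_iff_abs_summable_on_real[of "\<lambda>i. coord x i \<bullet> coord y i" UNIV] by simp
qed

instantiation l2 :: (type) real_inner
begin

text \<open>On complex numbers \<open>\<bullet>\<close> is the real part of the Hermitian product,
  so this is a real Hilbert space structure. It fits the real-linear type of bounded operators, and
  coercivity below is a statement about real parts. Complex linearity is tracked separately by
  \<open>clin\<close>.\<close>

definition inner_l2 :: "'a l2 \<Rightarrow> 'a l2 \<Rightarrow> real" where
  "inner_l2 x y = (\<Sum>\<^sub>\<infinity>i. coord x i \<bullet> coord y i)"
definition norm_l2 :: "'a l2 \<Rightarrow> real" where
  "norm_l2 x = sqrt (inner x x)"
definition sgn_l2 :: "'a l2 \<Rightarrow> 'a l2" where "sgn_l2 x = x /\<^sub>R norm x"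
definition dist_l2 :: "'a l2 \<Rightarrow> 'a l2 \<Rightarrow> real" where "dist_l2 x y = norm (x - y)"
definition uniformity_l2 :: "('a l2 \<times> 'a l2) filter" where
  "uniformity_l2 = (INF e\<in>{0 <..}. principal {(x, y). dist x y < e})"
definition open_l2 :: "'a l2 set \<Rightarrow> bool" where
  "open_l2 U \<longleftrightarrow> (\<forall>x\<in>U. eventually (\<lambda>(x', y). x' = x \<longrightarrow> y \<in> U) uniformity)"

instance
proof
  fix x y z :: "'a l2" and r :: real
  show "x \<bullet> y = y \<bullet> x" by (simp add: inner_l2_def inner_commute)
  show "(x + y) \<bullet> z = x \<bullet> z + y \<bullet> z"
    by (simp add: inner_l2_def plus_l2.rep_eq inner_add_left infsum_add inner_summable)
  show "r *\<^sub>R x \<bullet> y = r * (x \<bullet> y)"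
    by (simp add: inner_l2_def scaleR_l2.rep_eq infsum_cmult_right')
  show "0 \<le> x \<bullet> x" by (simp add: inner_l2_def infsum_nonneg)
  show "x \<bullet> x = 0 \<longleftrightarrow> x = 0"
  proof
    assume *: "x \<bullet> x = 0"
    have "coord x i \<bullet> coord x i = 0" for i
      by (rule nonneg_infsum_le_0D[where A = UNIV and f = "\<lambda>i. coord x i \<bullet> coord x i"])
        (use * in \<open>auto simp: inner_l2_def intro: inner_summable\<close>)
    then have "coord x = (\<lambda>i. 0)" by auto
    then show "x = 0" by (simp add: coord_inject[symmetric] zero_l2.rep_eq)
  qed (simp add: inner_l2_def zero_l2.rep_eq)
qed (simp_all add: norm_l2_def sgn_l2_def dist_l2_def uniformity_l2_def open_l2_def)

end

lemma norm_l2_eq: "norm x = ell2_norm (coord x)"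
  by (simp add: norm_l2_def inner_l2_def ell2_norm_def power2_norm_eq_inner)

lemma norm_l2_square: "(norm x)\<^sup>2 = (\<Sum>\<^sub>\<infinity>i. (cmod (coord x i))\<^sup>2)"
  by (simp add: norm_l2_eq ell2_norm_square)

lemma l2_eqI: "(\<And>i. coord x i = coord y i) \<Longrightarrow> x = y"
  by (simp add: coord_inject[symmetric] fun_eq_iff)

lemma coord_Abs [simp]: "u \<in> ell2 \<Longrightarrow> coord (Abs_l2 u) = u"
  by (rule Abs_l2_inverse)

lemmas coord_simps [simp] = zero_l2.rep_eq plus_l2.rep_eq minus_l2.rep_eq uminus_l2.rep_eq
  scaleR_l2.rep_eq

lemma coord_in_ell2 [simp]: "coord x \<in> ell2"
  by (rule coord)

lemma norm_coord_le: "cmod (coord x i) \<le> norm x"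
  by (simp add: norm_l2_eq ell2_norm_coord_le)

lemma bounded_linear_coord: "bounded_linear (\<lambda>x. coord x i)"
  by (rule bounded_linear_intro[where K = 1]) (simp_all add: norm_coord_le)

lemma coord_sum: "coord (sum f A) i = (\<Sum>a\<in>A. coord (f a) i)"
  by (induction A rule: infinite_finite_induct) auto

lemma sum_square_le_norm_l2:
  assumes "finite F"
  shows "(\<Sum>i\<in>F. (cmod (coord x i))\<^sup>2) \<le> (norm x)\<^sup>2"
  unfolding norm_l2_square using assms
  by (intro finite_sum_le_infsum coord_summable) auto

text \<open>The terms are nonnegative, so a bound on all finite partial sums yields summability and
  the norm estimate together. Limits and multipliers are shown to land in the space in this
  form.\<close>

lemma l2_bound:
  assumes "\<And>F. finite F \<Longrightarrow> (\<Sum>i\<in>F. (cmod (u i))\<^sup>2) \<le> M\<^sup>2" "0 \<le> M"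
  shows "u \<in> ell2" "norm (Abs_l2 u) \<le> M"
proof -
  have *: "(\<lambda>i. (cmod (u i))\<^sup>2) summable_on UNIV"
    by (rule nonneg_bdd_above_summable_on) (use assms in \<open>auto intro!: bdd_aboveI2\<close>)
  then show u: "u \<in> ell2" by (simp add: ell2_iff)
  have "(\<Sum>\<^sub>\<infinity>i. (cmod (u i))\<^sup>2) \<le> M\<^sup>2"
    by (rule infsum_le_finite_sums[OF *]) (use assms in auto)
  then show "norm (Abs_l2 u) \<le> M"
    using u assms(2) by (simp add: norm_l2_eq ell2_norm_def real_le_lsqrt infsum_nonneg)
qed

instance l2 :: (type) banach
proof
  fix X :: "nat \<Rightarrow> 'a l2"
  assume X: "Cauchy X"
  have "Cauchy (\<lambda>n. coord (X n) i)" for i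
    by (rule bounded_linear.Cauchy[OF bounded_linear_coord X])
  then have "\<exists>l. (\<lambda>n. coord (X n) i) \<longlonglongrightarrow> l" for i
    by (simp add: Cauchy_convergent_iff convergent_def)
  then obtain l where l: "\<And>i. (\<lambda>n. coord (X n) i) \<longlonglongrightarrow> l i"
    by metis
  \<comment> \<open>A Cauchy bound on norms is a bound on finite partial sums, and these pass to the
    coordinatewise limit. Membership of the difference and its norm estimate come out
    together.\<close>
  have tail: "(\<lambda>i. coord (X n) i - l i) \<in> ell2 \<and> norm (Abs_l2 (\<lambda>i. coord (X n) i - l i)) \<le> e"
    if N: "\<And>m. m \<ge> N \<Longrightarrow> norm (X n - X m) \<le> e" and "0 \<le> e" for n N e
  proof -
    have "(\<Sum>i\<in>F. (cmod (coord (X n) i - l i))\<^sup>2) \<le> e\<^sup>2" if "finite F" for F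
    proof (rule LIMSEQ_le_const2)
      show "(\<lambda>m. \<Sum>i\<in>F. (cmod (coord (X n) i - coord (X m) i))\<^sup>2)
          \<longlonglongrightarrow> (\<Sum>i\<in>F. (cmod (coord (X n) i - l i))\<^sup>2)"
        by (intro tendsto_intros l)
      have "(\<Sum>i\<in>F. (cmod (coord (X n) i - coord (X m) i))\<^sup>2) \<le> e\<^sup>2" if "m \<ge> N" for m
        using sum_square_le_norm_l2[OF \<open>finite F\<close>, of "X n - X m"] N[OF that]
          power_mono[of "norm (X n - X m)" e 2] by simp
      then show "\<exists>N. \<forall>m\<ge>N. (\<Sum>i\<in>F. (cmod (coord (X n) i - coord (X m) i))\<^sup>2) \<le> e\<^sup>2"
        by blast
    qed
    then show ?thesis
      using l2_bound[of "\<lambda>i. coord (X n) i - l i" e] \<open>0 \<le> e\<close> by blast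
  qed
  have near: "\<exists>N. \<forall>n\<ge>N. (\<lambda>i. coord (X n) i - l i) \<in> ell2 \<and> norm (Abs_l2 (\<lambda>i. coord (X n) i - l i)) \<le> e"
    if "0 < e" for e
  proof -
    obtain N where "\<And>m n. m \<ge> N \<Longrightarrow> n \<ge> N \<Longrightarrow> norm (X m - X n) < e"
      using X \<open>0 < e\<close> unfolding Cauchy_iff by blast
    then have "norm (X n - X m) \<le> e" if "n \<ge> N" "m \<ge> N" for n m
      using that by (simp add: less_imp_le)
    then show ?thesis
      using tail[of N _ e] \<open>0 < e\<close> by (intro exI[of _ N] allI impI) simp
  qed
  have l_ell2: "l \<in> ell2"
  proof -
    obtain n where "(\<lambda>i. coord (X n) i - l i) \<in> ell2"
      using near[of 1] by auto
    then have "(\<lambda>i. - (coord (X n) i - l i)) \<in> ell2"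
      by (simp only: ell2_iff norm_minus_cancel)
    from ell2_add[OF coord_in_ell2[of "X n"] this] show ?thesis by simp
  qed
  have "X \<longlonglongrightarrow> Abs_l2 l"
  proof (rule LIMSEQ_I)
    fix e :: real assume "0 < e"
    obtain N where N: "\<And>n. n \<ge> N \<Longrightarrow> norm (Abs_l2 (\<lambda>i. coord (X n) i - l i)) \<le> e / 2"
        "\<And>n. n \<ge> N \<Longrightarrow> (\<lambda>i. coord (X n) i - l i) \<in> ell2"
      using near[of "e/2"] \<open>0 < e\<close> by auto
    have "X n - Abs_l2 l = Abs_l2 (\<lambda>i. coord (X n) i - l i)" if "n \<ge> N" for n
      by (rule l2_eqI) (simp add: N that l_ell2)
    then have "norm (X n - Abs_l2 l) < e" if "n \<ge> N" for n
      using N(1)[OF that] \<open>0 < e\<close> that by simp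
    then show "\<exists>N. \<forall>n\<ge>N. norm (X n - Abs_l2 l) < e" by blast
  qed
  then show "convergent X" by (auto simp: convergent_def)
qed

section \<open>Multiplication and reindexing operators\<close>

lemma bounded_linear_Abs_l2:
  assumes "\<And>x. f x \<in> ell2 \<and> ell2_norm (f x) \<le> K * norm x"
    and "\<And>x y i. f (x + y) i = f x i + f y i" "\<And>r x i. f (r *\<^sub>R x) i = r *\<^sub>R f x i"
  shows "bounded_linear (\<lambda>x. Abs_l2 (f x))"
  by (rule bounded_linear_intro[where K = K])
     (use assms in \<open>auto intro!: l2_eqI simp: norm_l2_eq mult.commute\<close>)

text \<open>The operator is 0 unless \<open>f\<close> is bounded.\<close>

definition mult_op :: "('i \<Rightarrow> complex) \<Rightarrow> 'i l2 \<Rightarrow>\<^sub>L 'i l2" where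
  "mult_op f = (if bounded (range f) then Blinfun (\<lambda>x. Abs_l2 (\<lambda>i. f i * coord x i)) else 0)"

lemma mult_op:
  assumes f: "\<And>i. cmod (f i) \<le> K"
  shows coord_mult_op: "coord (mult_op f x) i = f i * coord x i"
    and norm_mult_op_le: "norm (mult_op f) \<le> K"
proof -
  have "0 \<le> K" using f[of undefined] norm_ge_zero order_trans by blast
  have bd: "bounded (range f)" using f by (auto simp: bounded_iff)
  have sq: "(cmod (f i * coord x i))\<^sup>2 \<le> K\<^sup>2 * (cmod (coord x i))\<^sup>2" for x i
    using power_mono[OF mult_right_mono[OF f[of i], of "cmod (coord x i)"], of 2]
    by (simp add: power_mult_distrib norm_mult)
  have *: "(\<lambda>i. f i * coord x i) \<in> ell2 \<and> norm (Abs_l2 (\<lambda>i. f i * coord x i)) \<le> K * norm x" for x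
  proof -
    have "(\<Sum>i\<in>F. (cmod (f i * coord x i))\<^sup>2) \<le> (K * norm x)\<^sup>2" if "finite F" for F
    proof -
      have "(\<Sum>i\<in>F. (cmod (f i * coord x i))\<^sup>2) \<le> K\<^sup>2 * (\<Sum>i\<in>F. (cmod (coord x i))\<^sup>2)"
        unfolding sum_distrib_left by (intro sum_mono sq)
      also have "\<dots> \<le> K\<^sup>2 * (norm x)\<^sup>2"
        by (intro mult_left_mono sum_square_le_norm_l2 that) simp
      finally show ?thesis by (simp add: power_mult_distrib)
    qed
    then show ?thesis
      using l2_bound[of "\<lambda>i. f i * coord x i" "K * norm x"] \<open>0 \<le> K\<close> by simp
  qed
  have **: "(\<lambda>i. f i * coord x i) \<in> ell2 \<and> ell2_norm (\<lambda>i. f i * coord x i) \<le> K * norm x" for x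
    using *[of x] by (metis norm_l2_eq coord_Abs)
  have bl: "bounded_linear (\<lambda>x. Abs_l2 (\<lambda>i. f i * coord x i))"
    by (rule bounded_linear_Abs_l2[where K = K]) (simp_all add: ** algebra_simps)
  have app: "mult_op f x = Abs_l2 (\<lambda>i. f i * coord x i)" for x
    using bd bl by (simp add: mult_op_def bounded_linear_Blinfun_apply)
  show "coord (mult_op f x) i = f i * coord x i"
    using * by (simp add: app)
  show "norm (mult_op f) \<le> K"
    using * \<open>0 \<le> K\<close> by (intro norm_blinfun_bound) (simp_all add: app)
qed

definition reindex_op :: "('i \<Rightarrow> 'i) \<Rightarrow> 'i l2 \<Rightarrow>\<^sub>L 'i l2" where
  "reindex_op \<pi> = (if bij \<pi> then Blinfun (\<lambda>x. Abs_l2 (\<lambda>i. coord x (\<pi> i))) else 0)"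

lemma reindex_op:
  assumes "bij \<pi>"
  shows coord_reindex_op: "coord (reindex_op \<pi> x) i = coord x (\<pi> i)"
    and norm_reindex_op_apply: "norm (reindex_op \<pi> x) = norm x"
proof -
  have "((\<lambda>i. (cmod (coord x (\<pi> i)))\<^sup>2) has_sum (norm x)\<^sup>2) UNIV" for x
    using has_sum_reindex_bij_betw[OF assms, of "\<lambda>i. (cmod (coord x i))\<^sup>2"]
    by (simp add: norm_l2_square coord_summable)
  note hs = this
  have *: "(\<lambda>i. coord x (\<pi> i)) \<in> ell2" "norm (Abs_l2 (\<lambda>i. coord x (\<pi> i))) = norm x" for x
  proof -
    show 1: "(\<lambda>i. coord x (\<pi> i)) \<in> ell2"
      using has_sum_imp_summable[OF hs[of x]] by (simp add: ell2_iff)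
    show "norm (Abs_l2 (\<lambda>i. coord x (\<pi> i))) = norm x"
      using infsumI[OF hs[of x]] by (simp add: norm_l2_eq[of "Abs_l2 _"] 1 ell2_norm_def)
  qed
  have bl: "bounded_linear (\<lambda>x. Abs_l2 (\<lambda>i. coord x (\<pi> i)))"
    by (rule bounded_linear_Abs_l2[where K = 1]) (use * in \<open>auto simp: norm_l2_eq\<close>)
  have app: "reindex_op \<pi> x = Abs_l2 (\<lambda>i. coord x (\<pi> i))" for x
    using assms bl by (simp add: reindex_op_def bounded_linear_Blinfun_apply)
  show "coord (reindex_op \<pi> x) i = coord x (\<pi> i)" "norm (reindex_op \<pi> x) = norm x"
    by (simp_all add: app *)
qed

lemma norm_reindex_op_le: "bij \<pi> \<Longrightarrow> norm (reindex_op \<pi>) \<le> 1"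
  by (rule norm_blinfun_bound) (simp_all add: norm_reindex_op_apply)

section \<open>Banach spaces of power series\<close>

instantiation nat :: metric_space
begin

text \<open>Distinct points are at distance at least 1, so every function on \<open>nat\<close> is
  continuous and \<open>bcontfun\<close> becomes the complete space of all bounded
  sequences.\<close>

definition dist_nat :: "nat \<Rightarrow> nat \<Rightarrow> real" where
  "dist_nat m n = \<bar>real m - real n\<bar>"
definition uniformity_nat :: "(nat \<times> nat) filter" where
  "uniformity_nat = (INF e\<in>{0 <..}. principal {(m, n). dist m n < e})"

instance
proof
  fix U :: "nat set" and x y z :: nat
  have near: "m = n" if "\<bar>real m - real n\<bar> < 1" for m n
    using that by linarith
  have "eventually (\<lambda>(x', y). x' = x \<longrightarrow> y \<in> U) uniformity" if "x \<in> U" for x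
    unfolding uniformity_nat_def
    by (rule eventually_INF1[of 1]) (use that near in \<open>auto simp: eventually_principal dist_nat_def\<close>)
  then show "open U \<longleftrightarrow> (\<forall>x\<in>U. eventually (\<lambda>(x', y). x' = x \<longrightarrow> y \<in> U) uniformity)"
    by (simp add: open_discrete)
  show "dist x y \<le> dist x z + dist y z" by (simp add: dist_nat_def)
qed (auto simp: dist_nat_def uniformity_nat_def)

end

instance bcontfun :: (metric_space, banach) banach ..

text \<open>
  A bounded sequence \<open>F\<close> stands for the power series whose \<open>k\<close>-th coefficient is
  \<open>F k / (k + 1)\<^sup>2\<close>.  With this weight the sup norm makes the Cauchy product of any bounded
  bilinear map bounded, and completeness comes for free.
\<close>

definition ser_coeff :: "(nat \<Rightarrow>\<^sub>C 'a::real_normed_vector) \<Rightarrow> nat \<Rightarrow> 'a" where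
  "ser_coeff F k = inverse ((real (Suc k))\<^sup>2) *\<^sub>R apply_bcontfun F k"

definition mk_ser :: "(nat \<Rightarrow> 'a::real_normed_vector) \<Rightarrow> nat \<Rightarrow>\<^sub>C 'a" where
  "mk_ser a = Bcontfun (\<lambda>k. (real (Suc k))\<^sup>2 *\<^sub>R a k)"

lemma mk_ser:
  assumes "\<And>k. (real (Suc k))\<^sup>2 * norm (a k) \<le> M"
  shows ser_coeff_mk_ser: "ser_coeff (mk_ser a) k = a k"
    and norm_mk_ser_le: "norm (mk_ser a) \<le> M"
proof -
  have "(\<lambda>k. (real (Suc k))\<^sup>2 *\<^sub>R a k) \<in> bcontfun"
    by (rule bcontfun_normI[where b = M]) (use assms in auto)
  then have *: "apply_bcontfun (mk_ser a) k = (real (Suc k))\<^sup>2 *\<^sub>R a k" for k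
    by (simp add: mk_ser_def Bcontfun_inverse)
  show "ser_coeff (mk_ser a) k = a k"
    by (simp add: ser_coeff_def * del: of_nat_Suc)
  show "norm (mk_ser a) \<le> M"
    by (rule norm_bound) (use assms in \<open>simp add: *\<close>)
qed

lemma norm_ser_coeff_le: "norm (ser_coeff F k) \<le> norm F * inverse ((real (Suc k))\<^sup>2)"
  using norm_bounded[of F k]
  by (simp add: ser_coeff_def mult.commute mult_left_mono del: of_nat_Suc)

lemma ser_coeff_add: "ser_coeff (F + G) k = ser_coeff F k + ser_coeff G k"
  and ser_coeff_diff: "ser_coeff (F - G) k = ser_coeff F k - ser_coeff G k"
  and ser_coeff_scaleR: "ser_coeff (r *\<^sub>R F) k = r *\<^sub>R ser_coeff F k"
  and ser_coeff_zero: "ser_coeff 0 k = 0"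
  by (simp_all add: ser_coeff_def algebra_simps)

lemma ser_eqI:
  assumes "\<And>k. ser_coeff F k = ser_coeff G k"
  shows "F = G"
  by (rule bcontfun_eqI) (use assms in \<open>simp add: ser_coeff_def del: of_nat_Suc\<close>)

definition inv_squares_sum :: real where
  "inv_squares_sum = (\<Sum>k. inverse ((real (Suc k))\<^sup>2))"

lemma summable_inv_squares: "summable (\<lambda>k. inverse ((real (Suc k))\<^sup>2))"
  using inverse_power_summable[of 2, where 'a = real] by (subst summable_Suc_iff) simp

lemma inv_squares_sum_ge: "(\<Sum>k<n. inverse ((real (Suc k))\<^sup>2)) \<le> inv_squares_sum"
  unfolding inv_squares_sum_def by (rule sum_le_suminf[OF summable_inv_squares]) auto

lemma inv_squares_sum_pos: "1 \<le> inv_squares_sum"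
  using inv_squares_sum_ge[of 1] by simp

text \<open>The weights 1/(k+1)^2 dominate the terms on the whole closed interval |t| \<le> 1,
  endpoints included; parameter increments are rescaled to this interval.\<close>

definition ser_eval :: "(nat \<Rightarrow>\<^sub>C 'a::banach) \<Rightarrow> real \<Rightarrow> 'a" where
  "ser_eval F t = (\<Sum>k. t ^ k *\<^sub>R ser_coeff F k)"

lemma norm_ser_term_le:
  assumes "\<bar>t\<bar> \<le> 1"
  shows "norm (t ^ k *\<^sub>R ser_coeff F k) \<le> norm F * inverse ((real (Suc k))\<^sup>2)"
proof -
  have "norm (t ^ k *\<^sub>R ser_coeff F k) \<le> 1 * norm (ser_coeff F k)"
    unfolding norm_scaleR using assms by (intro mult_right_mono) (auto simp: power_abs power_le_one)
  then show ?thesis using norm_ser_coeff_le[of F k] by linarith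
qed

lemma summable_norm_ser:
  assumes "\<bar>t\<bar> \<le> 1"
  shows "summable (\<lambda>k. norm (t ^ k *\<^sub>R ser_coeff F k))"
  by (rule summable_comparison_test'[OF summable_mult[OF summable_inv_squares, of "norm F"]])
     (use norm_ser_term_le[OF assms] in auto)

lemma ser_eval_sums:
  assumes "\<bar>t\<bar> \<le> 1"
  shows "(\<lambda>k. t ^ k *\<^sub>R ser_coeff F k) sums ser_eval F t"
  unfolding ser_eval_def using summable_norm_cancel[OF summable_norm_ser[OF assms]]
  by (rule summable_sums)

lemma ser_eval_add:
  assumes "\<bar>t\<bar> \<le> 1" shows "ser_eval (F + G) t = ser_eval F t + ser_eval G t"
  using sums_add[OF ser_eval_sums[OF assms, of F] ser_eval_sums[OF assms, of G]]
    ser_eval_sums[OF assms, of "F + G"]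
  by (simp add: ser_coeff_add scaleR_right_distrib sums_unique2)

lemma ser_eval_diff:
  assumes "\<bar>t\<bar> \<le> 1" shows "ser_eval (F - G) t = ser_eval F t - ser_eval G t"
  using sums_diff[OF ser_eval_sums[OF assms, of F] ser_eval_sums[OF assms, of G]]
    ser_eval_sums[OF assms, of "F - G"]
  by (simp add: ser_coeff_diff scaleR_right_diff_distrib sums_unique2)

lemma norm_ser_eval_le:
  assumes "\<bar>t\<bar> \<le> 1"
  shows "norm (ser_eval F t) \<le> norm F * inv_squares_sum"
proof -
  have "norm (ser_eval F t) \<le> (\<Sum>k. norm (t ^ k *\<^sub>R ser_coeff F k))"
    unfolding ser_eval_def by (rule summable_norm[OF summable_norm_ser[OF assms]])
  also have "\<dots> \<le> (\<Sum>k. norm F * inverse ((real (Suc k))\<^sup>2))"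
    by (rule suminf_le[OF norm_ser_term_le[OF assms] summable_norm_ser[OF assms]])
      (rule summable_mult[OF summable_inv_squares])
  finally show ?thesis
    unfolding suminf_mult[OF summable_inv_squares] inv_squares_sum_def .
qed

definition ser_const :: "'a::real_normed_vector \<Rightarrow> nat \<Rightarrow>\<^sub>C 'a" where
  "ser_const c = mk_ser (\<lambda>k. if k = 0 then c else 0)"

lemma ser_coeff_const: "ser_coeff (ser_const c) k = (if k = 0 then c else 0)"
  unfolding ser_const_def by (rule ser_coeff_mk_ser[where M = "norm c"]) simp

lemma norm_ser_const: "norm (ser_const c) = norm c"
proof (rule antisym)
  show "norm (ser_const c) \<le> norm c"
    unfolding ser_const_def by (rule norm_mk_ser_le) simp
  show "norm c \<le> norm (ser_const c)"
    using norm_ser_coeff_le[of "ser_const c" 0] by (simp add: ser_coeff_const)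
qed

lemma ser_const_add: "ser_const (a + b) = ser_const a + ser_const b"
  and ser_const_diff: "ser_const (a - b) = ser_const a - ser_const b"
  and ser_const_zero: "ser_const 0 = 0"
  by (rule ser_eqI, simp add: ser_coeff_const ser_coeff_add ser_coeff_diff ser_coeff_zero)+

lemma ser_eval_const: "\<bar>t\<bar> \<le> 1 \<Longrightarrow> ser_eval (ser_const c) t = c"
  using sums_unique2[OF ser_eval_sums[of t "ser_const c"]] sums_single[of 0 "\<lambda>k. t ^ k *\<^sub>R c"]
  by (simp add: ser_coeff_const if_distrib cong: if_cong)

lemma ser_eval_at_zero: "ser_eval F 0 = ser_coeff F 0"
proof -
  have "(\<lambda>k. 0 ^ k *\<^sub>R ser_coeff F k) = (\<lambda>k. if k = 0 then ser_coeff F 0 else 0)" by auto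
  then show ?thesis
    using sums_unique2[OF ser_eval_sums[of 0 F]] sums_single[of 0 "\<lambda>k. ser_coeff F 0"] by simp
qed

lemma ser_const_inject: "ser_const a = ser_const b \<longleftrightarrow> a = b"
  by (metis ser_coeff_const)

section \<open>Cauchy products of series\<close>

definition ser_conv :: "('a::real_normed_vector \<Rightarrow> 'b::real_normed_vector \<Rightarrow> 'c::real_normed_vector)
    \<Rightarrow> (nat \<Rightarrow>\<^sub>C 'a) \<Rightarrow> (nat \<Rightarrow>\<^sub>C 'b) \<Rightarrow> nat \<Rightarrow>\<^sub>C 'c" where
  "ser_conv pr F G = mk_ser (\<lambda>k. \<Sum>i\<le>k. pr (ser_coeff F i) (ser_coeff G (k - i)))"

text \<open>With a = i + 1 and b = k - i + 1 one has (k+1)^2 \<le> (a+b)^2 \<le> 4 (a^2 + b^2);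
  divide by a^2 b^2. The product of two weights is thus the weight at k times a sum of summable
  weights, which is what makes Cauchy products bounded.\<close>

lemma inverse_square_mult_le:
  assumes "i \<le> k"
  shows "inverse ((real (Suc i))\<^sup>2) * inverse ((real (Suc (k - i)))\<^sup>2)
    \<le> 4 * inverse ((real (Suc k))\<^sup>2) * (inverse ((real (Suc i))\<^sup>2) + inverse ((real (Suc (k - i)))\<^sup>2))"
proof -
  define a b where "a = real (Suc i)" and "b = real (Suc (k - i))"
  have ab: "0 < a" "0 < b" "real (Suc k) \<le> a + b" "0 < real (Suc k)"
    using assms by (auto simp: a_def b_def of_nat_diff)
  have "(real (Suc k))\<^sup>2 \<le> (a + b)\<^sup>2" using ab by (intro power_mono) auto
  also have "\<dots> \<le> 4 * (a\<^sup>2 + b\<^sup>2)"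
    using zero_le_power2[of "a - b"] zero_le_power2[of "a + b"] by (simp add: power2_eq_square algebra_simps)
  finally have *: "(real (Suc k))\<^sup>2 \<le> 4 * (a\<^sup>2 + b\<^sup>2)" .
  have "inverse (a\<^sup>2) * inverse (b\<^sup>2) * (real (Suc k))\<^sup>2 \<le> inverse (a\<^sup>2) * inverse (b\<^sup>2) * (4 * (a\<^sup>2 + b\<^sup>2))"
    by (rule mult_left_mono[OF *]) simp
  also have "\<dots> = 4 * (inverse (a\<^sup>2) + inverse (b\<^sup>2))"
    using ab by (simp add: field_simps)
  finally show ?thesis
    using ab(4) unfolding a_def[symmetric] b_def[symmetric] by (simp add: field_simps del: of_nat_Suc)
qed

text \<open>The factor 8 is the 4 of the weight inequality times the two weight sums over i, each at
  most \<open>inv_squares_sum\<close>.\<close>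

lemma ser_conv_bound:
  fixes pr :: "'a::real_normed_vector \<Rightarrow> 'b::real_normed_vector \<Rightarrow> 'c::real_normed_vector"
  assumes pr: "\<And>a b. norm (pr a b) \<le> norm a * norm b * K" and "0 \<le> K"
  shows "(real (Suc k))\<^sup>2 * norm (\<Sum>i\<le>k. pr (ser_coeff F i) (ser_coeff G (k - i)))
    \<le> norm F * norm G * (8 * inv_squares_sum * K)"
proof -
  let ?w = "\<lambda>i. inverse ((real (Suc i))\<^sup>2)"
  have "norm (\<Sum>i\<le>k. pr (ser_coeff F i) (ser_coeff G (k - i)))
      \<le> (\<Sum>i\<le>k. norm F * norm G * K * (4 * ?w k) * (?w i + ?w (k - i)))"
  proof (rule sum_norm_le)
    fix i assume "i \<in> {..k}"
    then have "i \<le> k" by simp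
    have "norm (pr (ser_coeff F i) (ser_coeff G (k - i))) \<le> (norm F * ?w i) * (norm G * ?w (k - i)) * K"
      by (rule order_trans[OF pr])
        (intro mult_right_mono mult_mono norm_ser_coeff_le \<open>0 \<le> K\<close>, auto)
    also have "\<dots> = norm F * norm G * K * (?w i * ?w (k - i))" by (simp only: mult_ac)
    also have "\<dots> \<le> norm F * norm G * K * (4 * ?w k * (?w i + ?w (k - i)))"
      by (intro mult_left_mono inverse_square_mult_le \<open>i \<le> k\<close>) (simp add: \<open>0 \<le> K\<close>)
    finally show "norm (pr (ser_coeff F i) (ser_coeff G (k - i)))
        \<le> norm F * norm G * K * (4 * ?w k) * (?w i + ?w (k - i))" by (simp only: mult_ac)
  qed
  also have "\<dots> = norm F * norm G * K * (4 * ?w k) * ((\<Sum>i\<le>k. ?w i) + (\<Sum>i\<le>k. ?w (k - i)))"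
    by (subst sum_distrib_left[symmetric]) (simp only: sum.distrib)
  also have "(\<Sum>i\<le>k. ?w (k - i)) = (\<Sum>i\<le>k. ?w i)"
    by (rule sum.reindex_bij_witness[of _ "\<lambda>i. k - i" "\<lambda>i. k - i"]) auto
  also have "norm F * norm G * K * (4 * ?w k) * ((\<Sum>i\<le>k. ?w i) + (\<Sum>i\<le>k. ?w i))
      \<le> norm F * norm G * K * (4 * ?w k) * (inv_squares_sum + inv_squares_sum)"
    using inv_squares_sum_ge[of "Suc k"] \<open>0 \<le> K\<close>
    by (intro mult_left_mono add_mono) (auto simp: lessThan_Suc_atMost simp del: of_nat_Suc)
  finally have "norm (\<Sum>i\<le>k. pr (ser_coeff F i) (ser_coeff G (k - i)))
      \<le> ?w k * (norm F * norm G * (8 * inv_squares_sum * K))" by (simp add: algebra_simps)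
  from mult_left_mono[OF this, of "(real (Suc k))\<^sup>2"] show ?thesis
    by (simp add: mult.assoc[symmetric] del: of_nat_Suc)
qed

context bounded_bilinear
begin

lemma ser_coeff_conv:
  "ser_coeff (ser_conv prod F G) k = (\<Sum>i\<le>k. prod (ser_coeff F i) (ser_coeff G (k - i)))"
proof -
  obtain K where "0 \<le> K" "\<And>a b. norm (prod a b) \<le> norm a * norm b * K"
    using nonneg_bounded by blast
  from ser_conv_bound[OF this(2,1)] show ?thesis
    unfolding ser_conv_def by (rule ser_coeff_mk_ser)
qed

lemma bounded_bilinear_ser_conv: "bounded_bilinear (ser_conv prod)"
proof
  obtain K where K: "0 \<le> K" "\<And>a b. norm (prod a b) \<le> norm a * norm b * K"
    using nonneg_bounded by blast
  show "\<exists>K. \<forall>F G. norm (ser_conv prod F G) \<le> norm F * norm G * K"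
    using norm_mk_ser_le[OF ser_conv_bound[OF K(2,1)]] unfolding ser_conv_def by blast
qed (rule ser_eqI, simp add: ser_coeff_conv ser_coeff_add ser_coeff_scaleR add_left add_right
    scaleR_left scaleR_right sum.distrib scaleR_sum_right)+

lemma ser_coeff_conv_const_left:
  "ser_coeff (ser_conv prod (ser_const c) G) k = prod c (ser_coeff G k)"
proof -
  have "ser_coeff (ser_conv prod (ser_const c) G) k
      = (\<Sum>i\<le>k. if i = 0 then prod c (ser_coeff G k) else 0)"
    unfolding ser_coeff_conv by (rule sum.cong) (auto simp: ser_coeff_const zero_left)
  then show ?thesis by simp
qed

lemma ser_coeff_conv_const_right:
  "ser_coeff (ser_conv prod F (ser_const c)) k = prod (ser_coeff F k) c"
proof -
  have "ser_coeff (ser_conv prod F (ser_const c)) k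
      = (\<Sum>i\<le>k. if i = k then prod (ser_coeff F k) c else 0)"
    unfolding ser_coeff_conv by (rule sum.cong) (auto simp: ser_coeff_const zero_right)
  then show ?thesis by simp
qed

lemma ser_conv_const: "ser_conv prod (ser_const a) (ser_const b) = ser_const (prod a b)"
  by (rule ser_eqI) (simp add: ser_coeff_conv_const_left ser_coeff_const zero_right)

end

text \<open>The double family of products is absolutely summable. Summed by rows it gives the
  product of the two values, summed along antidiagonals it gives the series of the
  convolution.\<close>

lemma ser_eval_conv:
  fixes prod :: "'a::banach \<Rightarrow> 'b::banach \<Rightarrow> 'c::banach"
  assumes "bounded_bilinear prod" and t: "\<bar>t\<bar> \<le> 1"
  shows "ser_eval (ser_conv prod F G) t = prod (ser_eval F t) (ser_eval G t)"
proof -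
  interpret bounded_bilinear prod by fact
  define a where "a = (\<lambda>i. t ^ i *\<^sub>R ser_coeff F i)"
  define b where "b = (\<lambda>i. t ^ i *\<^sub>R ser_coeff G i)"
  define h where "h = (\<lambda>(i, j). prod (a i) (b j))"
  obtain K where K: "0 \<le> K" "\<And>x y. norm (prod x y) \<le> norm x * norm y * K"
    using nonneg_bounded by blast
  have na: "summable (\<lambda>i. norm (a i))" and nb: "summable (\<lambda>i. norm (b i))"
    unfolding a_def b_def by (intro summable_norm_ser t)+
  have a: "(a has_sum ser_eval F t) UNIV" and b: "(b has_sum ser_eval G t) UNIV"
    using norm_summable_imp_has_sum[OF na] norm_summable_imp_has_sum[OF nb] ser_eval_sums[OF t]
    by (auto simp: a_def b_def)
  have na': "((\<lambda>i. norm (a i)) has_sum (\<Sum>i. norm (a i))) UNIV"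
    and nb': "((\<lambda>i. norm (b i)) has_sum (\<Sum>i. norm (b i))) UNIV"
    using na nb by (auto intro!: norm_summable_imp_has_sum summable_sums)
  have "(\<lambda>(i, j). norm (a i) * (norm (b j) * K)) summable_on (UNIV \<times> UNIV)"
    by (rule summable_on_SigmaI[where g = "\<lambda>i. norm (a i) * ((\<Sum>j. norm (b j)) * K)"])
      (use na' nb' K(1) in \<open>auto intro!: has_sum_cmult_right has_sum_cmult_left
        summable_on_cmult_left simp: has_sum_imp_summable\<close>)
  then have "(\<lambda>p. norm (h p)) summable_on (UNIV \<times> UNIV)"
    by (rule summable_on_comparison_test) (use K(2) in \<open>auto simp: h_def mult.assoc\<close>)
  then have "h summable_on UNIV \<times> UNIV"
    using abs_summable_summable by blast
  then obtain S where S: "(h has_sum S) (UNIV \<times> UNIV)" by (auto simp: summable_on_def)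
  have "((\<lambda>i. prod (a i) (ser_eval G t)) has_sum S) UNIV"
    using S by (rule has_sum_SigmaD) (auto simp: h_def intro: has_sum_bounded_linear[OF bounded_linear_right b])
  moreover have "((\<lambda>i. prod (a i) (ser_eval G t)) has_sum prod (ser_eval F t) (ser_eval G t)) UNIV"
    by (rule has_sum_bounded_linear[OF bounded_linear_left a])
  ultimately have S_eq: "S = prod (ser_eval F t) (ser_eval G t)"
    by (rule has_sum_unique)
  \<comment> \<open>The bijection (i, j) to (i + j, i) turns the quadrant into the region i \<le> k,
    whose rows are the antidiagonals.\<close>
  have "((\<lambda>(k, i). prod (a i) (b (k - i))) has_sum S) (SIGMA k:UNIV. {..k})"
    using S by (subst has_sum_reindex_bij_witness[of _ "\<lambda>(i, j). (i + j, i)" "\<lambda>(k, i). (i, k - i)"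
          "UNIV \<times> UNIV" h _ S S]) (auto simp: h_def)
  then have "((\<lambda>k. \<Sum>i\<le>k. prod (a i) (b (k - i))) has_sum S) UNIV"
    by (rule has_sum_SigmaD) (auto intro!: has_sum_finite)
  then have "(\<lambda>k. \<Sum>i\<le>k. prod (a i) (b (k - i))) sums S"
    by (rule has_sum_imp_sums)
  moreover have "(\<Sum>i\<le>k. prod (a i) (b (k - i))) = t ^ k *\<^sub>R ser_coeff (ser_conv prod F G) k" for k
    unfolding ser_coeff_conv scaleR_sum_right
    by (rule sum.cong) (auto simp: a_def b_def scaleR_left scaleR_right power_add[symmetric])
  ultimately show ?thesis
    using ser_eval_sums[OF t, of "ser_conv prod F G"] S_eq by (simp add: sums_unique2)
qed

section \<open>Rescaling and analytic functions of a real parameter\<close>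

definition ser_rescale :: "real \<Rightarrow> (nat \<Rightarrow>\<^sub>C 'a::real_normed_vector) \<Rightarrow> nat \<Rightarrow>\<^sub>C 'a" where
  "ser_rescale \<theta> F = mk_ser (\<lambda>k. \<theta> ^ k *\<^sub>R ser_coeff F k)"

text \<open>Replacing t by \<theta>t multiplies every coefficient except the constant one by at most
  \<theta>. A short parameter interval therefore becomes a small perturbation of a constant in the
  norm of the series space.\<close>

lemma ser_rescale:
  assumes "0 \<le> \<theta>" "\<theta> \<le> 1"
  shows ser_coeff_rescale: "ser_coeff (ser_rescale \<theta> F) k = \<theta> ^ k *\<^sub>R ser_coeff F k"
    and norm_ser_rescale_diff_le: "norm (ser_rescale \<theta> F - ser_const (ser_coeff F 0)) \<le> \<theta> * norm F"
proof -
  have le: "(real (Suc k))\<^sup>2 * norm (ser_coeff F k) \<le> norm F" for k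
    using mult_left_mono[OF norm_ser_coeff_le[of F k], of "(real (Suc k))\<^sup>2"]
    by (simp add: field_simps del: of_nat_Suc)
  have pk: "\<theta> ^ k \<le> 1" for k using assms by (simp add: power_le_one)
  have "(real (Suc k))\<^sup>2 * norm (\<theta> ^ k *\<^sub>R ser_coeff F k) \<le> norm F" for k
  proof -
    have "(real (Suc k))\<^sup>2 * norm (\<theta> ^ k *\<^sub>R ser_coeff F k) = \<theta> ^ k * ((real (Suc k))\<^sup>2 * norm (ser_coeff F k))"
      using assms by simp
    also have "\<dots> \<le> 1 * norm F"
      using assms by (intro mult_mono pk le) auto
    finally show ?thesis by simp
  qed
  from ser_coeff_mk_ser[OF this]
  show c: "ser_coeff (ser_rescale \<theta> F) k = \<theta> ^ k *\<^sub>R ser_coeff F k" for k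
    unfolding ser_rescale_def .
  have "ser_rescale \<theta> F - ser_const (ser_coeff F 0)
      = mk_ser (\<lambda>k. if k = 0 then 0 else \<theta> ^ k *\<^sub>R ser_coeff F k)"
    and "norm (mk_ser (\<lambda>k. if k = 0 then 0 else \<theta> ^ k *\<^sub>R ser_coeff F k)) \<le> \<theta> * norm F"
  proof -
    have *: "(real (Suc k))\<^sup>2 * norm (if k = 0 then 0 else \<theta> ^ k *\<^sub>R ser_coeff F k) \<le> \<theta> * norm F" for k
    proof (cases k)
      case (Suc j)
      have "(real (Suc k))\<^sup>2 * norm (\<theta> ^ k *\<^sub>R ser_coeff F k)
          = \<theta> * \<theta> ^ j * ((real (Suc k))\<^sup>2 * norm (ser_coeff F k))"
        using assms Suc by simp
      also have "\<dots> \<le> \<theta> * norm F"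
        using assms mult_mono[OF mult_left_mono[OF pk[of j], of \<theta>] le[of k]] by simp
      finally show ?thesis using Suc by simp
    qed (use assms in simp)
    show "norm (mk_ser (\<lambda>k. if k = 0 then 0 else \<theta> ^ k *\<^sub>R ser_coeff F k)) \<le> \<theta> * norm F"
      by (rule norm_mk_ser_le[OF *])
    show "ser_rescale \<theta> F - ser_const (ser_coeff F 0)
      = mk_ser (\<lambda>k. if k = 0 then 0 else \<theta> ^ k *\<^sub>R ser_coeff F k)"
      by (rule ser_eqI) (simp add: ser_coeff_mk_ser[OF *] ser_coeff_diff c ser_coeff_const)
  qed
  then show "norm (ser_rescale \<theta> F - ser_const (ser_coeff F 0)) \<le> \<theta> * norm F" by simp
qed

lemma ser_eval_rescale:
  assumes "0 \<le> \<theta>" "\<theta> \<le> 1"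
  shows "ser_eval (ser_rescale \<theta> F) t = ser_eval F (\<theta> * t)"
  by (simp add: ser_eval_def ser_coeff_rescale[OF assms] power_mult_distrib mult.commute)

text \<open>The affine change y = x + r t moves the expansion to |t| \<le> 1. The quadratic decay of
  coefficients built into the series type costs only a smaller r.\<close>

definition analytic_near :: "(real \<Rightarrow> 'a::banach) \<Rightarrow> real \<Rightarrow> bool" where
  "analytic_near f x \<longleftrightarrow> (\<exists>r>0. \<exists>F. \<forall>t. \<bar>t\<bar> \<le> 1 \<longrightarrow> f (x + r * t) = ser_eval F t)"

lemma analytic_near_rescaled:
  assumes "analytic_near f x" "0 < \<eta>"
  obtains r0 where "0 < r0"
    "\<And>r. 0 < r \<Longrightarrow> r \<le> r0 \<Longrightarrow> \<exists>F. (\<forall>t. \<bar>t\<bar> \<le> 1 \<longrightarrow> f (x + r * t) = ser_eval F t) \<and>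
       norm (F - ser_const (f x)) \<le> \<eta>"
proof -
  obtain R F where R: "0 < R" and F: "\<And>t. \<bar>t\<bar> \<le> 1 \<Longrightarrow> f (x + R * t) = ser_eval F t"
    using assms by (auto simp: analytic_near_def)
  \<comment> \<open>With \<theta> = r/R this gives \<theta> (norm F + 1) \<le> \<eta>; the 1 keeps
    the quotient meaningful for F = 0.\<close>
  define r0 where "r0 = min R (R * \<eta> / (norm F + 1))"
  show ?thesis
  proof
    show "0 < r0" using R assms(2) by (auto simp: r0_def intro!: divide_pos_pos add_nonneg_pos)
    fix r assume r: "0 < r" "r \<le> r0"
    define \<theta> where "\<theta> = r / R"
    have \<theta>: "0 \<le> \<theta>" "\<theta> \<le> 1" using r R by (auto simp: \<theta>_def r0_def)
    have f0: "f x = ser_coeff F 0" using F[of 0] by (simp add: ser_eval_at_zero)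
    have "\<theta> * (norm F + 1) \<le> \<eta>"
      using r R norm_ge_zero[of F] by (auto simp: \<theta>_def r0_def field_simps)
    then have "\<theta> * norm F \<le> \<eta>" using \<theta> by (simp add: algebra_simps)
    moreover have "f (x + r * t) = ser_eval (ser_rescale \<theta> F) t" if "\<bar>t\<bar> \<le> 1" for t
    proof -
      have "\<bar>\<theta> * t\<bar> \<le> 1" using that \<theta> by (simp add: abs_mult mult_le_one)
      from F[OF this] show ?thesis using R by (simp add: ser_eval_rescale[OF \<theta>]) (simp add: \<theta>_def)
    qed
    ultimately show "\<exists>F. (\<forall>t. \<bar>t\<bar> \<le> 1 \<longrightarrow> f (x + r * t) = ser_eval F t) \<and>
       norm (F - ser_const (f x)) \<le> \<eta>"
      using norm_ser_rescale_diff_le[OF \<theta>, of F] f0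
      by (intro exI[of _ "ser_rescale \<theta> F"]) auto
  qed
qed

lemma analytic_near_const: "analytic_near (\<lambda>_. c) x"
  unfolding analytic_near_def by (intro exI[of _ 1] exI[of _ "ser_const c"] conjI) (auto simp: ser_eval_const)

text \<open>Halving the radius gains a factor 2^(-k) in the k-th coefficient, and this absorbs the
  weight (k+1)^2.\<close>

lemma analytic_near_power_series:
  assumes "0 < r" "\<And>k. norm (a k) * r ^ k \<le> M"
    and f: "\<And>t. \<bar>t\<bar> < r \<Longrightarrow> (\<lambda>k. t ^ k *\<^sub>R a k) sums f (x + t)"
  shows "analytic_near f x"
proof -
  define s where "s = r / 2"
  \<comment> \<open>The lower-order terms close the induction: this quadratic at most doubles from k
    to k + 1 and equals 6 at k = 0, whereas (k+1)^2 itself first quadruples.\<close>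
  have "(real (Suc k))\<^sup>2 + 2 * real (Suc k) + 3 \<le> 6 * 2 ^ k" for k
  proof (induction k)
    case (Suc k)
    have "(real (Suc (Suc k)))\<^sup>2 + 2 * real (Suc (Suc k)) + 3
        \<le> 2 * ((real (Suc k))\<^sup>2 + 2 * real (Suc k) + 3)"
      by (simp add: power2_eq_square algebra_simps)
    with Suc show ?case by simp
  qed simp
  then have "(real (Suc k))\<^sup>2 \<le> 6 * 2 ^ k" for k
    using zero_le_power2[of "real (Suc k)"] by (smt (verit) of_nat_0_le_iff)
  then have B: "(real (Suc k))\<^sup>2 * (1/2) ^ k \<le> 6" for k
    by (simp add: power_divide field_simps)
  have M: "0 \<le> M" using order_trans[OF norm_ge_zero, of "a 0" M] assms(2)[of 0] by simp
  have *: "(real (Suc k))\<^sup>2 * norm (s ^ k *\<^sub>R a k) \<le> 6 * M" for k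
  proof -
    have "(real (Suc k))\<^sup>2 * norm (s ^ k *\<^sub>R a k) = ((real (Suc k))\<^sup>2 * (1/2) ^ k) * (norm (a k) * r ^ k)"
      using assms(1) by (simp add: s_def power_divide power_mult_distrib field_simps)
    also have "\<dots> \<le> 6 * M"
      using assms(1) by (intro mult_mono B assms(2)) auto
    finally show ?thesis .
  qed
  have "f (x + s * t) = ser_eval (mk_ser (\<lambda>k. s ^ k *\<^sub>R a k)) t" if "\<bar>t\<bar> \<le> 1" for t
  proof -
    have "\<bar>s * t\<bar> < r" using that assms(1)
      by (simp add: s_def abs_mult)
    from sums_unique[OF f[OF this]] show ?thesis
      by (simp add: ser_eval_def ser_coeff_mk_ser[OF *] power_mult_distrib mult.commute)
  qed
  moreover have "0 < s" using assms(1) by (simp add: s_def)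
  ultimately show ?thesis unfolding analytic_near_def by blast
qed

text \<open>The factors come with different radii, but both can be expanded on the smaller one,
  where the Cauchy product represents the result.\<close>

lemma analytic_near_bilinear:
  fixes pr :: "'a::banach \<Rightarrow> 'b::banach \<Rightarrow> 'c::banach"
  assumes "bounded_bilinear pr" "analytic_near f x" "analytic_near g x"
  shows "analytic_near (\<lambda>x. pr (f x) (g x)) x"
proof -
  obtain r1 where r1: "0 < r1" "\<And>r. 0 < r \<Longrightarrow> r \<le> r1 \<Longrightarrow> \<exists>F. (\<forall>t. \<bar>t\<bar> \<le> 1 \<longrightarrow> f (x + r * t) = ser_eval F t)"
    using analytic_near_rescaled[OF assms(2) zero_less_one] by metis
  obtain r2 where r2: "0 < r2" "\<And>r. 0 < r \<Longrightarrow> r \<le> r2 \<Longrightarrow> \<exists>F. (\<forall>t. \<bar>t\<bar> \<le> 1 \<longrightarrow> g (x + r * t) = ser_eval F t)"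
    using analytic_near_rescaled[OF assms(3) zero_less_one] by metis
  obtain F G where "\<forall>t. \<bar>t\<bar> \<le> 1 \<longrightarrow> f (x + min r1 r2 * t) = ser_eval F t"
      "\<forall>t. \<bar>t\<bar> \<le> 1 \<longrightarrow> g (x + min r1 r2 * t) = ser_eval G t"
    using r1(2)[of "min r1 r2"] r2(2)[of "min r1 r2"] r1(1) r2(1) by auto
  then show ?thesis
    unfolding analytic_near_def using r1(1) r2(1)
    by (intro exI[of _ "min r1 r2"] conjI exI[of _ "ser_conv pr F G"])
       (auto simp: ser_eval_conv[OF assms(1)])
qed

lemma analytic_near_add:
  assumes "analytic_near f x" "analytic_near g x"
  shows "analytic_near (\<lambda>x. f x + g x) x"
proof -
  obtain r1 where r1: "0 < r1" "\<And>r. 0 < r \<Longrightarrow> r \<le> r1 \<Longrightarrow> \<exists>F. (\<forall>t. \<bar>t\<bar> \<le> 1 \<longrightarrow> f (x + r * t) = ser_eval F t)"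
    using analytic_near_rescaled[OF assms(1) zero_less_one] by metis
  obtain r2 where r2: "0 < r2" "\<And>r. 0 < r \<Longrightarrow> r \<le> r2 \<Longrightarrow> \<exists>F. (\<forall>t. \<bar>t\<bar> \<le> 1 \<longrightarrow> g (x + r * t) = ser_eval F t)"
    using analytic_near_rescaled[OF assms(2) zero_less_one] by metis
  obtain F G where "\<forall>t. \<bar>t\<bar> \<le> 1 \<longrightarrow> f (x + min r1 r2 * t) = ser_eval F t"
      "\<forall>t. \<bar>t\<bar> \<le> 1 \<longrightarrow> g (x + min r1 r2 * t) = ser_eval G t"
    using r1(2)[of "min r1 r2"] r2(2)[of "min r1 r2"] r1(1) r2(1) by auto
  then show ?thesis
    unfolding analytic_near_def using r1(1) r2(1)
    by (intro exI[of _ "min r1 r2"] conjI exI[of _ "F + G"]) (auto simp: ser_eval_add)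
qed

lemma analytic_near_ident: "analytic_near (\<lambda>x. x) x"
proof (rule analytic_near_power_series[where r = 1 and a = "\<lambda>k. if k = 0 then x else if k = 1 then 1 else 0"
      and M = "max \<bar>x\<bar> 1"])
  fix t :: real
  have "(\<lambda>k. t ^ k *\<^sub>R (if k = 0 then x else if k = 1 then 1 else 0))
      sums (\<Sum>k\<in>{0, 1}. t ^ k *\<^sub>R (if k = 0 then x else if k = 1 then 1 else 0))"
    by (rule sums_finite) auto
  then show "(\<lambda>k. t ^ k *\<^sub>R (if k = 0 then x else if k = 1 then 1 else 0)) sums (x + t)"
    by simp
qed auto

lemma analytic_near_bounded_linear:
  assumes "bounded_linear h" "analytic_near f x"
  shows "analytic_near (\<lambda>x. h (f x)) x"
  using analytic_near_bilinear[OF bounded_bilinear_blinfun_apply analytic_near_const[of "Blinfun h"] assms(2)]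
  by (simp add: bounded_linear_Blinfun_apply assms(1))

section \<open>An implicit function theorem for quadratic pencils\<close>

text \<open>
  The eigenvalue equation \<open>(K0 + \<nu> K1 + \<nu>\<^sup>2 K2) x = 0\<close> with normalized \<open>x\<close> as one
  equation for one vector \<open>z\<close>.  Here \<open>mul z y\<close> stands for \<open>\<nu> y\<close>, where \<open>\<nu>\<close> is the
  component of \<open>z\<close> along \<open>X0\<close>; the rest of \<open>z\<close> is the correction of the eigenvector \<open>X0\<close>.
\<close>

definition pencil ::
  "('k \<Rightarrow> 'h \<Rightarrow> 'h) \<Rightarrow> ('h \<Rightarrow> 'h \<Rightarrow> 'h) \<Rightarrow> 'h::ab_group_add \<Rightarrow> 'k \<Rightarrow> 'k \<Rightarrow> 'k \<Rightarrow> 'h \<Rightarrow> 'h" where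
  "pencil app mul X0 K0 K1 K2 z = (let x = X0 + z - mul z X0 in
     app K0 x + app K1 (mul z x) + app K2 (mul z (mul z x)))"

text \<open>\<open>S\<close> is a left inverse of the derivative of the pencil at z = 0 for the
  limit coefficients (k0, k1, 0). Hence z - S (pencil z) has derivative zero there, and on a small
  ball it is a 1/2-contraction for all nearby coefficients. The bilinear maps are kept abstract so
  that the lemma applies to operators acting on power series, and \<delta>, \<rho>, C are fixed
  before the coefficients are.\<close>

lemma pencil_quasi_newton:
  fixes app :: "'k::real_normed_vector \<Rightarrow> 'h::banach \<Rightarrow> 'h" and mul :: "'h \<Rightarrow> 'h \<Rightarrow> 'h"
  assumes "bounded_bilinear app" "bounded_bilinear mul" "bounded_linear S"
    and S: "\<And>z. S (app k0 (z - mul z X0) + app k1 (mul z X0)) = z"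
    and k0: "app k0 X0 = 0"
  shows "\<exists>\<delta> \<rho> C. 0 < \<delta> \<and> 0 < \<rho> \<and> 0 \<le> C \<and>
    (\<forall>K0 K1 K2. norm (K0 - k0) \<le> \<delta> \<longrightarrow> norm (K1 - k1) \<le> \<delta> \<longrightarrow> norm K2 \<le> \<delta> \<longrightarrow>
      (\<exists>!z. norm z \<le> \<rho> \<and> S (pencil app mul X0 K0 K1 K2 z) = 0) \<and>
      (\<forall>z. norm z \<le> \<rho> \<longrightarrow> S (pencil app mul X0 K0 K1 K2 z) = 0 \<longrightarrow> norm z \<le> C * norm (K0 - k0)))"
proof -
  interpret app: bounded_bilinear app by fact
  interpret mul: bounded_bilinear mul by fact
  interpret S: bounded_linear S by fact
  obtain c1 where c1: "\<And>a b. norm (app a b) \<le> norm a * norm b * c1" using app.bounded by blast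
  obtain c2 where c2: "\<And>a b. norm (mul a b) \<le> norm a * norm b * c2" using mul.bounded by blast
  obtain c3 where c3: "\<And>a. norm (S a) \<le> norm a * c3" using S.bounded by blast
  \<comment> \<open>One constant dominates all norms, so that every estimate below is a power of
    c.\<close>
  define c where "c = Max {1, c1, c2, c3, norm X0, norm k1}"
  have c: "1 \<le> c" "c1 \<le> c" "c2 \<le> c" "c3 \<le> c" "norm X0 \<le> c" "norm k1 \<le> c"
    by (auto simp: c_def)
  have c0: "0 \<le> c" using c(1) by simp
  have app_le: "norm (app a b) \<le> c * (A * B)" if "norm a \<le> A" "norm b \<le> B" for a b A B
  proof -
    have "norm (app a b) \<le> norm a * norm b * c"
      by (rule order_trans[OF c1]) (intro mult_left_mono c, simp)
    also have "\<dots> \<le> A * B * c"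
      using that c0 by (intro mult_right_mono mult_mono) (auto intro: order_trans[OF norm_ge_zero])
    finally show ?thesis by (simp add: mult_ac)
  qed
  have mul_le: "norm (mul a b) \<le> c * (A * B)" if "norm a \<le> A" "norm b \<le> B" for a b A B
  proof -
    have "norm (mul a b) \<le> norm a * norm b * c"
      by (rule order_trans[OF c2]) (intro mult_left_mono c, simp)
    also have "\<dots> \<le> A * B * c"
      using that c0 by (intro mult_right_mono mult_mono) (auto intro: order_trans[OF norm_ge_zero])
    finally show ?thesis by (simp add: mult_ac)
  qed
  have S_le: "norm (S a) \<le> c * A" if "norm a \<le> A" for a A
  proof -
    have "norm (S a) \<le> norm a * c" by (rule order_trans[OF c3]) (intro mult_left_mono c, simp)
    also have "\<dots> \<le> A * c" using that c0 by (intro mult_right_mono) auto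
    finally show ?thesis by (simp add: mult_ac)
  qed
  \<comment> \<open>These make the Lipschitz constant 3/64 + 8/32 + 8/64 < 1/2, and c^3 \<delta> =
    \<rho>/2 exactly, so the image of 0 stays within half the radius and the ball is mapped into
    itself.\<close>
  define \<rho> where "\<rho> = 1 / (32 * c ^ 6)"
  define \<delta> where "\<delta> = 1 / (64 * c ^ 9)"
  have pc: "c ^ i \<le> c ^ j" if "i \<le> j" for i j using c(1) that by (rule power_increasing[rotated])
  have "0 < c" using c(1) by simp
  have \<rho>: "0 < \<rho>" "\<rho> \<le> 1" and \<delta>: "0 < \<delta>" "\<delta> \<le> 1"
    using \<open>0 < c\<close> one_le_power[OF c(1), of 6] one_le_power[OF c(1), of 9] by (auto simp: \<rho>_def \<delta>_def)
  have main: "(\<exists>!z. norm z \<le> \<rho> \<and> S (pencil app mul X0 K0 K1 K2 z) = 0) \<and>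
      (\<forall>z. norm z \<le> \<rho> \<longrightarrow> S (pencil app mul X0 K0 K1 K2 z) = 0 \<longrightarrow> norm z \<le> 2 * c ^ 3 * norm (K0 - k0))"
    if K: "norm (K0 - k0) \<le> \<delta>" "norm (K1 - k1) \<le> \<delta>" "norm K2 \<le> \<delta>" for K0 K1 K2 :: 'k
  proof -
    have K1: "norm K1 \<le> 2 * c"
      using norm_triangle_ineq[of "K1 - k1" k1] K(2) c \<delta> by simp
    define F where "F = pencil app mul X0 K0 K1 K2"
    define \<Phi> where "\<Phi> z = z - S (F z)" for z
    have lip: "norm (\<Phi> z - \<Phi> z') \<le> (1/2) * norm (z - z')" if z: "norm z \<le> \<rho>" "norm z' \<le> \<rho>" for z z'
    proof -
      define D y where "D = z - z'" and "y = z - mul z X0"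
      define x q where "x = X0 + y" and "q = D - mul D X0"
      define d where "d = norm D"
      have d: "norm D \<le> d" "0 \<le> d" by (simp_all add: d_def)
      \<comment> \<open>An exact expansion of the increment. After the derivative at the limit is
        removed, every remaining term contains a coefficient error or \<open>K2\<close>, of size
        \<delta>, or one of y and z', of size \<rho>.\<close>
      have lin: "F z - F z' - (app k0 (D - mul D X0) + app k1 (mul D X0))
         = app (K0 - k0) q + app (K1 - k1) (mul D X0) + app K1 (mul D y + mul z' q)
           + app K2 (mul D (mul z x) + (mul z' (mul D x) + mul z' (mul z' q)))"
      proof -
        define x' where "x' = X0 + (z' - mul z' X0)"
        have x: "x = x' + q" and z: "z = z' + D"
          by (simp_all add: x_def x'_def y_def q_def D_def mul.diff_left)
        have zx: "mul z x = mul z' x' + (mul D X0 + (mul D y + mul z' q))"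
          using arg_cong[OF x_def, of "mul D"]
          by (simp add: z mul.add_left) (simp add: x mul.add_right)
        have zzx: "mul z (mul z x) = mul z' (mul z' x') + (mul D (mul z x) + (mul z' (mul D x) + mul z' (mul z' q)))"
        proof -
          have "mul z (mul z x) = mul D (mul z x) + mul z' (mul z x)" by (simp add: z mul.add_left)
          also have "mul z' (mul z x) = mul z' (mul D x) + mul z' (mul z' x)"
            by (simp add: z mul.add_left mul.add_right)
          also have "mul z' (mul z' x) = mul z' (mul z' x') + mul z' (mul z' q)"
            by (simp add: x mul.add_right)
          finally show ?thesis by (simp only: add_ac)
        qed
        have "F z = app K0 x + app K1 (mul z x) + app K2 (mul z (mul z x))"
          by (simp add: F_def pencil_def Let_def x_def y_def add_diff_eq)
        moreover have "F z' = app K0 x' + app K1 (mul z' x') + app K2 (mul z' (mul z' x'))"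
          by (simp add: F_def pencil_def Let_def x'_def add_diff_eq)
        moreover have "app K0 x = app K0 x' + app K0 q" by (simp add: x app.add_right)
        moreover have "app K1 (mul z x) = app K1 (mul z' x') + (app K1 (mul D X0) + app K1 (mul D y + mul z' q))"
          by (simp only: zx app.add_right)
        moreover have "app K2 (mul z (mul z x)) = app K2 (mul z' (mul z' x'))
            + app K2 (mul D (mul z x) + (mul z' (mul D x) + mul z' (mul z' q)))"
          by (simp only: arg_cong[OF zzx, of "app K2"] app.add_right)
        moreover have "(s + q0 + (a1 + (a2 + a3)) + (b1 + b2)) - (s + a1 + b1) - (q1 + d1)
            = (q0 - q1) + (a2 - d1) + a3 + b2" for s q0 a1 a2 a3 b1 b2 q1 d1 :: 'h
          by (simp add: algebra_simps)
        ultimately show ?thesis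
          unfolding q_def[symmetric] app.diff_left by metis
      qed
      have "norm (mul D X0) \<le> c * (d * c)" by (intro mul_le d c)
      moreover have "norm q \<le> norm D + norm (mul D X0)" unfolding q_def by (rule norm_triangle_ineq4)
      ultimately have q: "norm q \<le> d + c * (d * c)" and DX: "norm (mul D X0) \<le> d * c^2"
        using d by (auto simp: power2_eq_square mult_ac)
      have c2: "1 \<le> c\<^sup>2" using one_le_power[OF c(1)] .
      have q: "norm q \<le> 2 * c\<^sup>2 * d"
        using q mult_right_mono[OF c2 d(2)] by (simp add: power2_eq_square algebra_simps)
      have "norm (mul z X0) \<le> c * (\<rho> * c)" by (intro mul_le z c)
      have "norm y \<le> norm z + norm (mul z X0)" unfolding y_def by (rule norm_triangle_ineq4)
      have y: "norm y \<le> 2 * c\<^sup>2 * \<rho>"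
      proof -
        have "\<rho> \<le> c\<^sup>2 * \<rho>" "c * (\<rho> * c) = c\<^sup>2 * \<rho>"
          using mult_right_mono[OF c2, of \<rho>] \<rho> by (auto simp: power2_eq_square)
        with \<open>norm (mul z X0) \<le> c * (\<rho> * c)\<close> \<open>norm y \<le> norm z + norm (mul z X0)\<close> z(1)
        show ?thesis by linarith
      qed
      have "2 * c\<^sup>2 * \<rho> \<le> 2 * c\<^sup>2 * 1" using \<rho> by (intro mult_left_mono) auto
      moreover have "c \<le> c\<^sup>2" using pc[of 1 2] by simp
      moreover have "norm x \<le> norm X0 + norm y" unfolding x_def by (rule norm_triangle_ineq)
      ultimately have x: "norm x \<le> 3 * c\<^sup>2" using y c by linarith
      have z1: "norm z \<le> 1" "norm z' \<le> 1" using z \<rho> by auto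
      have "norm (F z - F z' - (app k0 (D - mul D X0) + app k1 (mul D X0)))
          \<le> c * (\<delta> * (2 * c\<^sup>2 * d)) + c * (\<delta> * (d * c\<^sup>2))
            + c * ((2 * c) * (c * (d * (2 * c\<^sup>2 * \<rho>)) + c * (\<rho> * (2 * c\<^sup>2 * d))))
            + c * (\<delta> * (c * (d * (c * (1 * (3 * c\<^sup>2))))
                 + (c * (1 * (c * (d * (3 * c\<^sup>2)))) + c * (1 * (c * (1 * (2 * c\<^sup>2 * d)))))))"
        unfolding lin
        by (intro norm_triangle_mono app_le mul_le K K1 d z z1 x y q DX)
      also have "\<dots> = (3 * c ^ 3 * \<delta> + 8 * c ^ 5 * \<rho> + 8 * c ^ 5 * \<delta>) * d"
        by (simp add: algebra_simps power_numeral_reduce)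
      finally have E: "norm (F z - F z' - (app k0 (D - mul D X0) + app k1 (mul D X0)))
          \<le> (3 * c ^ 3 * \<delta> + 8 * c ^ 5 * \<rho> + 8 * c ^ 5 * \<delta>) * d" .
      have "\<Phi> z - \<Phi> z' = - S (F z - F z' - (app k0 (D - mul D X0) + app k1 (mul D X0)))"
        unfolding S.diff[of "F z - F z'"] S.diff[of "F z"] S \<Phi>_def D_def by simp
      then have "norm (\<Phi> z - \<Phi> z') \<le> c * ((3 * c ^ 3 * \<delta> + 8 * c ^ 5 * \<rho> + 8 * c ^ 5 * \<delta>) * d)"
        using S_le[OF E] by simp
      also have "\<dots> = (3 * (c ^ 4 * \<delta>) + 8 * (c ^ 6 * \<rho>) + 8 * (c ^ 6 * \<delta>)) * d"
        by (simp add: algebra_simps power_numeral_reduce)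
      also have "\<dots> \<le> (3 * (1 / 64) + 8 * (1 / 32) + 8 * (1 / 64)) * d"
      proof -
        have "c ^ 4 * \<delta> \<le> 1 / 64" "c ^ 6 * \<delta> \<le> 1 / 64"
          using pc[of 4 9] pc[of 6 9] \<open>0 < c\<close> by (auto simp: \<delta>_def field_simps)
        moreover have "c ^ 6 * \<rho> = 1 / 32"
          using \<open>0 < c\<close> by (simp add: \<rho>_def)
        ultimately show ?thesis using d by (intro mult_right_mono) auto
      qed
      also have "\<dots> \<le> (1/2) * d" using d by simp
      finally show ?thesis by (simp add: d_def D_def)
    qed
    have F0: "F 0 = app (K0 - k0) X0"
      by (simp add: F_def pencil_def Let_def mul.zero_left app.zero_right app.diff_left k0)
    have \<Phi>0: "norm (\<Phi> 0) \<le> c ^ 3 * norm (K0 - k0)"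
      using S_le[OF app_le[OF order_refl[of "norm (K0 - k0)"] c(5)]]
      by (simp add: \<Phi>_def F0 power_numeral_reduce mult_ac)
    have bound: "norm (\<Phi> z) \<le> (1/2) * norm z + c ^ 3 * norm (K0 - k0)" if "norm z \<le> \<rho>" for z
      using lip[OF that, of 0] \<Phi>0 \<rho> norm_triangle_ineq[of "\<Phi> z - \<Phi> 0" "\<Phi> 0"] by simp
    have small: "c ^ 3 * norm (K0 - k0) \<le> \<rho> / 2"
    proof -
      have "c ^ 3 * norm (K0 - k0) \<le> c ^ 3 * \<delta>" using K(1) c0 by (intro mult_left_mono) auto
      also have "\<dots> = \<rho> / 2" using \<open>0 < c\<close> by (simp add: \<delta>_def \<rho>_def power_numeral_reduce)
      finally show ?thesis .
    qed
    have "\<exists>!z\<in>cball 0 \<rho>. \<Phi> z = z"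
    proof (rule Banach_fix[where c = "1/2"])
      show "\<Phi> ` cball 0 \<rho> \<subseteq> cball 0 \<rho>"
      proof safe
        fix z :: 'h assume "z \<in> cball 0 \<rho>"
        then show "\<Phi> z \<in> cball 0 \<rho>" using bound[of z] small by auto
      qed
    qed (use \<rho> lip in \<open>auto simp: complete_eq_closed dist_norm\<close>)
    then have "\<exists>!z. norm z \<le> \<rho> \<and> S (F z) = 0"
      by (auto simp: \<Phi>_def)
    moreover have "norm z \<le> 2 * c ^ 3 * norm (K0 - k0)" if "norm z \<le> \<rho>" "S (F z) = 0" for z
      using bound[OF that(1)] that(2) by (simp add: \<Phi>_def)
    ultimately show ?thesis unfolding F_def by blast
  qed
  show ?thesis
    by (rule exI[of _ \<delta>], rule exI[of _ \<rho>], rule exI[of _ "2 * c ^ 3"])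
      (use \<rho>(1) \<delta>(1) c0 main in \<open>simp only: zero_le_power zero_le_mult_iff zero_le_numeral; blast\<close>)
qed

lemma ser_eval_pencil:
  fixes app :: "'k::banach \<Rightarrow> 'h::banach \<Rightarrow> 'h"
  assumes "bounded_bilinear app" "bounded_bilinear mul" "\<bar>t\<bar> \<le> 1"
  shows "ser_eval (pencil (ser_conv app) (ser_conv mul) (ser_const X0) K0 K1 K2 z) t
    = pencil app mul X0 (ser_eval K0 t) (ser_eval K1 t) (ser_eval K2 t) (ser_eval z t)"
  using assms
  by (simp add: pencil_def Let_def ser_eval_add ser_eval_diff ser_eval_conv ser_eval_const)

lemma pencil_const:
  assumes "bounded_bilinear app" "bounded_bilinear mul"
  shows "pencil (ser_conv app) (ser_conv mul) (ser_const X0) (ser_const K0) (ser_const K1) (ser_const K2)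
      (ser_const z) = ser_const (pencil app mul X0 K0 K1 K2 z)"
proof -
  interpret app: bounded_bilinear app by fact
  interpret mul: bounded_bilinear mul by fact
  show ?thesis
    by (simp add: pencil_def Let_def ser_const_add[symmetric] ser_const_diff[symmetric]
        app.ser_conv_const mul.ser_conv_const)
qed

text \<open>The contraction lemma is applied in the series space only, with \<delta> and \<rho>
  independent of the base point. Constant series give uniqueness at a single \<epsilon>; series
  around \<epsilon> give a solution analytic in the increment; uniqueness identifies the two. The
  radius of the series may depend on \<epsilon>, while the bounds defining \<epsilon>0 do
  not.\<close>

theorem pencil_analytic_branch:
  fixes K0 K1 K2 :: "real \<Rightarrow> 'h::banach \<Rightarrow>\<^sub>L 'h" and mul :: "'h \<Rightarrow> 'h \<Rightarrow> 'h"
  assumes mul: "bounded_bilinear mul"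
    and "0 < \<epsilon>1"
    and K0: "\<And>\<epsilon>. \<epsilon> \<in> {0<..<\<epsilon>1} \<Longrightarrow> norm (K0 \<epsilon> - k0) \<le> M * \<epsilon>"
    and K1: "\<And>\<epsilon>. \<epsilon> \<in> {0<..<\<epsilon>1} \<Longrightarrow> norm (K1 \<epsilon> - k1) \<le> M * \<epsilon>"
    and K2: "\<And>\<epsilon>. \<epsilon> \<in> {0<..<\<epsilon>1} \<Longrightarrow> norm (K2 \<epsilon>) \<le> M * \<epsilon>"
    and an: "\<And>\<epsilon>. \<epsilon> \<in> {0<..<\<epsilon>1} \<Longrightarrow> analytic_near K0 \<epsilon> \<and> analytic_near K1 \<epsilon> \<and> analytic_near K2 \<epsilon>"
    and S: "\<And>z. blinfun_apply S (k0 (z - mul z X0) + k1 (mul z X0)) = z"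
    and inj: "\<And>x. blinfun_apply S x = 0 \<Longrightarrow> x = 0"
    and k0: "k0 X0 = 0"
  obtains \<epsilon>0 \<rho> C z where "0 < \<epsilon>0" "\<epsilon>0 \<le> \<epsilon>1" "0 < \<rho>" "0 \<le> C"
    "\<And>\<epsilon>. \<epsilon> \<in> {0<..<\<epsilon>0} \<Longrightarrow> pencil blinfun_apply mul X0 (K0 \<epsilon>) (K1 \<epsilon>) (K2 \<epsilon>) (z \<epsilon>) = 0"
    "\<And>\<epsilon>. \<epsilon> \<in> {0<..<\<epsilon>0} \<Longrightarrow> norm (z \<epsilon>) \<le> C * \<epsilon>"
    "\<And>\<epsilon>. \<epsilon> \<in> {0<..<\<epsilon>0} \<Longrightarrow> analytic_near z \<epsilon>"
    "\<And>\<epsilon> z'. \<epsilon> \<in> {0<..<\<epsilon>0} \<Longrightarrow> norm z' \<le> \<rho> \<Longrightarrow>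
       pencil blinfun_apply mul X0 (K0 \<epsilon>) (K1 \<epsilon>) (K2 \<epsilon>) z' = 0 \<Longrightarrow> z' = z \<epsilon>"
proof -
  interpret mul: bounded_bilinear mul by (rule mul)
  let ?app = "ser_conv blinfun_apply :: (nat \<Rightarrow>\<^sub>C ('h \<Rightarrow>\<^sub>L 'h)) \<Rightarrow> (nat \<Rightarrow>\<^sub>C 'h) \<Rightarrow> (nat \<Rightarrow>\<^sub>C 'h)"
    and ?mul = "ser_conv mul" and ?X = "ser_const X0"
  let ?S = "ser_conv blinfun_apply (ser_const S)"
  let ?P = "pencil ?app ?mul ?X"
  note bb = bounded_bilinear_blinfun_apply
  have bbs: "bounded_bilinear ?app" "bounded_bilinear ?mul"
    by (rule blinfun.bounded_bilinear_ser_conv mul.bounded_bilinear_ser_conv)+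
  \<comment> \<open>A constant series acts coefficient by coefficient, so the left inverse of the
    derivative carries over from the base space unchanged.\<close>
  have S_ser: "?S (?app (ser_const k0) (z - ?mul z ?X) + ?app (ser_const k1) (?mul z ?X)) = z" for z
    by (rule ser_eqI) (simp add: blinfun.ser_coeff_conv_const_left ser_coeff_add ser_coeff_diff
        mul.ser_coeff_conv_const_right S)
  have S0: "?S F = 0 \<longleftrightarrow> F = 0" for F
  proof
    assume F: "?S F = 0"
    have "ser_coeff F k = 0" for k
    proof (rule inj)
      have "blinfun_apply S (ser_coeff F k) = ser_coeff (?S F) k"
        by (rule blinfun.ser_coeff_conv_const_left[symmetric])
      then show "blinfun_apply S (ser_coeff F k) = 0"
        by (simp only: F ser_coeff_zero)
    qed
    then show "F = 0" by (intro ser_eqI) (simp only: ser_coeff_zero)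
  qed (simp only: bounded_bilinear.zero_right[OF bbs(1)])
  have k0_ser: "?app (ser_const k0) ?X = 0" by (simp add: blinfun.ser_conv_const k0 ser_const_zero)
  have S_lin: "bounded_linear ?S"
    by (rule bounded_bilinear.bounded_linear_right[OF bbs(1)])
  have "\<exists>\<delta> \<rho> C. 0 < \<delta> \<and> 0 < \<rho> \<and> 0 \<le> C \<and>
    (\<forall>K0 K1 K2. norm (K0 - ser_const k0) \<le> \<delta> \<longrightarrow> norm (K1 - ser_const k1) \<le> \<delta> \<longrightarrow> norm K2 \<le> \<delta> \<longrightarrow>
      (\<exists>!z. norm z \<le> \<rho> \<and> ?S (?P K0 K1 K2 z) = 0) \<and>
      (\<forall>z. norm z \<le> \<rho> \<longrightarrow> ?S (?P K0 K1 K2 z) = 0 \<longrightarrow> norm z \<le> C * norm (K0 - ser_const k0)))"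
    by (rule pencil_quasi_newton[OF bbs, OF S_lin, OF S_ser, OF k0_ser])
  then obtain \<delta> \<rho> C where \<delta>: "0 < \<delta>" "0 < \<rho>" "0 \<le> C"
    and QN: "\<And>K0 K1 K2. norm (K0 - ser_const k0) \<le> \<delta> \<Longrightarrow> norm (K1 - ser_const k1) \<le> \<delta> \<Longrightarrow> norm K2 \<le> \<delta> \<Longrightarrow>
      (\<exists>!z. norm z \<le> \<rho> \<and> ?P K0 K1 K2 z = 0) \<and>
      (\<forall>z. norm z \<le> \<rho> \<longrightarrow> ?P K0 K1 K2 z = 0 \<longrightarrow> norm z \<le> C * norm (K0 - ser_const k0))"
    unfolding S0 by blast
  \<comment> \<open>Two errors of size \<eta> occur, the distance of K(\<epsilon>) from its limit
    and the nonconstant part of its series, and both together must fit under \<delta>. Evaluation of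
    a series costs a factor \<open>inv_squares_sum\<close>; the second entry keeps the evaluated
    solution inside the ball of radius \<rho> where uniqueness holds.\<close>
  define \<eta> where "\<eta> = min (\<delta> / 2) (\<rho> / (2 * (C + 1) * inv_squares_sum))"
  have \<eta>: "0 < \<eta>" using \<delta> inv_squares_sum_pos by (auto simp: \<eta>_def)
  have "C * (2 * \<eta>) * inv_squares_sum \<le> (C + 1) * (2 * \<eta>) * inv_squares_sum"
    using \<delta> \<eta> inv_squares_sum_pos by (intro mult_right_mono) auto
  also have "\<dots> \<le> (C + 1) * (2 * (\<rho> / (2 * (C + 1) * inv_squares_sum))) * inv_squares_sum"
    using \<delta> inv_squares_sum_pos by (intro mult_right_mono mult_left_mono) (auto simp: \<eta>_def)
  also have "\<dots> = \<rho> / (2 * (C + 1) * inv_squares_sum) * (2 * (C + 1) * inv_squares_sum)"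
    by (simp only: mult_ac)
  also have "\<dots> = \<rho>" using \<delta> inv_squares_sum_pos by simp
  finally have \<eta>\<rho>: "C * (2 * \<eta>) * inv_squares_sum \<le> \<rho>" .
  define \<epsilon>0 where "\<epsilon>0 = min \<epsilon>1 (\<eta> / (\<bar>M\<bar> + 1))"
  have \<epsilon>0: "0 < \<epsilon>0" "\<epsilon>0 \<le> \<epsilon>1" using \<eta> \<open>0 < \<epsilon>1\<close> by (auto simp: \<epsilon>0_def)
  have in1: "\<epsilon> \<in> {0<..<\<epsilon>1}" if "\<epsilon> \<in> {0<..<\<epsilon>0}" for \<epsilon> using that \<epsilon>0 by auto
  have small: "M * \<epsilon> \<le> \<eta>" if "\<epsilon> \<in> {0<..<\<epsilon>0}" for \<epsilon>
  proof -
    have "M * \<epsilon> \<le> (\<bar>M\<bar> + 1) * \<epsilon>" using that by (intro mult_right_mono) auto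
    also have "\<dots> \<le> (\<bar>M\<bar> + 1) * (\<eta> / (\<bar>M\<bar> + 1))"
      using that by (intro mult_left_mono) (auto simp: \<epsilon>0_def)
    finally show ?thesis by simp
  qed
  let ?F = "\<lambda>\<epsilon>. pencil blinfun_apply mul X0 (K0 \<epsilon>) (K1 \<epsilon>) (K2 \<epsilon>)"
  have uniq: "z = z'" and bound: "norm z \<le> C * norm (K0 \<epsilon> - k0)"
    if "\<epsilon> \<in> {0<..<\<epsilon>0}" "norm z \<le> \<rho>" "norm z' \<le> \<rho>" "?F \<epsilon> z = 0" "?F \<epsilon> z' = 0" for \<epsilon> z z'
  proof -
    have "norm (ser_const (K0 \<epsilon>) - ser_const k0) \<le> \<delta>" "norm (ser_const (K1 \<epsilon>) - ser_const k1) \<le> \<delta>"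
      "norm (ser_const (K2 \<epsilon>)) \<le> \<delta>"
      using K0[OF in1[OF that(1)]] K1[OF in1[OF that(1)]] K2[OF in1[OF that(1)]] small[OF that(1)] \<delta>
      by (auto simp: ser_const_diff[symmetric] norm_ser_const \<eta>_def)
    note Q = QN[OF this]
    have P: "?P (ser_const (K0 \<epsilon>)) (ser_const (K1 \<epsilon>)) (ser_const (K2 \<epsilon>)) (ser_const w) = 0"
      if "?F \<epsilon> w = 0" for w
      using that by (simp add: pencil_const[OF bb mul] ser_const_zero)
    have "ser_const z = ser_const z'"
      using Q P[OF that(4)] P[OF that(5)] that(2,3) by (metis norm_ser_const)
    then show "z = z'" by (simp add: ser_const_inject)
    show "norm z \<le> C * norm (K0 \<epsilon> - k0)"
      using Q P[OF that(4)] that(2) by (metis norm_ser_const ser_const_diff)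
  qed
  have ex: "\<exists>r>0. \<exists>w. \<forall>t. \<bar>t\<bar> \<le> 1 \<longrightarrow> norm (ser_eval w t) \<le> \<rho> \<and> ?F (\<epsilon> + r * t) (ser_eval w t) = 0
      \<and> \<epsilon> + r * t \<in> {0<..<\<epsilon>0}" if \<epsilon>: "\<epsilon> \<in> {0<..<\<epsilon>0}" for \<epsilon>
  proof -
    have a: "analytic_near K0 \<epsilon>" "analytic_near K1 \<epsilon>" "analytic_near K2 \<epsilon>"
      using an[OF in1[OF \<epsilon>]] by auto
    obtain r0 where r0: "0 < r0" "\<And>r. 0 < r \<Longrightarrow> r \<le> r0 \<Longrightarrow> \<exists>F. (\<forall>t. \<bar>t\<bar> \<le> 1 \<longrightarrow> K0 (\<epsilon> + r * t) = ser_eval F t) \<and>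
       norm (F - ser_const (K0 \<epsilon>)) \<le> \<eta>" by (rule analytic_near_rescaled[OF a(1) \<eta>]) blast
    obtain r1 where r1: "0 < r1" "\<And>r. 0 < r \<Longrightarrow> r \<le> r1 \<Longrightarrow> \<exists>F. (\<forall>t. \<bar>t\<bar> \<le> 1 \<longrightarrow> K1 (\<epsilon> + r * t) = ser_eval F t) \<and>
       norm (F - ser_const (K1 \<epsilon>)) \<le> \<eta>" by (rule analytic_near_rescaled[OF a(2) \<eta>]) blast
    obtain r2 where r2: "0 < r2" "\<And>r. 0 < r \<Longrightarrow> r \<le> r2 \<Longrightarrow> \<exists>F. (\<forall>t. \<bar>t\<bar> \<le> 1 \<longrightarrow> K2 (\<epsilon> + r * t) = ser_eval F t) \<and>
       norm (F - ser_const (K2 \<epsilon>)) \<le> \<eta>" by (rule analytic_near_rescaled[OF a(3) \<eta>]) blast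
    define r where "r = Min {r0, r1, r2, \<epsilon> / 2, (\<epsilon>0 - \<epsilon>) / 2}"
    have "0 < r" using r0(1) r1(1) r2(1) \<epsilon> by (simp add: r_def)
    moreover have "r \<le> r0" "r \<le> r1" "r \<le> r2" "r \<le> \<epsilon> / 2" "r \<le> (\<epsilon>0 - \<epsilon>) / 2"
      unfolding r_def by (rule Min_le; simp)+
    ultimately have r: "0 < r" "r \<le> r0" "r \<le> r1" "r \<le> r2" "r \<le> \<epsilon> / 2" "r \<le> (\<epsilon>0 - \<epsilon>) / 2"
      by blast+
    obtain F0 where F0: "\<And>t. \<bar>t\<bar> \<le> 1 \<Longrightarrow> K0 (\<epsilon> + r * t) = ser_eval F0 t" "norm (F0 - ser_const (K0 \<epsilon>)) \<le> \<eta>"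
      using r0(2)[OF r(1,2)] by blast
    obtain F1 where F1: "\<And>t. \<bar>t\<bar> \<le> 1 \<Longrightarrow> K1 (\<epsilon> + r * t) = ser_eval F1 t" "norm (F1 - ser_const (K1 \<epsilon>)) \<le> \<eta>"
      using r1(2)[OF r(1,3)] by blast
    obtain F2 where F2: "\<And>t. \<bar>t\<bar> \<le> 1 \<Longrightarrow> K2 (\<epsilon> + r * t) = ser_eval F2 t" "norm (F2 - ser_const (K2 \<epsilon>)) \<le> \<eta>"
      using r2(2)[OF r(1,4)] by blast
    note \<epsilon>K = K0[OF in1[OF \<epsilon>]] K1[OF in1[OF \<epsilon>]] K2[OF in1[OF \<epsilon>]] small[OF \<epsilon>]
    \<comment> \<open>The distance to the limit splits at the constant series with the value at the
      centre \<epsilon>.\<close>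
    have tri: "norm (F - ser_const k) \<le> 2 * \<eta>"
      if "norm (F - ser_const K) \<le> \<eta>" "norm (K - k) \<le> \<eta>" for F and K k :: "'h \<Rightarrow>\<^sub>L 'h"
    proof -
      have eq: "F - ser_const k = (F - ser_const K) + ser_const (K - k)" by (simp add: ser_const_diff)
      show ?thesis
        unfolding eq by (rule norm_triangle_le) (use that in \<open>simp add: norm_ser_const\<close>)
    qed
    have n0: "norm (F0 - ser_const k0) \<le> 2 * \<eta>" by (rule tri[OF F0(2)]) (use \<epsilon>K in linarith)
    have n1: "norm (F1 - ser_const k1) \<le> 2 * \<eta>" by (rule tri[OF F1(2)]) (use \<epsilon>K in linarith)
    have n2: "norm F2 \<le> 2 * \<eta>"
      using tri[OF F2(2), of 0] \<epsilon>K by (simp add: ser_const_zero)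
    have "2 * \<eta> \<le> \<delta>" by (simp add: \<eta>_def)
    with n0 n1 n2 have "norm (F0 - ser_const k0) \<le> \<delta>" "norm (F1 - ser_const k1) \<le> \<delta>" "norm F2 \<le> \<delta>"
      by linarith+
    from QN[OF this] obtain w where w: "norm w \<le> \<rho>" "?P F0 F1 F2 w = 0"
        "norm w \<le> C * norm (F0 - ser_const k0)" by blast
    have "norm w \<le> C * (2 * \<eta>)" using w(3) mult_left_mono[OF n0 \<delta>(3)] by linarith
    then have w_le: "norm w * inv_squares_sum \<le> \<rho>"
      using mult_right_mono[of "norm w" "C * (2 * \<eta>)" inv_squares_sum] inv_squares_sum_pos \<eta>\<rho> by linarith
    have "norm (ser_eval w t) \<le> \<rho> \<and> ?F (\<epsilon> + r * t) (ser_eval w t) = 0 \<and> \<epsilon> + r * t \<in> {0<..<\<epsilon>0}"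
      if t: "\<bar>t\<bar> \<le> 1" for t
    proof (intro conjI)
      show "norm (ser_eval w t) \<le> \<rho>" using norm_ser_eval_le[OF t, of w] w_le by linarith
      show "?F (\<epsilon> + r * t) (ser_eval w t) = 0"
        using arg_cong[OF w(2), of "\<lambda>F. ser_eval F t"]
        by (simp add: ser_eval_pencil[OF bb mul t] F0(1)[OF t] F1(1)[OF t] F2(1)[OF t])
          (simp add: ser_eval_def ser_coeff_zero)
      have "\<bar>r * t\<bar> \<le> r" using t r(1) by (simp add: abs_mult mult_left_le)
      moreover define s where "s = r * t"
      ultimately have "s \<le> r" "- s \<le> r" using abs_le_D1 abs_le_D2 by auto
      moreover have "0 < \<epsilon>" "\<epsilon> < \<epsilon>0" using \<epsilon> by auto
      ultimately show "\<epsilon> + r * t \<in> {0<..<\<epsilon>0}"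
        using r(1,5,6) by (simp add: s_def[symmetric])
    qed
    then show ?thesis using r(1) by blast
  qed
  define z where "z \<epsilon> = (SOME z. norm z \<le> \<rho> \<and> ?F \<epsilon> z = 0)" for \<epsilon>
  have z: "norm (z \<epsilon>) \<le> \<rho> \<and> ?F \<epsilon> (z \<epsilon>) = 0" if \<epsilon>: "\<epsilon> \<in> {0<..<\<epsilon>0}" for \<epsilon>
  proof -
    obtain r w where "\<forall>t. \<bar>t\<bar> \<le> 1 \<longrightarrow> norm (ser_eval w t) \<le> \<rho> \<and> ?F (\<epsilon> + r * t) (ser_eval w t) = 0
        \<and> \<epsilon> + r * t \<in> {0<..<\<epsilon>0}"
      using ex[OF \<epsilon>] by (elim exE conjE)
    from this[rule_format, of 0] have "\<exists>z. norm z \<le> \<rho> \<and> ?F \<epsilon> z = 0" by auto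
    then show ?thesis unfolding z_def by (rule someI_ex)
  qed
  show thesis
  proof (rule that[of \<epsilon>0 \<rho> "C * \<bar>M\<bar>" z])
    fix \<epsilon> assume \<epsilon>: "\<epsilon> \<in> {0<..<\<epsilon>0}"
    show "?F \<epsilon> (z \<epsilon>) = 0" using z[OF \<epsilon>] by blast
    have "norm (z \<epsilon>) \<le> C * norm (K0 \<epsilon> - k0)" using bound[OF \<epsilon>] z[OF \<epsilon>] by blast
    also have "\<dots> \<le> C * (\<bar>M\<bar> * \<epsilon>)"
    proof (rule mult_left_mono[OF _ \<delta>(3)])
      have "M * \<epsilon> \<le> \<bar>M\<bar> * \<epsilon>" using \<epsilon> by (intro mult_right_mono) auto
      then show "norm (K0 \<epsilon> - k0) \<le> \<bar>M\<bar> * \<epsilon>" using K0[OF in1[OF \<epsilon>]] by linarith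
    qed
    finally show "norm (z \<epsilon>) \<le> C * \<bar>M\<bar> * \<epsilon>" by (simp add: mult_ac)
    show "analytic_near z \<epsilon>"
    proof -
      obtain r w where rw: "0 < r" "\<And>t. \<bar>t\<bar> \<le> 1 \<Longrightarrow> norm (ser_eval w t) \<le> \<rho> \<and> ?F (\<epsilon> + r * t) (ser_eval w t) = 0
          \<and> \<epsilon> + r * t \<in> {0<..<\<epsilon>0}"
        using ex[OF \<epsilon>] by blast
      \<comment> \<open>Uniqueness at each single parameter glues the local series: the value chosen
        by \<open>SOME\<close> must agree with the series wherever the latter is defined.\<close>
      have "z (\<epsilon> + r * t) = ser_eval w t" if "\<bar>t\<bar> \<le> 1" for t
        using uniq[of "\<epsilon> + r * t" "z (\<epsilon> + r * t)" "ser_eval w t"] rw(2)[OF that] z by blast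
      then show ?thesis unfolding analytic_near_def using rw(1) by blast
    qed
    show "z' = z \<epsilon>" if "norm z' \<le> \<rho>" "?F \<epsilon> z' = 0" for z'
      using uniq[OF \<epsilon> that(1) _ that(2)] z[OF \<epsilon>] by blast
  qed (use \<epsilon>0 \<delta> in auto)
qed

section \<open>Coercive operators and finite-rank perturbations\<close>

text \<open>The Lax-Milgram argument: for small t > 0 the map x - t (E x - f) is a contraction, and
  coercivity bounds the inverse by 1/\<alpha>.\<close>

lemma coercive_invertible:
  fixes E :: "'a::{real_inner,banach} \<Rightarrow>\<^sub>L 'a"
  assumes "0 < \<alpha>" and coercive: "\<And>x. \<alpha> * (norm x)\<^sup>2 \<le> E x \<bullet> x"
  obtains R :: "'a \<Rightarrow>\<^sub>L 'a" where "\<And>x. R (E x) = x" "\<And>x. E (R x) = x"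
proof -
  \<comment> \<open>Adding \<alpha> to the norm ensures 0 < K and \<alpha> \<le> K, so that t is
    well defined and the contraction factor q is a square root of a nonnegative number.\<close>
  define K where "K = norm E + \<alpha>"
  define t where "t = \<alpha> / K\<^sup>2"
  define q where "q = sqrt (1 - (\<alpha> / K)\<^sup>2)"
  have K: "0 < K" "norm E \<le> K" "\<alpha> \<le> K" using assms(1) norm_ge_zero[of E] by (auto simp: K_def simp del: norm_ge_zero)
  have t: "0 < t" using assms(1) K by (simp add: t_def)
  have \<alpha>K: "0 < (\<alpha> / K)\<^sup>2" "(\<alpha> / K)\<^sup>2 \<le> 1"
    using assms(1) K by (auto intro!: power_le_one)
  have q: "0 \<le> q" "q < 1" using \<alpha>K by (auto simp: q_def real_sqrt_lt_1_iff)
  have q2: "q\<^sup>2 = 1 - 2 * t * \<alpha> + t\<^sup>2 * K\<^sup>2"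
    using \<alpha>K K assms(1) by (simp add: q_def t_def power2_eq_square field_simps)
  have contr: "norm (d - t *\<^sub>R E d) \<le> q * norm d" for d
  proof (rule power2_le_imp_le)
    have "(norm (d - t *\<^sub>R E d))\<^sup>2 = (norm d)\<^sup>2 - 2 * t * (E d \<bullet> d) + t\<^sup>2 * (norm (E d))\<^sup>2"
      unfolding power2_norm_eq_inner
      by (simp add: inner_diff_left inner_diff_right inner_commute power2_eq_square)
    also have "\<dots> \<le> (norm d)\<^sup>2 - 2 * t * (\<alpha> * (norm d)\<^sup>2) + t\<^sup>2 * (K * norm d)\<^sup>2"
    proof -
      have "norm (E d) \<le> K * norm d"
        using norm_blinfun[of E d] K(2) mult_right_mono[OF K(2) norm_ge_zero[of d]] by linarith
      then have "t\<^sup>2 * (norm (E d))\<^sup>2 \<le> t\<^sup>2 * (K * norm d)\<^sup>2"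
        by (intro mult_left_mono power_mono) auto
      moreover have "2 * t * (\<alpha> * (norm d)\<^sup>2) \<le> 2 * t * (E d \<bullet> d)"
        using t by (intro mult_left_mono coercive) auto
      ultimately show ?thesis by linarith
    qed
    also have "\<dots> = (q * norm d)\<^sup>2" by (simp add: power_mult_distrib q2 algebra_simps)
    finally show "(norm (d - t *\<^sub>R E d))\<^sup>2 \<le> (q * norm d)\<^sup>2" .
  qed (use q in simp)
  have ex: "\<exists>!x. E x = f" for f
  proof -
    have "\<exists>!x. x - t *\<^sub>R (E x - f) = x"
    proof (rule banach_fix_type[OF q], intro allI)
      fix x y
      have eq: "x - t *\<^sub>R (E x - f) - (y - t *\<^sub>R (E y - f)) = (x - y) - t *\<^sub>R E (x - y)"
        by (simp add: blinfun.diff_right algebra_simps)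
      show "dist (x - t *\<^sub>R (E x - f)) (y - t *\<^sub>R (E y - f)) \<le> q * dist x y"
        unfolding dist_norm eq by (rule contr)
    qed
    then show ?thesis using t by simp
  qed
  define r where "r f = (THE x. E x = f)" for f
  have r: "E (r f) = f" for f unfolding r_def by (rule theI'[OF ex])
  have r': "r (E x) = x" for x unfolding r_def by (rule the1_equality[OF ex refl])
  have bl: "bounded_linear r"
  proof (rule bounded_linear_intro[where K = "1 / \<alpha>"])
    fix x y :: 'a and s :: real
    show "r (x + y) = r x + r y" by (metis blinfun.add_right r r')
    show "r (s *\<^sub>R x) = s *\<^sub>R r x" by (metis blinfun.scaleR_right r r')
    have "\<alpha> * (norm (r x))\<^sup>2 \<le> norm x * norm (r x)"
      using coercive[of "r x"] norm_cauchy_schwarz[of x "r x"] by (simp add: r)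
    then have "\<alpha> * norm (r x) \<le> norm x"
      by (cases "r x = 0") (simp_all add: power2_eq_square mult.assoc[symmetric])
    then show "norm (r x) \<le> norm x * (1 / \<alpha>)" using assms(1) by (simp add: field_simps)
  qed
  show thesis
    by (rule that[of "Blinfun r"]) (simp_all add: bounded_linear_Blinfun_apply[OF bl] r r')
qed

text \<open>A dimension count: the images of a basis are independent, and a vector of the span
  outside their span would give more independent vectors than the basis has elements.\<close>

lemma linear_inj_on_span_surj:
  fixes g :: "'a::real_vector \<Rightarrow> 'a"
  assumes "finite B" "linear g" "g ` span B \<subseteq> span B" "\<And>x. x \<in> span B \<Longrightarrow> g x = 0 \<Longrightarrow> x = 0"
    and y: "y \<in> span B"
  shows "\<exists>x\<in>span B. g x = y"
proof -
  interpret linear g by fact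
  obtain B0 where B0: "B0 \<subseteq> B" "independent B0" "B \<subseteq> span B0"
    using maximal_independent_subset[of B] by blast
  have span: "span B0 = span B"
    using B0 span_mono[of B0 B] span_minimal[OF B0(3) subspace_span] by blast
  have "finite B0" using B0(1) assms(1) finite_subset by blast
  have inj: "inj_on g (span B0)"
    using linear_injective_on_subspace_0[OF assms(2) subspace_span, of B0] assms(4) by (auto simp: span)
  have inj0: "inj_on g B0" using inj_on_subset[OF inj span_superset] .
  have ind: "independent (g ` B0)" by (rule linear_independent_injective_image[OF assms(2) B0(2) inj])
  have "y \<in> span (g ` B0)"
  proof (rule ccontr)
    assume ny: "y \<notin> span (g ` B0)"
    then have "independent (insert y (g ` B0))" by (intro independent_insertI ind)
    moreover have "insert y (g ` B0) \<subseteq> span B0"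
      using y assms(3) span_superset[of B0] by (auto simp: span)
    ultimately have "card (insert y (g ` B0)) \<le> card B0"
      using independent_span_bound[OF \<open>finite B0\<close>] by blast
    moreover have "y \<notin> g ` B0" using ny span_superset[of "g ` B0"] by blast
    ultimately show False using \<open>finite B0\<close> card_image[OF inj0] by simp
  qed
  then show ?thesis using linear_span_image[OF assms(2), of B0] span by auto
qed

text \<open>The Fredholm alternative for finite rank. R T is the identity plus a map into the span
  of the vectors R (b i); it preserves that span and is injective on it, hence onto, so each b i has
  a preimage c i under T.\<close>

lemma finite_rank_perturbation_invertible:
  fixes D R T :: "'a::real_normed_vector \<Rightarrow>\<^sub>L 'a" and \<phi> :: "'i \<Rightarrow> 'a \<Rightarrow>\<^sub>L real" and b :: "'i \<Rightarrow> 'a"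
  assumes "finite I" and DR: "\<And>x. R (D x) = x" "\<And>x. D (R x) = x"
    and T: "\<And>x. T x = D x + (\<Sum>i\<in>I. \<phi> i x *\<^sub>R b i)"
    and inj: "\<And>x. T x = 0 \<Longrightarrow> x = 0"
  obtains S :: "'a \<Rightarrow>\<^sub>L 'a" where "\<And>x. S (T x) = x" "\<And>x. T (S x) = x"
proof -
  define B where "B = (\<lambda>i. blinfun_apply R (b i)) ` I"
  define g where "g x = blinfun_apply R (blinfun_apply T x)" for x
  have g: "g x = x + (\<Sum>i\<in>I. \<phi> i x *\<^sub>R R (b i))" for x
    by (simp add: g_def T blinfun.add_right DR blinfun.sum_right blinfun.scaleR_right)
  have lin: "linear g"
    by (intro linearI) (simp_all add: g_def blinfun.add_right blinfun.scaleR_right)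
  have R0: "R x = 0 \<longleftrightarrow> x = 0" for x
    by (metis DR(2) blinfun.zero_right)
  have "\<exists>x\<in>span B. g x = R (b i)" if "i \<in> I" for i
  proof (rule linear_inj_on_span_surj[OF _ lin])
    show "finite B" using assms(1) by (simp add: B_def)
    show "g ` span B \<subseteq> span B"
    proof safe
      fix x assume "x \<in> span B"
      then show "g x \<in> span B"
        unfolding g by (intro span_add span_sum span_scale) (auto simp: B_def intro: span_base)
    qed
    show "x = 0" if "g x = 0" for x using that R0 inj by (simp add: g_def)
    show "R (b i) \<in> span B" using that by (auto simp: B_def intro: span_base)
  qed
  then obtain c where c: "\<And>i. i \<in> I \<Longrightarrow> g (c i) = R (b i)" by metis
  have Tc: "T (c i) = b i" if "i \<in> I" for i
    using arg_cong[OF c[OF that], of "blinfun_apply D"] by (simp add: g_def DR)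
  \<comment> \<open>T (R y) exceeds y by the finite-rank terms; since T (c i) = b i, subtracting the
    same combination of the c i cancels them.\<close>
  define S where "S = R - (\<Sum>i\<in>I. blinfun_scaleR_left (c i) o\<^sub>L (\<phi> i o\<^sub>L R))"
  have S: "S y = R y - (\<Sum>i\<in>I. \<phi> i (R y) *\<^sub>R c i)" for y
    by (simp add: S_def blinfun.diff_left blinfun.sum_left)
  have TS: "T (S y) = y" for y
  proof -
    have "T (S y) = T (R y) - (\<Sum>i\<in>I. \<phi> i (R y) *\<^sub>R T (c i))"
      by (simp add: S blinfun.diff_right blinfun.sum_right blinfun.scaleR_right)
    also have "(\<Sum>i\<in>I. \<phi> i (R y) *\<^sub>R T (c i)) = (\<Sum>i\<in>I. \<phi> i (R y) *\<^sub>R b i)"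
      by (rule sum.cong) (simp_all add: Tc)
    finally show ?thesis by (simp add: T DR)
  qed
  have ST: "S (T x) = x" for x
  proof -
    have "T (S (T x) - x) = 0" by (simp add: blinfun.diff_right TS)
    then show ?thesis using inj by fastforce
  qed
  show thesis by (rule that[OF ST TS])
qed

section \<open>Weighted sequences and convolution operators\<close>

definition wt :: "int \<Rightarrow> real" where
  "wt m = 1 + (real_of_int m)\<^sup>2"

lemma wt_ge: "1 \<le> wt m" and wt_pos: "0 < wt m"
  by (simp_all add: wt_def add_pos_nonneg)

lemma wt_nonzero [simp]: "wt m \<noteq> 0"
  using wt_pos[of m] by simp

lemma summable_inv_wt: "(\<lambda>m. 1 / wt m) summable_on UNIV"
proof -
  have "summable (\<lambda>n::nat. 1 / wt (int n))"
  proof (rule summable_comparison_test')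
    show "summable (\<lambda>n::nat. inverse (real n ^ 2))" by (rule inverse_power_summable) simp
    show "norm (1 / wt (int n)) \<le> inverse (real n ^ 2)" if "n \<ge> 1" for n
    proof -
      have "0 < (real n)\<^sup>2" using that by simp
      then show ?thesis
        unfolding wt_def of_int_of_nat_eq by (simp add: divide_inverse le_imp_inverse_le)
    qed
  qed
  then have nat: "(\<lambda>n::nat. 1 / wt (int n)) summable_on UNIV"
    by (rule summable_nonneg_imp_summable_on) (simp add: wt_def)
  have "(\<lambda>m. 1 / wt m) summable_on (range int)"
    using nat by (subst summable_on_reindex) (auto simp: o_def)
  moreover have "(\<lambda>m. 1 / wt m) summable_on (range (\<lambda>n. - int n))"
    using nat by (subst summable_on_reindex) (auto simp: o_def inj_def wt_def)
  ultimately have "(\<lambda>m. 1 / wt m) summable_on (range int \<union> range (\<lambda>n. - int n))"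
    by (rule summable_on_union)
  moreover have "range int \<union> range (\<lambda>n. - int n) = UNIV"
    by (auto simp: image_iff) (metis int_cases2)
  ultimately show ?thesis by simp
qed

definition inv_wt_sum :: real where
  "inv_wt_sum = (\<Sum>\<^sub>\<infinity>m. 1 / wt m)"

lemma inv_wt_sum_nonneg: "0 \<le> inv_wt_sum"
  unfolding inv_wt_sum_def by (rule infsum_nonneg) (simp add: wt_def)

definition emb :: "(int \<Rightarrow> 'n \<Rightarrow> complex) \<Rightarrow> (int \<times> 'n) l2" where
  "emb B = Abs_l2 (\<lambda>(m, n). of_real (wt m) * B m n)"

definition unemb :: "(int \<times> 'n) l2 \<Rightarrow> int \<Rightarrow> 'n \<Rightarrow> complex" where
  "unemb X m n = coord X (m, n) / of_real (wt m)"

lemma ell22_weight: "(1 + \<bar>real_of_int m\<bar>\<^sup>2)\<^sup>2 * (ell2_norm (B m))\<^sup>2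
    = (wt m)\<^sup>2 * (\<Sum>\<^sub>\<infinity>n. (cmod (B m n))\<^sup>2)"
  by (simp add: wt_def ell2_norm_square)

text \<open>For nonnegative terms, summing first over sites and then over modes is the same as
  summing over pairs, so the weighted space becomes an ordinary l2 over pairs.\<close>

lemma ell22_iff: "B \<in> ell22 \<longleftrightarrow> (\<lambda>(m, n). of_real (wt m) * B m n) \<in> ell2"
proof -
  let ?f = "\<lambda>m n. (wt m)\<^sup>2 * (cmod (B m n))\<^sup>2"
  have iff: "(\<lambda>(m, n). of_real (wt m) * B m n) \<in> ell2 \<longleftrightarrow> (\<lambda>(m, n). ?f m n) summable_on UNIV \<times> UNIV"
    unfolding ell2_iff by (simp add: case_prod_unfold norm_mult power_mult_distrib)
  have B: "B m \<in> ell2 \<longleftrightarrow> ?f m summable_on UNIV" for m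
    by (simp add: ell2_iff summable_on_cmult_right')
  have inf: "infsum (?f m) UNIV = (1 + \<bar>real_of_int m\<bar>\<^sup>2)\<^sup>2 * (ell2_norm (B m))\<^sup>2" for m
    unfolding ell22_weight by (rule infsum_cmult_right')
  show ?thesis
    unfolding iff
  proof
    assume "B \<in> ell22"
    then have *: "\<And>m. ?f m summable_on UNIV" "(\<lambda>m. infsum (?f m) UNIV) summable_on UNIV"
      unfolding ell22_def B[symmetric] inf by auto
    show "(\<lambda>(m, n). ?f m n) summable_on UNIV \<times> UNIV"
      by (rule summable_on_SigmaI[where g = "\<lambda>m. infsum (?f m) UNIV"]) (use * in auto)
  next
    assume *: "(\<lambda>(m, n). ?f m n) summable_on UNIV \<times> UNIV"
    have "?f m summable_on UNIV" for m using summable_on_SigmaD1[OF *] by simp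
    moreover have "(\<lambda>m. infsum (?f m) UNIV) summable_on UNIV" by (rule summable_on_Sigma_banach[OF *])
    ultimately show "B \<in> ell22" unfolding ell22_def B[symmetric] inf by auto
  qed
qed

lemma coord_emb: "B \<in> ell22 \<Longrightarrow> coord (emb B) (m, n) = of_real (wt m) * B m n"
  by (simp add: emb_def ell22_iff)

lemma unemb_emb: "B \<in> ell22 \<Longrightarrow> unemb (emb B) = B"
  by (intro ext) (simp add: unemb_def coord_emb)

lemma ell22_norm_eq: "B \<in> ell22 \<Longrightarrow> ell22_norm B = norm (emb B)"
proof -
  assume B: "B \<in> ell22"
  let ?f = "\<lambda>m n. (wt m)\<^sup>2 * (cmod (B m n))\<^sup>2"
  have s: "(\<lambda>(m, n). ?f m n) summable_on UNIV \<times> UNIV"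
    using B unfolding ell22_iff ell2_iff by (simp add: case_prod_unfold norm_mult power_mult_distrib)
  have "(\<Sum>\<^sub>\<infinity>m. (1 + \<bar>real_of_int m\<bar>\<^sup>2)\<^sup>2 * (ell2_norm (B m))\<^sup>2) = (\<Sum>\<^sub>\<infinity>m. infsum (?f m) UNIV)"
    unfolding ell22_weight infsum_cmult_right' ..
  also have "\<dots> = infsum (\<lambda>(m, n). ?f m n) (UNIV \<times> UNIV)"
    by (rule infsum_Sigma'_banach[OF s])
  also have "\<dots> = (norm (emb B))\<^sup>2"
    unfolding norm_l2_square UNIV_Times_UNIV
    by (rule infsum_cong) (auto simp: coord_emb[OF B] norm_mult power_mult_distrib)
  finally show ?thesis unfolding ell22_norm_def by simp
qed

lemma unemb_in_ell22: "unemb X \<in> ell22" and emb_unemb: "emb (unemb X) = X"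
proof -
  have eq: "(\<lambda>(m, n). of_real (wt m) * unemb X m n) = coord X"
    by (auto simp: unemb_def)
  show "unemb X \<in> ell22" unfolding ell22_iff eq by simp
  show "emb (unemb X) = X" unfolding emb_def eq by (rule coord_inverse)
qed

lemma ell22_norm_unemb: "ell22_norm (unemb X) = norm X"
  by (simp add: ell22_norm_eq unemb_in_ell22 emb_unemb)

lemma slice:
  fixes X :: "('k \<times> 'n) l2"
  shows slice_in_ell2: "(\<lambda>n. coord X (m, n)) \<in> ell2"
    and slice_norm_le: "ell2_norm (\<lambda>n. coord X (m, n)) \<le> norm X"
proof -
  have *: "(\<Sum>n\<in>F. (cmod (coord X (m, n)))\<^sup>2) \<le> (norm X)\<^sup>2" if "finite F" for F
    using sum_square_le_norm_l2[of "Pair m ` F" X] that by (simp add: sum.reindex inj_on_def)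
  show 1: "(\<lambda>n. coord X (m, n)) \<in> ell2"
    using l2_bound(1)[OF *] by simp
  show "ell2_norm (\<lambda>n. coord X (m, n)) \<le> norm X"
    using l2_bound(2)[OF *] 1 norm_l2_eq[of "Abs_l2 (\<lambda>n. coord X (m, n))"] by simp
qed

lemma ell2_cmult:
  fixes u :: "'i \<Rightarrow> complex"
  shows "u \<in> ell2 \<Longrightarrow> (\<lambda>i. c * u i) \<in> ell2"
  and ell2_norm_cmult: "ell2_norm (\<lambda>i. c * u i) = cmod c * ell2_norm u"
proof -
  show "u \<in> ell2 \<Longrightarrow> (\<lambda>i. c * u i) \<in> ell2"
    by (rule ell2_dominated[of u _ "cmod c"]) (auto simp: norm_mult)
  show "ell2_norm (\<lambda>i. c * u i) = cmod c * ell2_norm u"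
    by (simp add: ell2_norm_def norm_mult power_mult_distrib infsum_cmult_right' real_sqrt_mult)
qed

lemma unemb_in_ell2: "unemb X m \<in> ell2"
  and unemb_norm_le: "ell2_norm (unemb X m) \<le> norm X * (1 / wt m)"
proof -
  have eq: "unemb X m = (\<lambda>n. of_real (1 / wt m) * coord X (m, n))"
    by (auto simp: unemb_def)
  show "unemb X m \<in> ell2" unfolding eq by (intro ell2_cmult slice_in_ell2)
  have "cmod (of_real (1 / wt m)) = 1 / wt m"
    unfolding norm_of_real using wt_pos[of m] by simp
  then have "ell2_norm (unemb X m) = 1 / wt m * ell2_norm (\<lambda>n. coord X (m, n))"
    unfolding eq ell2_norm_cmult by simp
  also have "\<dots> \<le> 1 / wt m * norm X"
    using wt_pos[of m] by (intro mult_left_mono slice_norm_le) auto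
  finally show "ell2_norm (unemb X m) \<le> norm X * (1 / wt m)" by (simp only: mult.commute)
qed

text \<open>Each mode is at most norm X / (1 + m^2), and these weights are summable. This places the
  weighted space inside the absolutely convergent Fourier series.\<close>

lemma unemb_norm_summable: "(\<lambda>m. ell2_norm (unemb X m)) summable_on S"
  and unemb_norm_infsum_le: "(\<Sum>\<^sub>\<infinity>m\<in>S. ell2_norm (unemb X m)) \<le> norm X * inv_wt_sum"
proof -
  have s: "(\<lambda>m. norm X * (1 / wt m)) summable_on UNIV"
    by (intro summable_on_cmult_right summable_inv_wt)
  have u: "(\<lambda>m. ell2_norm (unemb X m)) summable_on UNIV"
    by (rule summable_on_comparison_test[OF s]) (auto simp: unemb_norm_le[simplified] ell2_norm_nonneg)
  then show "(\<lambda>m. ell2_norm (unemb X m)) summable_on S" by (rule summable_on_subset) simp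
  have "(\<Sum>\<^sub>\<infinity>m\<in>S. ell2_norm (unemb X m)) \<le> (\<Sum>\<^sub>\<infinity>m. ell2_norm (unemb X m))"
    by (rule infsum_mono2) (auto intro: u summable_on_subset[OF u] ell2_norm_nonneg)
  also have "\<dots> \<le> (\<Sum>\<^sub>\<infinity>m. norm X * (1 / wt m))"
    by (rule infsum_mono[OF u s]) (rule unemb_norm_le)
  also have "\<dots> = norm X * inv_wt_sum" unfolding inv_wt_sum_def by (rule infsum_cmult_right')
  finally show "(\<Sum>\<^sub>\<infinity>m\<in>S. ell2_norm (unemb X m)) \<le> norm X * inv_wt_sum" .
qed

lemma ell22_norms_summable: "B \<in> ell22 \<Longrightarrow> (\<lambda>m. ell2_norm (B m)) summable_on S"
  using unemb_norm_summable[of "emb B" S] by (simp add: unemb_emb)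

section \<open>Multipliers, shifts and convolution in the mode variable\<close>

definition mode_mult :: "(int \<Rightarrow> complex) \<Rightarrow> (int \<times> 'n) l2 \<Rightarrow>\<^sub>L (int \<times> 'n) l2" where
  "mode_mult f = mult_op (\<lambda>(m, n). f m)"

definition site_mult :: "('n \<Rightarrow> complex) \<Rightarrow> (int \<times> 'n) l2 \<Rightarrow>\<^sub>L (int \<times> 'n) l2" where
  "site_mult a = mult_op (\<lambda>(m, n). a n)"

definition mode_shift :: "int \<Rightarrow> (int \<times> 'n) l2 \<Rightarrow>\<^sub>L (int \<times> 'n) l2" where
  "mode_shift k = reindex_op (\<lambda>(m, n). (m - k, n))"

definition site_shift :: "'n::group_add \<Rightarrow> (int \<times> 'n) l2 \<Rightarrow>\<^sub>L (int \<times> 'n) l2" where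
  "site_shift v = reindex_op (\<lambda>(m, n). (m, n + v))"

lemma coord_mode_mult:
  "(\<And>m. cmod (f m) \<le> K) \<Longrightarrow> coord (mode_mult f X) (m, n) = f m * coord X (m, n)"
  unfolding mode_mult_def by (subst coord_mult_op[where K = K]) auto

lemma coord_site_mult:
  "(\<And>n. cmod (a n) \<le> K) \<Longrightarrow> coord (site_mult a X) (m, n) = a n * coord X (m, n)"
  unfolding site_mult_def by (subst coord_mult_op[where K = K]) auto

lemma norm_site_mult_le: "(\<And>n. cmod (a n) \<le> K) \<Longrightarrow> norm (site_mult a) \<le> K"
  unfolding site_mult_def by (rule norm_mult_op_le) auto

lemma bij_mode_shift: "bij (\<lambda>(m :: int, n). (m - k, n))"
  by (rule bij_betwI[of _ _ _ "\<lambda>(m, n). (m + k, n)"]) auto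

lemma bij_site_shift: "bij (\<lambda>(m :: int, n :: 'n::group_add). (m, n + v))"
  by (rule bij_betwI[of _ _ _ "\<lambda>(m, n). (m, n - v)"]) auto

lemma coord_mode_shift: "coord (mode_shift k X) (m, n) = coord X (m - k, n)"
  unfolding mode_shift_def by (subst coord_reindex_op[OF bij_mode_shift]) simp

lemma coord_site_shift: "coord (site_shift v X) (m, n) = coord X (m, n + v)"
  unfolding site_shift_def by (subst coord_reindex_op[OF bij_site_shift]) simp

lemma norm_mode_shift_le: "norm (mode_shift k) \<le> 1"
  unfolding mode_shift_def by (rule norm_reindex_op_le[OF bij_mode_shift])

text \<open>Pointwise multiplication by the function with Fourier coefficients \<open>A k\<close>,
  seen on Fourier coefficients: the k-th harmonic shifts modes by k and multiplies each site by
  \<open>A k\<close>.\<close>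

definition conv_op :: "(int \<Rightarrow> 'n \<Rightarrow> complex) \<Rightarrow> (int \<times> 'n) l2 \<Rightarrow>\<^sub>L (int \<times> 'n) l2" where
  "conv_op A = (\<Sum>\<^sub>\<infinity>k. site_mult (A k) o\<^sub>L mode_shift k)"

definition wiener :: "(int \<Rightarrow> 'n \<Rightarrow> complex) \<Rightarrow> bool" where
  "wiener A \<longleftrightarrow> (\<forall>k. A k \<in> ell2) \<and> (\<lambda>k. ell2_norm (A k)) summable_on UNIV"

lemma wiener_ell22: "B \<in> ell22 \<Longrightarrow> wiener B"
  by (simp add: wiener_def ell22_norms_summable) (simp add: ell22_def)

lemma wiener_unemb: "wiener (unemb X)"
  by (intro wiener_ell22 unemb_in_ell22)

text \<open>The supremum over sites is at most the ell2 norm and shifts are contractions, so the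
  operator series converges absolutely in norm. The coordinate formula results from applying a
  continuous functional to that sum.\<close>

lemma conv_op:
  fixes A :: "int \<Rightarrow> 'n \<Rightarrow> complex"
  assumes "wiener A"
  shows conv_op_has_sum: "((\<lambda>k. site_mult (A k) o\<^sub>L mode_shift k) has_sum conv_op A) UNIV"
    and norm_conv_op_le: "norm (conv_op A) \<le> (\<Sum>\<^sub>\<infinity>k. ell2_norm (A k))"
    and coord_conv_op: "((\<lambda>k. A k n * coord X (m - k, n)) has_sum coord (conv_op A X) (m, n)) UNIV"
proof -
  have A: "A k \<in> ell2" and sA: "(\<lambda>k. ell2_norm (A k)) summable_on UNIV" for k
    using assms by (auto simp: wiener_def)
  have le: "cmod (A k n) \<le> ell2_norm (A k)" for k n by (rule ell2_norm_coord_le[OF A])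
  have norm_le: "norm (site_mult (A k) o\<^sub>L mode_shift k) \<le> ell2_norm (A k)" for k
  proof -
    have "norm (site_mult (A k) o\<^sub>L mode_shift k)
        \<le> norm (site_mult (A k)) * norm (mode_shift k :: (int \<times> 'n) l2 \<Rightarrow>\<^sub>L (int \<times> 'n) l2)"
      by (rule norm_blinfun_compose)
    also have "\<dots> \<le> ell2_norm (A k) * 1"
      by (intro mult_mono norm_site_mult_le le norm_mode_shift_le) (auto simp: ell2_norm_nonneg)
    finally show ?thesis by simp
  qed
  have "(\<lambda>k. norm (site_mult (A k) o\<^sub>L mode_shift k)) summable_on UNIV"
    by (rule summable_on_comparison_test[OF sA]) (auto simp: norm_le)
  from abs_summable_summable[OF this]
  show hs: "((\<lambda>k. site_mult (A k) o\<^sub>L mode_shift k) has_sum conv_op A) UNIV"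
    unfolding conv_op_def by (rule has_sum_infsum)
  show "norm (conv_op A) \<le> (\<Sum>\<^sub>\<infinity>k. ell2_norm (A k))"
    by (rule norm_infsum_le[OF hs has_sum_infsum[OF sA] norm_le])
  have "bounded_linear (\<lambda>M :: (int \<times> 'n) l2 \<Rightarrow>\<^sub>L (int \<times> 'n) l2. coord (blinfun_apply M X) (m, n))"
    by (rule bounded_linear_compose[OF bounded_linear_coord blinfun.bounded_linear_left])
  from has_sum_bounded_linear[OF this hs]
  show "((\<lambda>k. A k n * coord X (m - k, n)) has_sum coord (conv_op A X) (m, n)) UNIV"
    by (simp add: coord_site_mult[OF le] coord_mode_shift)
qed

lemma conv_op_eqI:
  fixes A :: "int \<Rightarrow> 'n \<Rightarrow> complex" and M :: "(int \<times> 'n) l2 \<Rightarrow>\<^sub>L (int \<times> 'n) l2"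
  assumes "wiener A" "\<And>X m n. ((\<lambda>k. A k n * coord X (m - k, n)) has_sum coord (blinfun_apply M X) (m, n)) UNIV"
  shows "conv_op A = M"
proof (intro blinfun_eqI l2_eqI)
  fix X p
  have "((\<lambda>k. A k (snd p) * coord X (fst p - k, snd p)) has_sum coord (conv_op A X) (fst p, snd p)) UNIV"
    by (rule coord_conv_op[OF assms(1)])
  from has_sum_unique[OF this assms(2)]
  show "coord (conv_op A X) p = coord (M X) p" by simp
qed

lemma conv_op_diff:
  assumes "wiener A" "wiener A'" "wiener (\<lambda>k n. A k n - A' k n)"
  shows "conv_op (\<lambda>k n. A k n - A' k n) = conv_op A - conv_op A'"
proof (rule conv_op_eqI[OF assms(3)])
  fix X m n
  show "((\<lambda>k. (A k n - A' k n) * coord X (m - k, n)) has_sum coord ((conv_op A - conv_op A') X) (m, n)) UNIV"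
    using has_sum_add[OF coord_conv_op[OF assms(1), of n X m] has_sum_uminusI[OF coord_conv_op[OF assms(2), of n X m]]]
    by (simp add: blinfun.diff_left algebra_simps)
qed

text \<open>Through this linear map the analyticity of the breather in the weighted space becomes
  norm analyticity of the multiplication operator.\<close>

lemma bounded_linear_conv_op_unemb: "bounded_linear (\<lambda>X. conv_op (unemb X))"
proof (rule bounded_linear_intro[where K = inv_wt_sum])
  fix X Y :: "(int \<times> 'n) l2" and r :: real
  show "conv_op (unemb (X + Y)) = conv_op (unemb X) + conv_op (unemb Y)"
  proof (rule conv_op_eqI[OF wiener_unemb])
    fix Z m n
    show "((\<lambda>k. unemb (X + Y) k n * coord Z (m - k, n)) has_sum
        coord ((conv_op (unemb X) + conv_op (unemb Y)) Z) (m, n)) UNIV"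
      using has_sum_add[OF coord_conv_op[OF wiener_unemb, of X n Z m] coord_conv_op[OF wiener_unemb, of Y n Z m]]
      by (simp add: blinfun.add_left unemb_def add_divide_distrib distrib_right)
  qed
  show "conv_op (unemb (r *\<^sub>R X)) = r *\<^sub>R conv_op (unemb X)"
  proof (rule conv_op_eqI[OF wiener_unemb])
    fix Z m n
    show "((\<lambda>k. unemb (r *\<^sub>R X) k n * coord Z (m - k, n)) has_sum
        coord ((r *\<^sub>R conv_op (unemb X)) Z) (m, n)) UNIV"
      using has_sum_scaleR[OF coord_conv_op[OF wiener_unemb, of X n Z m], of r]
      by (simp add: blinfun.scaleR_left unemb_def scaleR_conv_of_real mult.assoc)
  qed
  show "norm (conv_op (unemb X)) \<le> norm X * inv_wt_sum"
    by (rule order_trans[OF norm_conv_op_le[OF wiener_unemb] unemb_norm_infsum_le])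
qed

section \<open>The discrete Laplacian\<close>

lemma inner_l2_mono:
  assumes "\<And>i. coord U i \<bullet> coord X i \<le> coord V i \<bullet> coord Y i"
  shows "U \<bullet> X \<le> V \<bullet> Y"
  unfolding inner_l2_def by (rule infsum_mono[OF inner_summable inner_summable assms])

lemma inner_site_shift:
  fixes X Y :: "(int \<times> 'n::group_add) l2"
  shows "site_shift v X \<bullet> site_shift v Y = X \<bullet> Y"
proof -
  have "bij (\<lambda>(m :: int, n :: 'n). (m, n + v))" by (rule bij_site_shift)
  from infsum_reindex_bij_betw[OF this, of "\<lambda>i. coord X i \<bullet> coord Y i"]
  show ?thesis
    by (simp add: inner_l2_def case_prod_unfold coord_site_shift[of v X "fst p" "snd p" for p, simplified]
        coord_site_shift[of v Y "fst p" "snd p" for p, simplified])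
qed

definition lap_op :: "(int \<times> (int ^ 'd)) l2 \<Rightarrow>\<^sub>L (int \<times> (int ^ 'd)) l2" where
  "lap_op = (\<Sum>v\<in>neighbours 0. site_shift v - id_blinfun)"

lemma lap_op_apply: "lap_op X = (\<Sum>v\<in>neighbours 0. site_shift v X - X)"
  by (simp add: lap_op_def blinfun.sum_left blinfun.diff_left)

lemma neighbours_shift: "(\<Sum>k\<in>neighbours n. f k) = (\<Sum>v\<in>neighbours 0. f (n + v))"
  by (rule sum.reindex_bij_witness[of _ "\<lambda>v. n + v" "\<lambda>k. k - n"]) (auto simp: neighbours_def)

lemma coord_lap_op: "coord (lap_op X) (m, n) = laplacian (\<lambda>n. coord X (m, n)) n"
  unfolding laplacian_def
  by (subst neighbours_shift) (simp add: lap_op_apply coord_sum coord_site_shift)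

lemma neighbours_minus: "(\<Sum>v\<in>neighbours 0. f (- v)) = (\<Sum>v\<in>neighbours 0. f v)"
  by (rule sum.reindex_bij_witness[of _ uminus uminus]) (auto simp: neighbours_def)

text \<open>An integer vector of l1 norm 1 has a single nonzero coordinate, equal to 1 or -1. The
  count 2d is what produces the edge 4d of the spectrum in the numerical range estimate.\<close>

lemma card_neighbours_le: "card (neighbours (0 :: int ^ 'd)) \<le> 2 * CARD('d)"
proof -
  have "neighbours (0 :: int ^ 'd) \<subseteq> (\<lambda>(i, s). axis i s) ` (UNIV \<times> {1, -1})"
  proof
    fix k :: "int ^ 'd" assume "k \<in> neighbours 0"
    then have s: "(\<Sum>i\<in>UNIV. \<bar>k $ i\<bar>) = 1" by (simp add: neighbours_def)
    then obtain i where i: "k $ i \<noteq> 0" by (metis abs_zero sum.neutral zero_neq_one)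
    have "(\<Sum>i\<in>UNIV. \<bar>k $ i\<bar>) = \<bar>k $ i\<bar> + (\<Sum>j\<in>UNIV - {i}. \<bar>k $ j\<bar>)"
      by (rule sum.remove) auto
    moreover have "0 \<le> (\<Sum>j\<in>UNIV - {i}. \<bar>k $ j\<bar>)" by (rule sum_nonneg) simp
    ultimately have 1: "\<bar>k $ i\<bar> = 1" and "(\<Sum>j\<in>UNIV - {i}. \<bar>k $ j\<bar>) = 0"
      using s i by linarith+
    then have "\<forall>j\<in>UNIV - {i}. \<bar>k $ j\<bar> = 0" by (subst (asm) sum_nonneg_eq_0_iff) auto
    then have "k = axis i (k $ i)" by (auto simp: vec_eq_iff axis_def)
    moreover have "k $ i \<in> {1, -1}" using 1 by auto
    ultimately show "k \<in> (\<lambda>(i, s). axis i s) ` (UNIV \<times> {1, -1})" by force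
  qed
  then have "card (neighbours (0 :: int ^ 'd)) \<le> card ((\<lambda>(i :: 'd, s :: int). axis i s) ` (UNIV \<times> {1, -1}))"
    by (intro card_mono) auto
  also have "\<dots> \<le> card ((UNIV :: 'd set) \<times> {1, -1 :: int})" by (rule card_image_le) auto
  also have "\<dots> = 2 * CARD('d)" by (simp add: card_cartesian_product)
  finally show ?thesis .
qed

text \<open>Numerical range of the Laplacian: symmetrizing over \<open>\<plusminus>v\<close> removes the imaginary part of \<open>e\<close>.\<close>

lemma inner_lap_op_ge:
  fixes X :: "(int \<times> (int ^ 'd)) l2"
  assumes e: "\<And>m. cmod (e m) \<le> K"
  shows "4 * real CARD('d) * (mode_mult (\<lambda>m. of_real (min (Re (e m)) 0)) X \<bullet> X)
    \<le> mode_mult e (- lap_op X) \<bullet> X"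
proof -
  define E where "E = (mode_mult e :: (int \<times> (int ^ 'd)) l2 \<Rightarrow>\<^sub>L (int \<times> (int ^ 'd)) l2)"
  \<comment> \<open>The negative part of Re e: as minus the Laplacian is nonnegative, only modes
    with negative real part can lower the form.\<close>
  define E' where "E' = (mode_mult (\<lambda>m. of_real (min (Re (e m)) 0)) :: (int \<times> (int ^ 'd)) l2 \<Rightarrow>\<^sub>L (int \<times> (int ^ 'd)) l2)"
  have e': "cmod (of_real (min (Re (e m)) 0)) \<le> K" for m
    using abs_Re_le_cmod[of "e m"] e[of m] by (auto simp: min_def)
  have cE: "coord (E Y) (m, n) = e m * coord Y (m, n)" for Y m n
    unfolding E_def by (rule coord_mode_mult[OF e])
  have cE': "coord (E' Y) (m, n) = of_real (min (Re (e m)) 0) * coord Y (m, n)" for Y m n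
    unfolding E'_def by (rule coord_mode_mult[OF e'])
  have in_e: "(w * z) \<bullet> z = Re w * (z \<bullet> z)" for w z :: complex
    by (simp add: inner_complex_def algebra_simps)
  have ge: "E' Y \<bullet> Y \<le> E Y \<bullet> Y" for Y
  proof (rule inner_l2_mono)
    fix i :: "int \<times> (int ^ 'd)"
    show "coord (E' Y) i \<bullet> coord Y i \<le> coord (E Y) i \<bullet> coord Y i"
      by (cases i) (auto simp: cE cE' in_e intro!: mult_right_mono)
  qed
  have le0: "E' Y \<bullet> Y \<le> 0" for Y
  proof -
    have "E' Y \<bullet> Y \<le> (0 :: (int \<times> (int ^ 'd)) l2) \<bullet> 0"
    proof (rule inner_l2_mono)
      fix i :: "int \<times> (int ^ 'd)"
      show "coord (E' Y) i \<bullet> coord Y i \<le> coord 0 i \<bullet> coord 0 i"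
        by (cases i) (simp add: cE' in_e mult_nonpos_nonneg)
    qed
    then show ?thesis by simp
  qed
  have comm: "E (site_shift v Y) = site_shift v (E Y)" "E' (site_shift v Y) = site_shift v (E' Y)" for v Y
    by (rule l2_eqI, simp add: cE cE' coord_site_shift split_paired_all)+
  have inv: "site_shift v (site_shift (- v) Y) = Y" for v and Y :: "(int \<times> (int ^ 'd)) l2"
  proof (rule l2_eqI)
    fix i :: "int \<times> (int ^ 'd)"
    show "coord (site_shift v (site_shift (- v) Y)) i = coord Y i"
      by (cases i) (simp add: coord_site_shift)
  qed
  define t where "t v = E (X - site_shift v X) \<bullet> X" for v
  \<comment> \<open>The two shift terms add up to the form of E at X - Y, which is bounded below by
    that of E'. The parallelogram identity together with E' \<le> 0 at X + Y gives the factor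
    4.\<close>
  have pair: "4 * (E' X \<bullet> X) \<le> t v + t (- v)" for v
  proof -
    let ?Y = "site_shift v X"
    have "E (site_shift (- v) X) \<bullet> X = E X \<bullet> ?Y"
      using inner_site_shift[of v "E (site_shift (- v) X)" X] by (simp add: comm[symmetric] inv)
    moreover have EY: "E ?Y \<bullet> ?Y = E X \<bullet> X" "E' ?Y \<bullet> ?Y = E' X \<bullet> X"
      by (simp_all add: comm inner_site_shift)
    ultimately have "t v + t (- v) = E (X - ?Y) \<bullet> (X - ?Y)"
      by (simp add: t_def blinfun.diff_right inner_diff_left inner_diff_right)
    moreover have "E' (X - ?Y) \<bullet> (X - ?Y) \<le> E (X - ?Y) \<bullet> (X - ?Y)" by (rule ge)
    moreover have "E' (X - ?Y) \<bullet> (X - ?Y) + E' (X + ?Y) \<bullet> (X + ?Y) = 2 * (E' X \<bullet> X) + 2 * (E' ?Y \<bullet> ?Y)"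
      by (simp add: blinfun.diff_right blinfun.add_right inner_diff_left inner_diff_right
          inner_add_left inner_add_right)
    ultimately show ?thesis using le0[of "X + ?Y"] EY by linarith
  qed
  have "2 * (\<Sum>v\<in>neighbours 0. t v) = (\<Sum>v\<in>neighbours 0. t v + t (- v))"
    by (simp add: sum.distrib neighbours_minus[of t])
  also have "\<dots> \<ge> (\<Sum>v\<in>neighbours (0 :: int ^ 'd). 4 * (E' X \<bullet> X))" by (rule sum_mono) (rule pair)
  finally have "2 * (real (card (neighbours (0 :: int ^ 'd))) * (E' X \<bullet> X)) \<le> (\<Sum>v\<in>neighbours 0. t v)" by simp
  moreover have "2 * real CARD('d) * (E' X \<bullet> X) \<le> real (card (neighbours (0 :: int ^ 'd))) * (E' X \<bullet> X)"
    by (rule mult_right_mono_neg[OF _ le0])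
      (metis card_neighbours_le of_nat_le_iff of_nat_mult of_nat_numeral)
  moreover have "E (- lap_op X) \<bullet> X = (\<Sum>v\<in>neighbours 0. t v)"
    unfolding lap_op_apply sum_negf[symmetric] blinfun.sum_right inner_sum_left t_def by simp
  ultimately show ?thesis unfolding E_def[symmetric] E'_def[symmetric] by linarith
qed

section \<open>Fourier series\<close>

abbreviation abs_summable :: "(int \<Rightarrow> complex) \<Rightarrow> bool" where
  "abs_summable a \<equiv> (\<lambda>m. cmod (a m)) summable_on UNIV"

text \<open>The family \<alpha> k * \<beta> j is absolutely summable over pairs; enumerating the
  pairs by (k, j) and by (k + j, k) gives the same total.\<close>

lemma conv_has_sum:
  fixes \<alpha> \<beta> \<delta> :: "int \<Rightarrow> complex"
  assumes \<alpha>: "abs_summable \<alpha>" and \<beta>: "abs_summable \<beta>"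
    and \<delta>: "\<And>m. ((\<lambda>k. \<alpha> k * \<beta> (m - k)) has_sum \<delta> m) UNIV"
  shows "abs_summable \<delta>" "infsum \<delta> UNIV = infsum \<alpha> UNIV * infsum \<beta> UNIV"
proof -
  define h where "h = (\<lambda>(k, j). \<alpha> k * \<beta> j)"
  define h' where "h' = (\<lambda>(m, k). \<alpha> k * \<beta> (m - k))"
  have "(\<lambda>(k, j). cmod (\<alpha> k) * cmod (\<beta> j)) summable_on (UNIV \<times> UNIV)"
    by (rule summable_on_SigmaI[where g = "\<lambda>k. cmod (\<alpha> k) * (\<Sum>\<^sub>\<infinity>j. cmod (\<beta> j))"])
      (use \<alpha> \<beta> in \<open>auto intro!: has_sum_cmult_right summable_on_cmult_left\<close>)
  then have nh: "(\<lambda>p. norm (h p)) summable_on (UNIV \<times> UNIV)"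
    by (simp add: h_def case_prod_unfold norm_mult)
  have nh': "(\<lambda>p. norm (h' p)) summable_on (UNIV \<times> UNIV)"
    using nh by (subst summable_on_reindex_bij_witness[of _ "\<lambda>(k, j). (k + j, k)" "\<lambda>(m, k). (k, m - k)"
          "UNIV \<times> UNIV" "\<lambda>p. norm (h p)"]) (auto simp: h_def h'_def)
  from abs_summable_summable[OF nh] obtain S where S: "(h has_sum S) (UNIV \<times> UNIV)"
    by (auto simp: summable_on_def)
  have a: "(\<alpha> has_sum infsum \<alpha> UNIV) UNIV" and b: "(\<beta> has_sum infsum \<beta> UNIV) UNIV"
    using \<alpha> \<beta> by (auto intro: has_sum_infsum abs_summable_summable)
  have "((\<lambda>k. \<alpha> k * infsum \<beta> UNIV) has_sum S) UNIV"
    using S by (rule has_sum_SigmaD) (auto simp: h_def intro!: has_sum_cmult_right b)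
  from has_sum_unique[OF this has_sum_cmult_left[OF a]]
  have S_eq: "S = infsum \<alpha> UNIV * infsum \<beta> UNIV" .
  have "(h' has_sum S) (UNIV \<times> UNIV)"
    using S by (subst has_sum_reindex_bij_witness[of _ "\<lambda>(k, j). (k + j, k)" "\<lambda>(m, k). (k, m - k)"
          "UNIV \<times> UNIV" h _ S S]) (auto simp: h_def h'_def)
  then have "(\<delta> has_sum S) UNIV"
    by (rule has_sum_SigmaD) (auto simp: h'_def \<delta>)
  then show "infsum \<delta> UNIV = infsum \<alpha> UNIV * infsum \<beta> UNIV"
    using S_eq infsumI by blast
  have s': "(\<lambda>(m, k). cmod (\<alpha> k * \<beta> (m - k))) summable_on (UNIV \<times> UNIV)"
    using nh' by (simp add: h'_def case_prod_unfold)
  show "abs_summable \<delta>"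
  proof (rule summable_on_comparison_test[OF summable_on_Sigma_banach[OF s']])
    fix m
    have "(\<lambda>k. cmod (\<alpha> k * \<beta> (m - k))) summable_on UNIV" using summable_on_SigmaD1[OF s'] by simp
    from norm_infsum_le[OF \<delta> has_sum_infsum[OF this]]
    show "cmod (\<delta> m) \<le> (\<Sum>\<^sub>\<infinity>k. cmod (\<alpha> k * \<beta> (m - k)))" by simp
  qed auto
qed

definition fser :: "(int \<Rightarrow> complex) \<Rightarrow> real \<Rightarrow> complex" where
  "fser a \<tau> = (\<Sum>\<^sub>\<infinity>m. a m * cis (of_int m * \<tau>))"

text \<open>The phase at m splits into the phases at k and m - k, so the convolution identity
  applies to the phased coefficients.\<close>

lemma fser_conv:
  assumes a: "abs_summable a" and b: "abs_summable b"
    and d: "\<And>m. ((\<lambda>k. a k * b (m - k)) has_sum d m) UNIV"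
  shows "abs_summable d" "fser d \<tau> = fser a \<tau> * fser b \<tau>"
proof -
  show "abs_summable d" by (rule conv_has_sum(1)[OF a b d])
  have "((\<lambda>k. (a k * cis (of_int k * \<tau>)) * (b (m - k) * cis (of_int (m - k) * \<tau>)))
      has_sum (d m * cis (of_int m * \<tau>))) UNIV" for m
  proof -
    have eq: "(a k * cis (of_int k * \<tau>)) * (b (m - k) * cis (of_int (m - k) * \<tau>))
        = a k * b (m - k) * cis (of_int m * \<tau>)" for k
    proof -
      have "cis (of_int k * \<tau>) * cis (of_int (m - k) * \<tau>) = cis (of_int m * \<tau>)"
        by (simp add: cis_mult algebra_simps)
      then show ?thesis by (simp add: mult_ac)
    qed
    show ?thesis unfolding eq by (rule has_sum_cmult_left[OF d])
  qed
  from conv_has_sum(2)[OF _ _ this] a b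
  show "fser d \<tau> = fser a \<tau> * fser b \<tau>" by (simp add: fser_def norm_mult)
qed

lemma integral_cis:
  "((\<lambda>\<tau>. cis (of_int j * \<tau>)) has_integral (if j = 0 then 2 * of_real pi else 0)) {-pi..pi}"
proof (cases "j = 0")
  case True
  show ?thesis
    using has_integral_const_real[of "1 :: complex" "-pi" pi] True
    by (simp add: scaleR_conv_of_real)
next
  case False
  define F where "F z = exp (\<i> * of_int j * z) / (\<i> * of_int j)" for z :: complex
  have "((\<lambda>\<tau>. F (of_real \<tau>)) has_vector_derivative cis (of_int j * \<tau>)) (at \<tau> within {-pi..pi})" for \<tau>
  proof (rule has_vector_derivative_real_field)
    show "(F has_field_derivative cis (of_int j * \<tau>)) (at (of_real \<tau>))"
      unfolding F_def cis_conv_exp using False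
      by (auto intro!: derivative_eq_intros simp: mult_ac)
  qed
  then have "((\<lambda>\<tau>. cis (of_int j * \<tau>)) has_integral (F (of_real pi) - F (of_real (-pi)))) {-pi..pi}"
    by (intro fundamental_theorem_of_calculus) auto
  moreover have "F (of_real pi) = F (of_real (-pi))"
  proof -
    have "cis (of_int j * pi) = cis (- (of_int j * pi))"
      using sin_npi_int[of j] by (simp add: complex_eq_iff mult.commute)
    then show ?thesis by (simp add: F_def cis_conv_exp mult_ac)
  qed
  ultimately show ?thesis using False by simp
qed

text \<open>Absolute summability makes the partial sums converge uniformly, so the integral passes
  to the limit. By orthogonality the integrals of the partial sums are constant as soon as the index
  set contains m.\<close>

lemma fourier_coefficient:
  assumes a: "abs_summable a"
  shows "integral {-pi..pi} (\<lambda>\<tau>. fser a \<tau> * cis (- (of_int m * \<tau>))) = 2 * of_real pi * a m"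
proof -
  define f where "f F \<tau> = (\<Sum>k\<in>F. a k * cis (of_int k * \<tau>)) * cis (- (of_int m * \<tau>))" for F \<tau>
  have "uniform_limit ({-pi..pi}) (\<lambda>F \<tau>. \<Sum>k\<in>F. a k * cis (of_int k * \<tau>)) (fser a) (finite_subsets_at_top UNIV)"
    unfolding fser_def
    by (rule Weierstrass_m_test_general[where M = "\<lambda>k. cmod (a k)"]) (use a in \<open>auto simp: norm_mult\<close>)
  then have u: "uniform_limit ({-pi..pi}) f (\<lambda>\<tau>. fser a \<tau> * cis (- (of_int m * \<tau>))) (finite_subsets_at_top UNIV)"
    unfolding f_def uniform_limit_iff by (simp add: dist_norm left_diff_distrib[symmetric] norm_mult)
  obtain I J where IJ: "\<And>F. (f F has_integral I F) ({-pi..pi})"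
      "((\<lambda>\<tau>. fser a \<tau> * cis (- (of_int m * \<tau>))) has_integral J) ({-pi..pi})"
      "(I \<longlongrightarrow> J) (finite_subsets_at_top UNIV)"
    by (rule uniform_limit_integral[OF u]) (auto simp: f_def cis_conv_exp intro!: continuous_intros)
  have "I F = 2 * of_real pi * a m" if "finite F" "m \<in> F" for F
  proof -
    have "f F = (\<lambda>\<tau>. \<Sum>k\<in>F. a k * cis (of_int (k - m) * \<tau>))"
      unfolding f_def sum_distrib_right
      by (intro ext sum.cong) (simp_all add: mult.assoc cis_mult left_diff_distrib)
    moreover have "((\<lambda>\<tau>. \<Sum>k\<in>F. a k * cis (of_int (k - m) * \<tau>)) has_integral
        (\<Sum>k\<in>F. a k * (if k - m = 0 then 2 * of_real pi else 0))) {-pi..pi}"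
      by (intro has_integral_sum that has_integral_mult_right integral_cis)
    ultimately have "I F = (\<Sum>k\<in>F. a k * (if k - m = 0 then 2 * of_real pi else 0))"
      using IJ(1)[of F] has_integral_unique by metis
    also have "\<dots> = (\<Sum>k\<in>F. if k = m then 2 * of_real pi * a m else 0)"
      by (rule sum.cong) auto
    finally show ?thesis using that by simp
  qed
  then have "eventually (\<lambda>F. I F = 2 * of_real pi * a m) (finite_subsets_at_top UNIV)"
    unfolding eventually_finite_subsets_at_top by (intro exI[of _ "{m}"]) auto
  then have "(I \<longlongrightarrow> 2 * of_real pi * a m) (finite_subsets_at_top UNIV)"
    by (rule tendsto_eventually)
  then have "J = 2 * of_real pi * a m"
    using IJ(3) tendsto_unique[OF finite_subsets_at_top_neq_bot] by blast
  then show ?thesis using IJ(2) by (simp add: integral_unique)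
qed

primrec blinfun_pow :: "('a::real_normed_vector \<Rightarrow>\<^sub>L 'a) \<Rightarrow> nat \<Rightarrow> 'a \<Rightarrow>\<^sub>L 'a" where
  "blinfun_pow M 0 = id_blinfun"
| "blinfun_pow M (Suc j) = M o\<^sub>L blinfun_pow M j"

text \<open>The induction carries absolute summability along with the product formula, because each
  further convolution needs it as input.\<close>

lemma fser_conv_op_pow:
  assumes A: "wiener A" and Y: "abs_summable (\<lambda>m. coord Y (m, n))"
  shows "abs_summable (\<lambda>m. coord (blinfun_pow (conv_op A) j Y) (m, n)) \<and>
    fser (\<lambda>m. coord (blinfun_pow (conv_op A) j Y) (m, n)) \<tau>
      = fourier_series A \<tau> n ^ j * fser (\<lambda>m. coord Y (m, n)) \<tau>"
proof (induction j)
  case (Suc j)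
  have a: "abs_summable (\<lambda>m. A m n)"
  proof (rule summable_on_comparison_test)
    show "(\<lambda>k. ell2_norm (A k)) summable_on UNIV" using A by (simp add: wiener_def)
    show "cmod (A k n) \<le> ell2_norm (A k)" for k
      using A by (intro ell2_norm_coord_le) (simp add: wiener_def)
  qed auto
  note * = fser_conv[OF a conjunct1[OF Suc.IH] coord_conv_op[OF A]]
  have "fser (\<lambda>m. A m n) \<tau> = fourier_series A \<tau> n" by (simp add: fser_def fourier_series_def)
  then show ?case using *(1) *(2)[of \<tau>] Suc.IH by (simp add: mult.assoc)
qed (use Y in simp)

text \<open>This converts the integral of U^(2p) W in the spectral problem into a power of the
  convolution operator applied to the coefficients of W.\<close>

lemma fourier_coefficient_conv_op_pow:
  assumes A: "wiener A" and Y: "abs_summable (\<lambda>m. coord Y (m, n))"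
    and B: "\<And>m. coord Y (m, n) = B m n"
  shows "integral {-pi..pi}
      (\<lambda>\<tau>. fourier_series A \<tau> n ^ j * fourier_series B \<tau> n * cis (- (of_int m * \<tau>)))
    = 2 * of_real pi * coord (blinfun_pow (conv_op A) j Y) (m, n)"
proof -
  note * = fser_conv_op_pow[OF A Y, of j]
  have "fourier_series B \<tau> n = fser (\<lambda>m. coord Y (m, n)) \<tau>" for \<tau>
    by (simp add: fser_def fourier_series_def B)
  with * have "(\<lambda>\<tau>. fourier_series A \<tau> n ^ j * fourier_series B \<tau> n * cis (- (of_int m * \<tau>)))
     = (\<lambda>\<tau>. fser (\<lambda>m. coord (blinfun_pow (conv_op A) j Y) (m, n)) \<tau> * cis (- (of_int m * \<tau>)))"
    by auto
  then show ?thesis using fourier_coefficient[OF conjunct1[OF *]] by simp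
qed

section \<open>Analytic branches\<close>

text \<open>Convergence at t = r/2 bounds the terms there, which is the geometric coefficient bound
  of \<open>analytic_near_power_series\<close> on half the radius.\<close>

lemma analytic_nearI:
  assumes "0 < r" and f: "\<And>t. \<bar>t\<bar> < r \<Longrightarrow> (\<lambda>k. t ^ k *\<^sub>R a k) sums f (x + t)"
  shows "analytic_near f x"
proof -
  have "(\<lambda>k. (r / 2) ^ k *\<^sub>R a k) \<longlonglongrightarrow> 0"
    using f[of "r / 2"] assms(1) by (intro summable_LIMSEQ_zero sums_summable) auto
  then have "Bseq (\<lambda>k. (r / 2) ^ k *\<^sub>R a k)" by (rule convergent_imp_Bseq[OF convergentI])
  then obtain M where "\<And>k. norm ((r / 2) ^ k *\<^sub>R a k) \<le> M" by (auto simp: Bseq_def)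
  then have "\<And>k. norm (a k) * (r / 2) ^ k \<le> M" using assms(1) by (simp add: mult.commute)
  then show ?thesis
    using assms by (intro analytic_near_power_series[of "r / 2" a M]) auto
qed

lemma analytic_near_emb:
  assumes A: "real_analytic_ell22 A {0<..<e}" and x: "x \<in> {0<..<e}"
  shows "analytic_near (\<lambda>\<epsilon>. emb (A \<epsilon>)) x"
proof -
  obtain r a where r: "0 < r" and a: "\<And>k. a k \<in> ell22"
    and conv: "\<And>y. y \<in> {0<..<e} \<Longrightarrow> \<bar>y - x\<bar> < r \<Longrightarrow> A y \<in> ell22 \<and>
       (\<lambda>N. ell22_norm (\<lambda>m n. A y m n - (\<Sum>k<N. complex_of_real ((y - x) ^ k) * a k m n))) \<longlonglongrightarrow> 0"
    using A x unfolding real_analytic_ell22_def by blast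
  \<comment> \<open>The expansion is asserted only at points of the open interval, so the radius is
    cut down until x + t cannot leave it.\<close>
  define r' where "r' = min r (min x (e - x))"
  show ?thesis
  proof (rule analytic_nearI[where r = r' and a = "\<lambda>k. emb (a k)"])
    show "0 < r'" using r x by (simp add: r'_def)
    fix t assume t: "\<bar>t\<bar> < r'"
    then have y: "x + t \<in> {0<..<e}" "\<bar>x + t - x\<bar> < r" by (auto simp: r'_def)
    have Ay: "A (x + t) \<in> ell22" using conv[OF y] by blast
    have eq: "(\<lambda>m n. A (x + t) m n - (\<Sum>k<N. complex_of_real ((x + t - x) ^ k) * a k m n))
        = unemb (emb (A (x + t)) - (\<Sum>k<N. t ^ k *\<^sub>R emb (a k)))" for N
    proof (intro ext)
      fix m n
      have "coord (emb (a k)) (m, n) = of_real (wt m) * a k m n" for k by (rule coord_emb[OF a])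
      then show "A (x + t) m n - (\<Sum>k<N. complex_of_real ((x + t - x) ^ k) * a k m n)
          = unemb (emb (A (x + t)) - (\<Sum>k<N. t ^ k *\<^sub>R emb (a k))) m n"
        by (simp add: unemb_def coord_emb[OF Ay] coord_sum scaleR_conv_of_real diff_divide_distrib
            sum_divide_distrib mult.left_commute[of "complex_of_real (wt m)"])
    qed
    have "(\<lambda>N. norm (emb (A (x + t)) - (\<Sum>k<N. t ^ k *\<^sub>R emb (a k)))) \<longlonglongrightarrow> 0"
      using conv[OF y] unfolding eq ell22_norm_unemb by blast
    then have "(\<lambda>N. norm ((\<Sum>k<N. t ^ k *\<^sub>R emb (a k)) - emb (A (x + t)))) \<longlonglongrightarrow> 0"
      by (simp only: norm_minus_commute)
    then show "(\<lambda>k. t ^ k *\<^sub>R emb (a k)) sums emb (A (x + t))"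
      unfolding sums_def by (subst LIM_zero_iff[symmetric], subst tendsto_norm_zero_iff[symmetric])
  qed
qed

lemma analytic_near_sums:
  assumes "analytic_near f x"
  obtains r a where "0 < r" "\<And>y. \<bar>y - x\<bar> < r \<Longrightarrow> (\<lambda>k. (y - x) ^ k *\<^sub>R a k) sums f y"
proof -
  obtain r F where r: "0 < r" and F: "\<And>t. \<bar>t\<bar> \<le> 1 \<Longrightarrow> f (x + r * t) = ser_eval F t"
    using assms by (auto simp: analytic_near_def)
  show thesis
  proof (rule that[of r "\<lambda>k. inverse r ^ k *\<^sub>R ser_coeff F k"])
    fix y assume "\<bar>y - x\<bar> < r"
    then have t: "\<bar>(y - x) / r\<bar> \<le> 1" using r by simp
    have "(\<lambda>k. ((y - x) / r) ^ k *\<^sub>R ser_coeff F k) sums f y"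
      using ser_eval_sums[OF t, of F] F[OF t] r by simp
    then show "(\<lambda>k. (y - x) ^ k *\<^sub>R (inverse r ^ k *\<^sub>R ser_coeff F k)) sums f y"
      by (simp add: divide_inverse power_mult_distrib)
  qed (rule r)
qed

lemma real_analytic_ell22_unemb:
  assumes "\<And>x. x \<in> S \<Longrightarrow> analytic_near X x"
  shows "real_analytic_ell22 (\<lambda>\<epsilon>. unemb (X \<epsilon>)) S"
  unfolding real_analytic_ell22_def
proof
  fix x assume "x \<in> S"
  then obtain r a where r: "0 < r" and a: "\<And>y. \<bar>y - x\<bar> < r \<Longrightarrow> (\<lambda>k. (y - x) ^ k *\<^sub>R a k) sums X y"
    by (rule analytic_near_sums[OF assms]) blast
  have "(\<lambda>N. ell22_norm (\<lambda>m n. unemb (X y) m n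
      - (\<Sum>k<N. complex_of_real ((y - x) ^ k) * unemb (a k) m n))) \<longlonglongrightarrow> 0" if "\<bar>y - x\<bar> < r" for y
  proof -
    have eq: "(\<lambda>m n. unemb (X y) m n - (\<Sum>k<N. complex_of_real ((y - x) ^ k) * unemb (a k) m n))
       = unemb (X y - (\<Sum>k<N. (y - x) ^ k *\<^sub>R a k))" for N
      by (intro ext) (simp add: unemb_def coord_sum scaleR_conv_of_real diff_divide_distrib sum_divide_distrib)
    have "(\<lambda>N. (\<Sum>k<N. (y - x) ^ k *\<^sub>R a k)) \<longlonglongrightarrow> X y" using a[OF that] by (simp add: sums_def)
    from tendsto_norm_zero[OF LIM_zero[OF this]]
    show ?thesis unfolding eq ell22_norm_unemb by (simp only: norm_minus_commute)
  qed
  then show "\<exists>r>0. \<exists>a. (\<forall>k. a k \<in> ell22) \<and>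
     (\<forall>y\<in>S. \<bar>y - x\<bar> < r \<longrightarrow> unemb (X y) \<in> ell22 \<and>
       (\<lambda>N. ell22_norm (\<lambda>m n. unemb (X y) m n - (\<Sum>k<N. complex_of_real ((y - x) ^ k) * a k m n)))
         \<longlonglongrightarrow> 0)"
    using r unemb_in_ell22 by (intro exI[of _ r] conjI exI[of _ "\<lambda>k. unemb (a k)"]) auto
qed

lemma real_analytic_complexI:
  assumes "\<And>x. x \<in> S \<Longrightarrow> analytic_near f x"
  shows "real_analytic_complex f S"
  unfolding real_analytic_complex_def
proof
  fix x assume "x \<in> S"
  then obtain r a where "0 < r" "\<And>y. \<bar>y - x\<bar> < r \<Longrightarrow> (\<lambda>k. (y - x) ^ k *\<^sub>R a k) sums f y"
    by (rule analytic_near_sums[OF assms]) blast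
  then show "\<exists>r>0. \<exists>a. \<forall>y\<in>S. \<bar>y - x\<bar> < r \<longrightarrow> (\<lambda>k. complex_of_real ((y - x) ^ k) * a k) sums f y"
    unfolding scaleR_conv_of_real by blast
qed

text \<open>The two properties that \<open>pencil_analytic_branch\<close> asks of its coefficients,
  bundled so that they pass through sums and products: analyticity at each positive parameter, and a
  linear rate of approach to a limit at 0.\<close>

definition regular_branch :: "real \<Rightarrow> (real \<Rightarrow> 'a::banach) \<Rightarrow> 'a \<Rightarrow> bool" where
  "regular_branch e f f0 \<longleftrightarrow> (\<exists>K\<ge>0. \<forall>\<epsilon>\<in>{0<..<e}. norm (f \<epsilon> - f0) \<le> K * \<epsilon>) \<and>
     (\<forall>\<epsilon>\<in>{0<..<e}. analytic_near f \<epsilon>)"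

lemma regular_branch_const: "regular_branch e (\<lambda>_. c) c"
  by (auto simp: regular_branch_def analytic_near_const)

lemma regular_branch_ident: "regular_branch e (\<lambda>\<epsilon>. \<epsilon>) 0"
  by (auto simp: regular_branch_def analytic_near_ident intro!: exI[of _ 1])

lemma regular_branch_add:
  assumes "regular_branch e f f0" "regular_branch e g g0"
  shows "regular_branch e (\<lambda>\<epsilon>. f \<epsilon> + g \<epsilon>) (f0 + g0)"
proof -
  obtain K1 where K1: "0 \<le> K1" "\<And>\<epsilon>. \<epsilon> \<in> {0<..<e} \<Longrightarrow> norm (f \<epsilon> - f0) \<le> K1 * \<epsilon>"
    using assms(1) by (auto simp: regular_branch_def)
  obtain K2 where K2: "0 \<le> K2" "\<And>\<epsilon>. \<epsilon> \<in> {0<..<e} \<Longrightarrow> norm (g \<epsilon> - g0) \<le> K2 * \<epsilon>"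
    using assms(2) by (auto simp: regular_branch_def)
  have "norm (f \<epsilon> + g \<epsilon> - (f0 + g0)) \<le> (K1 + K2) * \<epsilon>" if "\<epsilon> \<in> {0<..<e}" for \<epsilon>
  proof -
    have "f \<epsilon> + g \<epsilon> - (f0 + g0) = (f \<epsilon> - f0) + (g \<epsilon> - g0)" by simp
    then show ?thesis
      using norm_triangle_ineq[of "f \<epsilon> - f0" "g \<epsilon> - g0"] K1(2)[OF that] K2(2)[OF that]
      by (simp only: distrib_right)
  qed
  then show ?thesis
    using assms K1 K2 unfolding regular_branch_def
    by (intro conjI exI[of _ "K1 + K2"] ballI analytic_near_add) auto
qed

lemma regular_branch_bilinear:
  assumes "bounded_bilinear pr" "regular_branch e f f0" "regular_branch e g g0"
  shows "regular_branch e (\<lambda>\<epsilon>. pr (f \<epsilon>) (g \<epsilon>)) (pr f0 g0)"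
proof -
  interpret bounded_bilinear pr by fact
  obtain c where c: "0 \<le> c" "\<And>a b. norm (pr a b) \<le> norm a * norm b * c" using nonneg_bounded by blast
  obtain K1 where K1: "0 \<le> K1" "\<And>\<epsilon>. \<epsilon> \<in> {0<..<e} \<Longrightarrow> norm (f \<epsilon> - f0) \<le> K1 * \<epsilon>"
    using assms(2) by (auto simp: regular_branch_def)
  obtain K2 where K2: "0 \<le> K2" "\<And>\<epsilon>. \<epsilon> \<in> {0<..<e} \<Longrightarrow> norm (g \<epsilon> - g0) \<le> K2 * \<epsilon>"
    using assms(3) by (auto simp: regular_branch_def)
  define K where "K = K1 * (K2 * \<bar>e\<bar> + norm g0) * c + norm f0 * K2 * c"
  have "norm (pr (f \<epsilon>) (g \<epsilon>) - pr f0 g0) \<le> K * \<epsilon>" if e: "\<epsilon> \<in> {0<..<e}" for \<epsilon>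
  proof -
    have "norm (g \<epsilon>) \<le> norm (g \<epsilon> - g0) + norm g0"
      using norm_triangle_ineq[of "g \<epsilon> - g0" g0] by simp
    also have "\<dots> \<le> K2 * \<bar>e\<bar> + norm g0"
      using K2(2)[OF e] mult_left_mono[OF _ K2(1), of \<epsilon> "\<bar>e\<bar>"] e by auto
    finally have g: "norm (g \<epsilon>) \<le> K2 * \<bar>e\<bar> + norm g0" .
    have 1: "norm (pr (f \<epsilon> - f0) (g \<epsilon>)) \<le> (K1 * \<epsilon>) * (K2 * \<bar>e\<bar> + norm g0) * c"
      by (rule order_trans[OF c(2)])
        (intro mult_right_mono mult_mono K1(2) e g c(1) norm_ge_zero mult_nonneg_nonneg K1(1), use e in auto)
    have 2: "norm (pr f0 (g \<epsilon> - g0)) \<le> norm f0 * (K2 * \<epsilon>) * c"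
      by (rule order_trans[OF c(2)]) (intro mult_right_mono mult_left_mono K2(2) e c(1) norm_ge_zero)
    have "pr (f \<epsilon>) (g \<epsilon>) - pr f0 g0 = pr (f \<epsilon> - f0) (g \<epsilon>) + pr f0 (g \<epsilon> - g0)"
      by (simp add: diff_left diff_right)
    then have "norm (pr (f \<epsilon>) (g \<epsilon>) - pr f0 g0)
        \<le> (K1 * \<epsilon>) * (K2 * \<bar>e\<bar> + norm g0) * c + norm f0 * (K2 * \<epsilon>) * c"
      using norm_triangle_mono[OF 1 2] by simp
    also have "\<dots> = K * \<epsilon>" by (simp add: K_def algebra_simps)
    finally show ?thesis .
  qed
  moreover have "0 \<le> K" using K1(1) K2(1) c(1) by (simp add: K_def)
  ultimately show ?thesis
    using assms unfolding regular_branch_def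
    by (intro conjI exI[of _ K] ballI analytic_near_bilinear[OF assms(1)]) auto
qed

lemma regular_branch_scaleR:
  "regular_branch e f f0 \<Longrightarrow> regular_branch e (\<lambda>\<epsilon>. f \<epsilon> *\<^sub>R c) (f0 *\<^sub>R c)"
  by (rule regular_branch_bilinear[OF bounded_bilinear_scaleR _ regular_branch_const])

lemma regular_branch_compose:
  "regular_branch e f f0 \<Longrightarrow> regular_branch e g g0 \<Longrightarrow> regular_branch e (\<lambda>\<epsilon>. f \<epsilon> o\<^sub>L g \<epsilon>) (f0 o\<^sub>L g0)"
  by (rule regular_branch_bilinear[OF bounded_bilinear_blinfun_compose])

lemma regular_branch_pow:
  "regular_branch e M M0 \<Longrightarrow> regular_branch e (\<lambda>\<epsilon>. blinfun_pow (M \<epsilon>) j) (blinfun_pow M0 j)"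
  by (induction j) (simp_all add: regular_branch_const regular_branch_compose)

lemma regular_branch_sqrt:
  assumes "0 < e" "e * \<bar>\<Omega>\<bar> \<le> 1 / 2"
  shows "regular_branch e (\<lambda>\<epsilon>. sqrt (1 - \<epsilon> * \<Omega>)) 1"
proof -
  have pos: "1 / 2 \<le> 1 - \<epsilon> * \<Omega>" if "\<epsilon> \<in> {0<..<e}" for \<epsilon>
  proof -
    have "\<epsilon> * \<Omega> \<le> \<epsilon> * \<bar>\<Omega>\<bar>" using that by (intro mult_left_mono) auto
    also have "\<dots> \<le> e * \<bar>\<Omega>\<bar>" using that by (intro mult_right_mono) auto
    finally show ?thesis using assms(2) by linarith
  qed
  have "norm (sqrt (1 - \<epsilon> * \<Omega>) - 1) \<le> \<bar>\<Omega>\<bar> * \<epsilon>" if "\<epsilon> \<in> {0<..<e}" for \<epsilon>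
  proof -
    let ?s = "sqrt (1 - \<epsilon> * \<Omega>)"
    \<comment> \<open>The identity (s - 1)(s + 1) = -\<epsilon>\<Omega> with s + 1 \<ge> 1 avoids a
      division.\<close>
    have s: "0 \<le> ?s" "?s * ?s = 1 - \<epsilon> * \<Omega>" using pos[OF that] by auto
    have "\<bar>?s - 1\<bar> * 1 \<le> \<bar>?s - 1\<bar> * (?s + 1)" using s by (intro mult_left_mono) auto
    also have "\<dots> = \<bar>(?s - 1) * (?s + 1)\<bar>" using s(1) by (simp add: abs_mult)
    also have "\<dots> = \<bar>\<Omega>\<bar> * \<epsilon>"
      using s(2) that by (simp add: algebra_simps abs_mult)
    finally show ?thesis by simp
  qed
  moreover have "analytic_near (\<lambda>\<epsilon>. sqrt (1 - \<epsilon> * \<Omega>)) \<epsilon>" if e: "\<epsilon> \<in> {0<..<e}" for \<epsilon>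
  proof -
    define a where "a = 1 - \<epsilon> * \<Omega>"
    \<comment> \<open>The binomial series is expanded about a = 1 - \<epsilon>\<Omega> in the
      variable -t\<Omega>/a; this radius keeps its modulus below 1 and remains defined for \<Omega>
      = 0.\<close>
    define r where "r = a / (\<bar>\<Omega>\<bar> + 1)"
    have a: "1 / 2 \<le> a" using pos[OF e] by (simp add: a_def)
    show ?thesis
    proof (rule analytic_nearI[where r = r and a = "\<lambda>k. sqrt a * (((1/2) gchoose k) * (- \<Omega> / a) ^ k)"])
      show "0 < r" using a by (simp add: r_def)
      fix t assume t: "\<bar>t\<bar> < r"
      have "\<bar>t\<bar> * (\<bar>\<Omega>\<bar> + 1) < a" using t by (simp add: r_def pos_less_divide_eq)
      then have "\<bar>t\<bar> * \<bar>\<Omega>\<bar> < a" by (simp add: algebra_simps)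
      then have z: "\<bar>t * (- \<Omega> / a)\<bar> < 1" using a by (simp add: abs_mult)
      from gen_binomial_real[OF z, of "1/2"]
      have "(\<lambda>k. sqrt a * ((1/2 gchoose k) * (t * (- \<Omega> / a)) ^ k)) sums (sqrt a * (1 + t * (- \<Omega> / a)) powr (1/2))"
        by (intro sums_mult)
      moreover have "sqrt a * (1 + t * (- \<Omega> / a)) powr (1/2) = sqrt (1 - (\<epsilon> + t) * \<Omega>)"
      proof -
        have "0 \<le> 1 + t * (- \<Omega> / a)" using z by linarith
        then have "sqrt a * (1 + t * (- \<Omega> / a)) powr (1/2) = sqrt (a * (1 + t * (- \<Omega> / a)))"
          by (simp add: powr_half_sqrt real_sqrt_mult)
        also have "a * (1 + t * (- \<Omega> / a)) = 1 - (\<epsilon> + t) * \<Omega>"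
          using a by (simp add: field_simps a_def)
        finally show ?thesis .
      qed
      ultimately show "(\<lambda>k. t ^ k *\<^sub>R (sqrt a * ((1/2 gchoose k) * (- \<Omega> / a) ^ k))) sums sqrt (1 - (\<epsilon> + t) * \<Omega>)"
        by (simp only: power_mult_distrib[of t] real_scaleR_def mult_ac)
    qed
  qed
  ultimately show ?thesis
    unfolding regular_branch_def by (intro conjI exI[of _ "\<bar>\<Omega>\<bar>"] ballI) auto
qed

section \<open>Powers of the leading-order breather\<close>

lemma laplacian_add: "laplacian (\<lambda>n. u n + w n) n = laplacian u n + laplacian w n"
  by (simp add: laplacian_def sum.distrib[symmetric] algebra_simps)

lemma laplacian_cmult:
  fixes c :: complex
  shows "laplacian (\<lambda>n. c * u n) n = c * laplacian u n"
  by (simp add: laplacian_def sum_distrib_left algebra_simps)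

text \<open>The right-hand side is the infimum of Re (c (s - z)) over s in [0, 4D]: a rotation c
  that moves the segment strictly into a half-plane seen from z. For nonreal z take c = i or -i, for
  real z take 1 or -1.\<close>

lemma separating_phase:
  fixes z :: complex
  assumes "z \<notin> of_real ` {0..4 * D}" "0 \<le> D"
  obtains c \<alpha> where "cmod c = 1" "0 < \<alpha>" "\<alpha> \<le> Re (- (c * z)) + 4 * D * min (Re c) 0"
proof (cases "Im z = 0")
  case False
  show thesis
    by (rule that[of "\<i> * of_real (sgn (Im z))" "\<bar>Im z\<bar>"]) (use False in \<open>auto simp: norm_mult sgn_if\<close>)
next
  case True
  then have z: "z = of_real (Re z)" by (simp add: complex_eq_iff)
  then have "Re z \<notin> {0..4 * D}" using assms(1) by (metis image_eqI)
  then consider "Re z < 0" | "Re z > 4 * D" by fastforce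
  then show thesis
  proof cases
    case 1 show thesis by (rule that[of 1 "- Re z"]) (use 1 in auto)
  next
    case 2 show thesis by (rule that[of "-1" "Re z - 4 * D"]) (use 2 assms(2) in auto)
  qed
qed

text \<open>The two right-hand sides have sum (1 + 2p) \<gamma> and difference \<gamma>, which are
  exactly the two potential coefficients of the dNLS matrix.\<close>

lemma binomial_gamma:
  shows "(1 + 2 * real p) * real (2 * p choose p) = (real p + 1) * gamma_coeff p"
    and "(1 + 2 * real p) * real (2 * p choose (p + 1)) = real p * gamma_coeff p"
proof -
  have f: "fact (2 * p + 1) = (1 + 2 * real p) * fact (2 * p)" "fact (p + 1) = (real p + 1) * fact p"
    by (simp_all add: algebra_simps)
  show "(1 + 2 * real p) * real (2 * p choose p) = (real p + 1) * gamma_coeff p"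
  proof -
    have b: "real (2 * p choose p) = fact (2 * p) / (fact p * fact p)"
      using binomial_fact[of p "2 * p", where 'a = real] by simp
    have "a * (F / (B * B)) = q * ((a * F) / (B * (q * B)))" if "B \<noteq> 0" "q \<noteq> 0" for a F B q :: real
      using that by (simp add: field_simps)
    then show ?thesis unfolding gamma_coeff_def f b by simp
  qed
  show "(1 + 2 * real p) * real (2 * p choose (p + 1)) = real p * gamma_coeff p"
  proof (cases p)
    case (Suc q)
    have g: "fact p = real p * fact q" using Suc by simp
    have "real (2 * p choose (p + 1)) = fact (2 * p) / (fact (p + 1) * fact q)"
      using binomial_fact[of "p + 1" "2 * p", where 'a = real] Suc by simp
    moreover have "a * (F / (q * (r * B) * B)) = r * ((a * F) / ((r * B) * (q * (r * B))))"
      if "B \<noteq> 0" "r \<noteq> 0" "q \<noteq> 0" for a F B r q :: real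
      using that by (simp add: field_simps)
    ultimately show ?thesis
      unfolding gamma_coeff_def f g using Suc by simp
  qed (simp add: gamma_coeff_def)
qed

text \<open>Multiplication by 2 cos \<tau> on Fourier coefficients. The leading-order breather is 2
  \<A> cos \<tau>, so its powers act as powers of \<A> at each site times powers of this
  operator.\<close>

definition hop :: "(int \<times> 'n) l2 \<Rightarrow>\<^sub>L (int \<times> 'n) l2" where
  "hop = mode_shift 1 + mode_shift (- 1)"

lemma coord_hop: "coord (hop X) (m, n) = coord X (m - 1, n) + coord X (m + 1, n)"
  by (simp add: hop_def blinfun.add_left coord_mode_shift)

lemma pascal_sum:
  fixes f :: "nat \<Rightarrow> complex"
  shows "(\<Sum>i\<le>Suc j. of_nat (Suc j choose i) * f i) = (\<Sum>i\<le>j. of_nat (j choose i) * (f i + f (Suc i)))"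
proof -
  have "(\<Sum>i\<le>j. of_nat (j choose i) * f i) = (\<Sum>i\<le>Suc j. of_nat (j choose i) * f i)" by simp
  also have "\<dots> = f 0 + (\<Sum>i\<le>j. of_nat (j choose Suc i) * f (Suc i))"
    by (subst sum.atMost_Suc_shift) simp
  finally have "(\<Sum>i\<le>j. of_nat (j choose i) * (f i + f (Suc i)))
      = f 0 + (\<Sum>i\<le>j. of_nat (j choose Suc i) * f (Suc i)) + (\<Sum>i\<le>j. of_nat (j choose i) * f (Suc i))"
    by (simp add: distrib_left sum.distrib)
  also have "\<dots> = f 0 + (\<Sum>i\<le>j. of_nat (Suc j choose Suc i) * f (Suc i))"
    by (simp add: distrib_right sum.distrib)
  also have "\<dots> = (\<Sum>i\<le>Suc j. of_nat (Suc j choose i) * f i)"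
    by (subst sum.atMost_Suc_shift) simp
  finally show ?thesis ..
qed

text \<open>The binomial theorem for a sum of two commuting opposite shifts: i of the j steps go one
  way and j - i the other.\<close>

lemma coord_hop_pow:
  "coord (blinfun_pow hop j X) (m, n)
    = (\<Sum>i\<le>j. of_nat (j choose i) * coord X (m + int j - 2 * int i, n))"
proof (induction j arbitrary: m)
  case (Suc j)
  have "coord (blinfun_pow hop (Suc j) X) (m, n)
      = (\<Sum>i\<le>j. of_nat (j choose i) * (coord X (m + int (Suc j) - 2 * int i, n)
          + coord X (m + int (Suc j) - 2 * int (Suc i), n)))"
    by (simp add: coord_hop Suc.IH sum.distrib[symmetric] distrib_left algebra_simps)
  also have "\<dots> = (\<Sum>i\<le>Suc j. of_nat (Suc j choose i) * coord X (m + int (Suc j) - 2 * int i, n))"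
    by (rule pascal_sum[symmetric])
  finally show ?case .
qed simp

text \<open>For input carried by the modes 1 and -1 only two binomial terms survive: i = p, p + 1
  into mode 1 and i = p - 1, p into mode -1. Symmetry of the binomial coefficients makes the
  resulting 2 by 2 matrix symmetric.\<close>

lemma coord_hop_pow_critical:
  assumes "1 \<le> p" and X: "\<And>m. m \<noteq> 1 \<Longrightarrow> m \<noteq> -1 \<Longrightarrow> coord X (m, n) = 0"
  shows "coord (blinfun_pow hop (2 * p) X) (1, n)
      = of_nat (2 * p choose p) * coord X (1, n) + of_nat (2 * p choose (p + 1)) * coord X (-1, n)"
    and "coord (blinfun_pow hop (2 * p) X) (-1, n)
      = of_nat (2 * p choose (p + 1)) * coord X (1, n) + of_nat (2 * p choose p) * coord X (-1, n)"
proof -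
  have "coord (blinfun_pow hop (2 * p) X) (1, n)
      = (\<Sum>i\<in>{p, p + 1}. of_nat (2 * p choose i) * coord X (1 + int (2 * p) - 2 * int i, n))"
    unfolding coord_hop_pow
    by (rule sum.mono_neutral_right) (use assms(1) in \<open>auto intro!: X\<close>)
  then show "coord (blinfun_pow hop (2 * p) X) (1, n)
      = of_nat (2 * p choose p) * coord X (1, n) + of_nat (2 * p choose (p + 1)) * coord X (-1, n)"
    by simp
  have "coord (blinfun_pow hop (2 * p) X) (-1, n)
      = (\<Sum>i\<in>{p - 1, p}. of_nat (2 * p choose i) * coord X (- 1 + int (2 * p) - 2 * int i, n))"
    unfolding coord_hop_pow
    by (rule sum.mono_neutral_right) (use assms(1) in \<open>auto intro!: X\<close>)
  moreover have "2 * p choose (p - 1) = 2 * p choose (p + 1)"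
    using binomial_symmetric[of "p + 1" "2 * p"] assms(1) by (simp add: mult_2)
  moreover have "int (p - 1) = int p - 1" "p - 1 \<noteq> p" using assms(1) by auto
  ultimately show "coord (blinfun_pow hop (2 * p) X) (-1, n)
      = of_nat (2 * p choose (p + 1)) * coord X (1, n) + of_nat (2 * p choose p) * coord X (-1, n)"
    by simp
qed

definition two_mode :: "('n \<Rightarrow> complex) \<Rightarrow> ('n \<Rightarrow> complex) \<Rightarrow> int \<Rightarrow> 'n \<Rightarrow> complex" where
  "two_mode u w m = (if m = 1 then u else if m = - 1 then w else (\<lambda>n. 0))"

lemma ell2_norm_zero: "ell2_norm (\<lambda>n. 0) = 0"
  by (simp add: ell2_norm_def)

lemma two_mode_ell22:
  assumes "u \<in> ell2" "w \<in> ell2"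
  shows "two_mode u w \<in> ell22"
proof -
  have "(\<lambda>m. (1 + \<bar>real_of_int m\<bar>\<^sup>2)\<^sup>2 * (ell2_norm (two_mode u w m))\<^sup>2) summable_on UNIV"
    by (rule finite_nonzero_values_imp_summable_on, rule finite_subset[of _ "{1, - 1}"])
      (auto simp: two_mode_def ell2_norm_zero split: if_splits)
  then show ?thesis using assms unfolding ell22_def by (auto simp: two_mode_def)
qed

lemma coord_conv_two_mode:
  assumes "a \<in> ell2"
  shows "coord (conv_op (two_mode a a) X) (m, n) = a n * coord (hop X) (m, n)"
proof -
  have "((\<lambda>k. two_mode a a k n * coord X (m - k, n)) has_sum
      (\<Sum>k\<in>{1, - 1}. two_mode a a k n * coord X (m - k, n))) UNIV"
    by (rule has_sum_finite_neutralI[of "{1, - 1}"]) (auto simp: two_mode_def)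
  from has_sum_unique[OF coord_conv_op[OF wiener_ell22[OF two_mode_ell22[OF assms assms]]] this]
  show ?thesis by (simp add: two_mode_def coord_hop distrib_left)
qed

lemma coord_conv_two_mode_pow:
  assumes "a \<in> ell2"
  shows "coord (blinfun_pow (conv_op (two_mode a a)) j X) (m, n) = a n ^ j * coord (blinfun_pow hop j X) (m, n)"
  by (induction j arbitrary: m) (simp_all add: coord_conv_two_mode[OF assms] coord_hop algebra_simps)

definition unit_l2 :: "'i \<Rightarrow> complex \<Rightarrow> 'i l2" where
  "unit_l2 i c = Abs_l2 (\<lambda>j. if j = i then c else 0)"

lemma coord_unit_l2: "coord (unit_l2 i c) j = (if j = i then c else 0)"
proof -
  have "(\<lambda>j. if j = i then c else 0) \<in> ell2"
    unfolding ell2_iff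
    by (rule finite_nonzero_values_imp_summable_on, rule finite_subset[of _ "{i}"]) auto
  then show ?thesis by (simp add: unit_l2_def)
qed

text \<open>Finite-rank arguments are carried out over the reals, so every coordinate contributes
  two directions, 1 and i, selected by a Boolean.\<close>

lemma finite_support_expansion:
  assumes "finite I" and Y: "\<And>i. i \<notin> I \<Longrightarrow> coord Y i = 0"
  shows "Y = (\<Sum>q\<in>I \<times> UNIV. (if snd q then Re (coord Y (fst q)) else Im (coord Y (fst q)))
      *\<^sub>R unit_l2 (fst q) (if snd q then 1 else \<i>))"
proof (rule l2_eqI)
  fix j
  let ?g = "\<lambda>i s. (if s then Re (coord Y i) else Im (coord Y i)) *\<^sub>R (if j = i then if s then 1 else \<i> else 0)"
  have "coord (\<Sum>q\<in>I \<times> UNIV. (if snd q then Re (coord Y (fst q)) else Im (coord Y (fst q)))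
      *\<^sub>R unit_l2 (fst q) (if snd q then 1 else \<i>)) j = (\<Sum>i\<in>I. \<Sum>s\<in>UNIV. ?g i s)"
    by (simp add: coord_sum coord_unit_l2 sum.cartesian_product case_prod_unfold)
  also have "\<dots> = (\<Sum>i\<in>I. if j = i then coord Y i else 0)"
    by (rule sum.cong) (auto simp: UNIV_bool scaleR_conv_of_real complex_eq_iff)
  also have "\<dots> = coord Y j" using assms by simp
  finally show "coord Y j = coord (\<Sum>q\<in>I \<times> UNIV. (if snd q then Re (coord Y (fst q)) else Im (coord Y (fst q)))
      *\<^sub>R unit_l2 (fst q) (if snd q then 1 else \<i>)) j" by simp
qed

lemma norm_mode_mult_le: "(\<And>m. cmod (f m) \<le> K) \<Longrightarrow> norm (mode_mult f) \<le> K"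
  unfolding mode_mult_def by (rule norm_mult_op_le) auto

text \<open>Passing from B to X divides the symbols 1, 1 - m^2, m^2 and 2m by 1 + m^2; the resulting
  multipliers all have norm at most 1.\<close>

lemma wt_bounds:
  shows "\<bar>1 / wt m\<bar> \<le> 1" "\<bar>(1 - (real_of_int m)\<^sup>2) / wt m\<bar> \<le> 1" "\<bar>(real_of_int m)\<^sup>2 / wt m\<bar> \<le> 1"
    "\<bar>2 * real_of_int m / wt m\<bar> \<le> 1"
proof -
  have w: "0 < wt m" by (rule wt_pos)
  have "\<bar>2 * real_of_int m\<bar> \<le> wt m"
    using zero_le_power2[of "real_of_int m - 1"] zero_le_power2[of "real_of_int m + 1"]
    by (auto simp: wt_def power2_eq_square algebra_simps abs_le_iff)
  then show "\<bar>2 * real_of_int m / wt m\<bar> \<le> 1" using w by (simp add: abs_divide)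
  show "\<bar>1 / wt m\<bar> \<le> 1" "\<bar>(1 - (real_of_int m)\<^sup>2) / wt m\<bar> \<le> 1" "\<bar>(real_of_int m)\<^sup>2 / wt m\<bar> \<le> 1"
    using w by (auto simp: abs_divide wt_def abs_le_iff)
qed

section \<open>The limiting dNLS problem\<close>

locale dnls_eigenvalue =
  fixes p :: nat and \<Omega> :: real and \<A> :: "int ^ 'd \<Rightarrow> real" and \<Lambda> :: complex
    and bp bm :: "int ^ 'd \<Rightarrow> complex"
  assumes p: "1 \<le> p"
    and \<A>: "\<A> \<in> ell2"
    and eig: "eigenpair (dnls_matrix p \<Omega> \<A>) (2 * \<Lambda>) (bp, bm)"
    and simple: "simple_eigenvalue (dnls_matrix p \<Omega> \<A>) (2 * \<Lambda>)"
    and outside: "2 * \<Lambda> \<notin> (\<lambda>s. \<i> * complex_of_real s) ` {\<Omega>..\<Omega> + 4 * real CARD('d)}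
           \<union> (\<lambda>s. - \<i> * complex_of_real s) ` {\<Omega>..\<Omega> + 4 * real CARD('d)}"
begin

definition crit :: "int \<Rightarrow> complex" where
  "crit m = (if m = 1 \<or> m = - 1 then 1 else 0)"

definition P1 :: "(int \<times> (int ^ 'd)) l2 \<Rightarrow>\<^sub>L (int \<times> (int ^ 'd)) l2" where
  "P1 = mode_mult crit"
text \<open>The unweighting operator: applied to X it returns the Fourier coefficients B as an
  element of l2.\<close>

definition Rw :: "(int \<times> (int ^ 'd)) l2 \<Rightarrow>\<^sub>L (int \<times> (int ^ 'd)) l2" where
  "Rw = mode_mult (\<lambda>m. of_real (1 / wt m))"
definition L0 :: "(int \<times> (int ^ 'd)) l2 \<Rightarrow>\<^sub>L (int \<times> (int ^ 'd)) l2" where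
  "L0 = mode_mult (\<lambda>m. of_real ((1 - (real_of_int m)\<^sup>2) / wt m))"
definition Q1 :: "(int \<times> (int ^ 'd)) l2 \<Rightarrow>\<^sub>L (int \<times> (int ^ 'd)) l2" where
  "Q1 = mode_mult (\<lambda>m. \<i> * of_real (2 * real_of_int m / wt m))"
definition Q\<Lambda> :: "(int \<times> (int ^ 'd)) l2 \<Rightarrow>\<^sub>L (int \<times> (int ^ 'd)) l2" where
  "Q\<Lambda> = mode_mult (\<lambda>m. \<Lambda> * (\<i> * of_real (2 * real_of_int m / wt m)))"
definition Q2 :: "(int \<times> (int ^ 'd)) l2 \<Rightarrow>\<^sub>L (int \<times> (int ^ 'd)) l2" where
  "Q2 = mode_mult (\<lambda>m. of_real ((real_of_int m)\<^sup>2 / wt m))"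
definition Ac :: "int ^ 'd \<Rightarrow> complex" where
  "Ac n = of_real (\<A> n)"
definition A0 :: "int \<Rightarrow> int ^ 'd \<Rightarrow> complex" where
  "A0 = two_mode Ac Ac"
text \<open>The factor of \<epsilon> in the spectral equation at \<epsilon> = 0 and \<mu> =
  \<Lambda>: \<Omega> m^2 comes from -m^2 \<omega>^2, and 2 i m \<Lambda> from the cross term of
  (\<epsilon>\<mu> + i m \<omega>)^2.\<close>

definition Nlim :: "(int \<times> (int ^ 'd)) l2 \<Rightarrow>\<^sub>L (int \<times> (int ^ 'd)) l2" where
  "Nlim = \<Omega> *\<^sub>R Q2 + (Q\<Lambda> + ((1 + 2 * real p) *\<^sub>R (blinfun_pow (conv_op A0) (2 * p) o\<^sub>L Rw)
     + (- 1) *\<^sub>R (lap_op o\<^sub>L Rw)))"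
text \<open>\<open>k0\<close> is the limit pencil at \<mu> = \<Lambda>, \<open>k1\<close> its
  derivative in \<mu>. Away from the modes 1 and -1 only 1 - m^2 survives; on them it vanishes and
  the bracket \<open>Nlim\<close> takes over.\<close>

definition k0 :: "(int \<times> (int ^ 'd)) l2 \<Rightarrow>\<^sub>L (int \<times> (int ^ 'd)) l2" where
  "k0 = L0 + (P1 o\<^sub>L Nlim)"
definition k1 :: "(int \<times> (int ^ 'd)) l2 \<Rightarrow>\<^sub>L (int \<times> (int ^ 'd)) l2" where
  "k1 = P1 o\<^sub>L Q1"

lemma cmod_crit: "cmod (crit m) \<le> 1"
  by (simp add: crit_def)

lemma coord_P1: "coord (P1 X) (m, n) = crit m * coord X (m, n)"
  unfolding P1_def by (rule coord_mode_mult[OF cmod_crit])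

lemma coord_Rw: "coord (Rw X) (m, n) = unemb X m n"
  unfolding Rw_def
  by (subst coord_mode_mult[where K = 1], unfold norm_of_real, rule wt_bounds)
    (simp add: unemb_def)

lemma coord_L0: "coord (L0 X) (m, n) = of_real (1 - (real_of_int m)\<^sup>2) * unemb X m n"
  unfolding L0_def
  by (subst coord_mode_mult[where K = 1], unfold norm_of_real, rule wt_bounds)
    (simp add: unemb_def)

lemma coord_Q1: "coord (Q1 X) (m, n) = 2 * \<i> * of_int m * unemb X m n"
  unfolding Q1_def
  by (subst coord_mode_mult[where K = 1], unfold norm_mult norm_of_real norm_ii mult_1, rule wt_bounds)
    (simp add: unemb_def)

lemma coord_Q\<Lambda>: "coord (Q\<Lambda> X) (m, n) = \<Lambda> * (2 * \<i> * of_int m * unemb X m n)"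
proof -
  have "cmod (\<Lambda> * (\<i> * of_real (2 * real_of_int m / wt m))) \<le> cmod \<Lambda> * 1" for m
    unfolding norm_mult norm_of_real norm_ii mult_1 by (intro mult_left_mono wt_bounds) simp
  then show ?thesis unfolding Q\<Lambda>_def
    by (subst coord_mode_mult[where K = "cmod \<Lambda> * 1"]) (auto simp: unemb_def)
qed

lemma coord_Q2: "coord (Q2 X) (m, n) = (of_int m)\<^sup>2 * unemb X m n"
  unfolding Q2_def
  by (subst coord_mode_mult[where K = 1], unfold norm_of_real, rule wt_bounds)
    (simp add: unemb_def)

lemma Ac: "Ac \<in> ell2"
  using \<A> by (simp add: Ac_def ell2_iff)

lemma coord_pow_A0: "coord (blinfun_pow (conv_op A0) (2 * p) X) (m, n)
    = Ac n ^ (2 * p) * coord (blinfun_pow hop (2 * p) X) (m, n)"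
  unfolding A0_def by (rule coord_conv_two_mode_pow[OF Ac])

lemma coord_lap_Rw: "coord (lap_op (Rw X)) (m, n) = laplacian (unemb X m) n"
  by (simp add: coord_lap_op coord_Rw)

lemma coord_Nlim: "coord (Nlim X) (m, n) = of_real \<Omega> * ((of_int m)\<^sup>2 * unemb X m n)
    + (\<Lambda> * (2 * \<i> * of_int m * unemb X m n)
    + ((1 + 2 * of_nat p) * (Ac n ^ (2 * p) * coord (blinfun_pow hop (2 * p) (Rw X)) (m, n))
    - laplacian (unemb X m) n))"
  by (simp add: Nlim_def blinfun.add_left blinfun.diff_left blinfun.scaleR_left coord_Q2 coord_Q\<Lambda> coord_pow_A0
      coord_lap_Rw scaleR_conv_of_real)

lemma coord_k0: "coord (k0 X) (m, n)
    = of_real (1 - (real_of_int m)\<^sup>2) * unemb X m n + crit m * coord (Nlim X) (m, n)"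
  by (simp add: k0_def blinfun.add_left coord_L0 coord_P1)

lemma coord_k1: "coord (k1 X) (m, n) = crit m * (2 * \<i> * of_int m * unemb X m n)"
  by (simp add: k1_def coord_P1 coord_Q1)

lemma b_ell2: "bp \<in> ell2" "bm \<in> ell2"
  using eig by (auto simp: eigenpair_def)

lemma ell2_i_comb:
  fixes u w :: "int ^ 'd \<Rightarrow> complex"
  assumes "u \<in> ell2" "w \<in> ell2"
  shows "(\<lambda>n. u n + c * w n) \<in> ell2"
  by (rule ell2_add[OF assms(1) ell2_cmult(1)[OF assms(2)]])

definition vec :: "(int ^ 'd) cpair \<Rightarrow> (int \<times> (int ^ 'd)) l2" where
  "vec c = emb (two_mode (\<lambda>n. fst c n + \<i> * snd c n) (\<lambda>n. fst c n + (- \<i>) * snd c n))"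

lemma unemb_vec:
  assumes "c \<in> ell2 \<times> ell2"
  shows "unemb (vec c) = two_mode (\<lambda>n. fst c n + \<i> * snd c n) (\<lambda>n. fst c n + (- \<i>) * snd c n)"
  unfolding vec_def using assms
  by (intro unemb_emb two_mode_ell22 ell2_i_comb) auto

definition X0 :: "(int \<times> (int ^ 'd)) l2" where
  "X0 = vec (bp, bm)"

lemma coord_vec:
  assumes "c \<in> ell2 \<times> ell2"
  shows "coord (vec c) (m, n) = of_real (wt m) * two_mode (\<lambda>n. fst c n + \<i> * snd c n) (\<lambda>n. fst c n + (- \<i>) * snd c n) m n"
  unfolding vec_def using assms
  by (intro coord_emb two_mode_ell22 ell2_i_comb) auto

text \<open>On the modes \<open>\<plusminus>1\<close> the limit operator is the dNLS operator in the variables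
  \<open>b\<^sub>+ \<plusminus> i b\<^sub>-\<close>.\<close>

lemma dnls_mode_equation:
  fixes c :: "(int ^ 'd) cpair"
  defines "r \<equiv> shifted (dnls_matrix p \<Omega> \<A>) (2 * \<Lambda>) c"
  assumes s: "s * s = - 1"
    and Y: "\<And>n. Y n = fst c n + s * snd c n" "\<And>n. Y' n = fst c n - s * snd c n"
  shows "of_real \<Omega> * Y n + (\<Lambda> * (2 * s * Y n)
    + ((1 + 2 * of_nat p) * (Ac n ^ (2 * p)
         * (of_nat (2 * p choose p) * Y n + of_nat (2 * p choose (p + 1)) * Y' n))
      - laplacian Y n)) = snd r n - s * fst r n"
proof -
  define g where "g = complex_of_real (gamma_coeff p)"
  define a where "a = Ac n ^ (2 * p)"
  have b: "(1 + 2 * of_nat p) * of_nat (2 * p choose p) = (of_nat p + 1) * g"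
    "(1 + 2 * of_nat p) * of_nat (2 * p choose (p + 1)) = of_nat p * g"
    using binomial_gamma[of p, THEN arg_cong, of complex_of_real] by (simp_all add: g_def)
  have l: "laplacian Y n = laplacian (fst c) n + s * laplacian (snd c) n"
    unfolding laplacian_cmult[symmetric] laplacian_add[symmetric] by (simp add: Y(1)[abs_def])
  have r1: "fst r n = - (of_real \<Omega> * snd c n - laplacian (snd c) n + g * a * snd c n) - 2 * \<Lambda> * fst c n"
    and r2: "snd r n = of_real \<Omega> * fst c n - laplacian (fst c) n + (1 + 2 * of_nat p) * g * a * fst c n - 2 * \<Lambda> * snd c n"
    by (simp_all add: r_def shifted_def dnls_matrix_def g_def a_def Ac_def mult_ac)
  have "(1 + 2 * of_nat p) * (a * (of_nat (2 * p choose p) * Y n + of_nat (2 * p choose (p + 1)) * Y' n))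
      = a * (((1 + 2 * of_nat p) * of_nat (2 * p choose p)) * Y n
          + ((1 + 2 * of_nat p) * of_nat (2 * p choose (p + 1))) * Y' n)"
    by (simp only: distrib_left distrib_right mult_ac)
  \<comment> \<open>By the binomial identities fst c gets the factor (p + 1) + p and s * snd c the
    factor (p + 1) - p.\<close>
  also have "\<dots> = a * g * ((1 + 2 * of_nat p) * fst c n + s * snd c n)"
    unfolding b Y by (simp add: algebra_simps)
  finally have nl: "(1 + 2 * of_nat p) * (a * (of_nat (2 * p choose p) * Y n + of_nat (2 * p choose (p + 1)) * Y' n))
      = a * g * ((1 + 2 * of_nat p) * fst c n + s * snd c n)" .
  have ss: "s * (s * x) = - x" for x using s by (simp add: mult.assoc[symmetric])
  show ?thesis
    unfolding a_def[symmetric] nl l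
    unfolding r1 r2 Y(1)
    by (simp add: algebra_simps ss)
qed

text \<open>The critical modes carry two independent combinations of the components of the dNLS
  residual, so \<open>k0 (vec c)\<close> vanishes exactly when that residual does.\<close>

lemma coord_k0_vec:
  assumes c: "c \<in> ell2 \<times> ell2"
  defines "r \<equiv> shifted (dnls_matrix p \<Omega> \<A>) (2 * \<Lambda>) c"
  shows "coord (k0 (vec c)) (1, n) = snd r n - \<i> * fst r n"
    and "coord (k0 (vec c)) (- 1, n) = snd r n + \<i> * fst r n"
    and "m \<noteq> 1 \<Longrightarrow> m \<noteq> - 1 \<Longrightarrow> coord (k0 (vec c)) (m, n) = 0"
proof -
  let ?Y = "\<lambda>n. fst c n + \<i> * snd c n" and ?Y' = "\<lambda>n. fst c n + (- \<i>) * snd c n"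
  have u: "unemb (vec c) = two_mode ?Y ?Y'" by (rule unemb_vec[OF c])
  have z: "coord (Rw (vec c)) (m, n) = 0" if "m \<noteq> 1" "m \<noteq> - 1" for m
    using that by (simp add: coord_Rw u two_mode_def)
  have h1: "coord (blinfun_pow hop (2 * p) (Rw (vec c))) (1, n)
      = of_nat (2 * p choose p) * ?Y n + of_nat (2 * p choose (p + 1)) * ?Y' n"
    by (subst coord_hop_pow_critical(1)[OF p]) (simp_all add: z, simp add: coord_Rw u two_mode_def)
  have h2: "coord (blinfun_pow hop (2 * p) (Rw (vec c))) (- 1, n)
      = of_nat (2 * p choose p) * ?Y' n + of_nat (2 * p choose (p + 1)) * ?Y n"
    by (subst coord_hop_pow_critical(2)[OF p]) (simp_all add: z, simp add: coord_Rw u two_mode_def)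
  have "coord (k0 (vec c)) (1, n) = of_real \<Omega> * ?Y n + (\<Lambda> * (2 * \<i> * ?Y n)
    + ((1 + 2 * of_nat p) * (Ac n ^ (2 * p)
         * (of_nat (2 * p choose p) * ?Y n + of_nat (2 * p choose (p + 1)) * ?Y' n))
      - laplacian ?Y n))"
    unfolding coord_k0 coord_Nlim h1 u by (simp add: crit_def two_mode_def)
  also have "\<dots> = snd r n - \<i> * fst r n"
    unfolding r_def by (rule dnls_mode_equation) auto
  finally show "coord (k0 (vec c)) (1, n) = snd r n - \<i> * fst r n" .
  have "coord (k0 (vec c)) (- 1, n) = of_real \<Omega> * ?Y' n + (\<Lambda> * (2 * (- \<i>) * ?Y' n)
    + ((1 + 2 * of_nat p) * (Ac n ^ (2 * p)
         * (of_nat (2 * p choose p) * ?Y' n + of_nat (2 * p choose (p + 1)) * ?Y n))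
      - laplacian ?Y' n))"
    unfolding coord_k0 coord_Nlim h2 u by (simp add: crit_def two_mode_def)
  also have "\<dots> = snd r n - (- \<i>) * fst r n"
    unfolding r_def by (rule dnls_mode_equation) auto
  finally show "coord (k0 (vec c)) (- 1, n) = snd r n + \<i> * fst r n" by simp
  show "m \<noteq> 1 \<Longrightarrow> m \<noteq> - 1 \<Longrightarrow> coord (k0 (vec c)) (m, n) = 0"
    by (simp add: coord_k0 crit_def u two_mode_def)
qed

lemma shifted_b: "shifted (dnls_matrix p \<Omega> \<A>) (2 * \<Lambda>) (bp, bm) = pair_zero"
  using eig by (simp add: eigenpair_def shifted_def pair_scale_def pair_zero_def)

lemma k0_X0: "k0 X0 = 0"
proof (rule l2_eqI)
  fix i :: "int \<times> (int ^ 'd)"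
  obtain m n where i: "i = (m, n)" by (cases i)
  have b: "(bp, bm) \<in> ell2 \<times> ell2" using b_ell2 by simp
  consider "m = 1" | "m = - 1" | "m \<noteq> 1" "m \<noteq> - 1" by blast
  then show "coord (k0 X0) i = coord 0 i"
    by cases (simp_all add: i X0_def coord_k0_vec[OF b] shifted_b pair_zero_def)
qed

lemma X0_nonzero: "\<exists>i. coord X0 i \<noteq> 0"
proof (rule ccontr)
  assume "\<not> ?thesis"
  then have z: "coord X0 (m, n) = 0" for m n by blast
  have b: "(bp, bm) \<in> ell2 \<times> ell2" using b_ell2 by simp
  have e: "bp n + \<i> * bm n = 0" "bp n + (- \<i>) * bm n = 0" for n
    using z[of 1 n] z[of "- 1" n] by (simp_all add: X0_def coord_vec[OF b] two_mode_def)
  have "2 * bp n = 0" "2 * \<i> * bm n = 0" for n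
  proof -
    have "2 * bp n = (bp n + \<i> * bm n) + (bp n + (- \<i>) * bm n)"
      "2 * \<i> * bm n = (bp n + \<i> * bm n) - (bp n + (- \<i>) * bm n)"
      by (simp_all add: algebra_simps)
    then show "2 * bp n = 0" "2 * \<i> * bm n = 0" unfolding e by simp_all
  qed
  then have "(bp, bm) = pair_zero" by (auto simp: pair_zero_def)
  then show False using eig by (simp add: eigenpair_def)
qed

section \<open>Normalization of the eigenvector and the bordered operator\<close>

definition i0 :: "int \<times> (int ^ 'd)" where
  "i0 = (SOME i. coord X0 i \<noteq> 0)"

lemma i0: "coord X0 i0 \<noteq> 0"
  unfolding i0_def by (rule someI_ex[OF X0_nonzero])

text \<open>A bounded complex-linear functional equal to 1 at X0. Requiring \<open>ell x = 1\<close>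
  removes the scalar freedom of the eigenvector, and \<open>ell z\<close> of the unknown z encodes
  the eigenvalue increment \<nu>.\<close>

definition ell :: "(int \<times> (int ^ 'd)) l2 \<Rightarrow> complex" where
  "ell z = coord z i0 / coord X0 i0"

lemma ell_X0: "ell X0 = 1"
  by (simp add: ell_def i0)

text \<open>The product \<nu> y with \<nu> = \<open>ell z\<close>, written as a bilinear map of two
  vectors, as the abstract pencil requires.\<close>

definition mul :: "(int \<times> (int ^ 'd)) l2 \<Rightarrow> (int \<times> (int ^ 'd)) l2 \<Rightarrow> (int \<times> (int ^ 'd)) l2" where
  "mul z y = mode_mult (\<lambda>_. ell z) y"

lemma coord_mul: "coord (mul z y) i = ell z * coord y i"
  unfolding mul_def by (cases i) (simp add: coord_mode_mult[OF order_refl])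

lemma ell_add: "ell (x + y) = ell x + ell y" and ell_diff: "ell (x - y) = ell x - ell y"
  and ell_scaleR: "ell (r *\<^sub>R x) = r *\<^sub>R ell x"
  by (simp_all add: ell_def add_divide_distrib diff_divide_distrib scaleR_conv_of_real)

lemma bounded_bilinear_mul: "bounded_bilinear mul"
proof
  fix a a' b b' :: "(int \<times> (int ^ 'd)) l2" and r :: real
  show "mul (a + a') b = mul a b + mul a' b" "mul a (b + b') = mul a b + mul a b'"
    "mul (r *\<^sub>R a) b = r *\<^sub>R mul a b" "mul a (r *\<^sub>R b) = r *\<^sub>R mul a b"
    by (rule l2_eqI, simp add: coord_mul ell_add ell_scaleR algebra_simps)+
  show "\<exists>K. \<forall>a b. norm (mul a b) \<le> norm a * norm b * K"
  proof (intro exI allI)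
    fix a b :: "(int \<times> (int ^ 'd)) l2"
    have "norm (mul a b) \<le> norm (mode_mult (\<lambda>_. ell a) :: (int \<times> (int ^ 'd)) l2 \<Rightarrow>\<^sub>L (int \<times> (int ^ 'd)) l2) * norm b"
      unfolding mul_def by (rule norm_blinfun)
    also have "\<dots> \<le> (norm a / cmod (coord X0 i0)) * norm b"
    proof (rule mult_right_mono[OF norm_mode_mult_le norm_ge_zero])
      show "cmod (ell a) \<le> norm a / cmod (coord X0 i0)"
        unfolding ell_def norm_divide by (intro divide_right_mono norm_coord_le) simp
    qed
    finally show "norm (mul a b) \<le> norm a * norm b * (1 / cmod (coord X0 i0))" by (simp add: field_simps)
  qed
qed

text \<open>As k0 X0 = 0, this sends z to k0 z + ell(z) k1 X0: the derivative of the normalized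
  eigenvalue problem at (\<Lambda>, X0).\<close>

definition T :: "(int \<times> (int ^ 'd)) l2 \<Rightarrow>\<^sub>L (int \<times> (int ^ 'd)) l2" where
  "T = k0 + ((k1 - k0) o\<^sub>L Blinfun (\<lambda>z. mul z X0))"

lemma T_apply: "T z = k0 (z - mul z X0) + k1 (mul z X0)"
  using bounded_linear_Blinfun_apply[OF bounded_bilinear.bounded_linear_left[OF bounded_bilinear_mul, of X0]]
  by (simp add: T_def blinfun.add_left blinfun.diff_left blinfun.diff_right)

text \<open>The hypothesis puts c into the kernel of the square of the shifted matrix, hence into
  the generalized eigenspace, which is a line. Such a c is a multiple of the eigenvector and is
  killed already by the first power, so no Jordan chain exists.\<close>

lemma generalized_eigenspace_line:
  assumes "c \<in> ell2 \<times> ell2"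
    and c: "shifted (dnls_matrix p \<Omega> \<A>) (2 * \<Lambda>) c = pair_scale \<nu> (bp, bm)"
  shows "\<exists>\<kappa>. c = pair_scale \<kappa> (bp, bm)" and "\<nu> = 0"
proof -
  let ?M = "dnls_matrix p \<Omega> \<A>"
  have sc: "shifted ?M (2 * \<Lambda>) (pair_scale k w) = pair_scale k (shifted ?M (2 * \<Lambda>) w)" for k w
    by (simp add: shifted_def dnls_matrix_def pair_scale_def laplacian_cmult algebra_simps)
  have z: "pair_scale k pair_zero = pair_zero" for k :: complex by (simp add: pair_scale_def pair_zero_def)
  have bnz: "(bp, bm) \<noteq> pair_zero" using eig by (simp add: eigenpair_def)
  obtain v where v: "eigenpair ?M (2 * \<Lambda>) v"
    "generalized_eigenspace ?M (2 * \<Lambda>) = {pair_scale k v | k. True}"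
    using simple by (auto simp: simple_eigenvalue_def)
  have "(bp, bm) \<in> generalized_eigenspace ?M (2 * \<Lambda>)"
    using b_ell2 shifted_b by (auto simp: generalized_eigenspace_def intro!: exI[of _ 1])
  then obtain k1 where k1: "(bp, bm) = pair_scale k1 v" using v(2) by auto
  have "(shifted ?M (2 * \<Lambda>) ^^ 2) c = pair_zero"
    by (simp add: numeral_2_eq_2 c sc shifted_b z)
  then have "c \<in> generalized_eigenspace ?M (2 * \<Lambda>)"
    using assms(1) by (auto simp: generalized_eigenspace_def intro!: exI[of _ 2])
  then obtain k2 where k2: "c = pair_scale k2 v" using v(2) by auto
  have "shifted ?M (2 * \<Lambda>) v = pair_zero"
    using v(1) by (simp add: eigenpair_def shifted_def pair_scale_def pair_zero_def)
  then have "pair_scale \<nu> (bp, bm) = pair_zero" using c by (simp add: k2 sc z)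
  then show "\<nu> = 0" using bnz by (auto simp: pair_scale_def pair_zero_def fun_eq_iff)
  have "k1 \<noteq> 0" using k1 bnz by (auto simp: pair_scale_def pair_zero_def)
  then have "c = pair_scale (k2 / k1) (bp, bm)"
    unfolding k1 k2 by (simp add: pair_scale_def)
  then show "\<exists>\<kappa>. c = pair_scale \<kappa> (bp, bm)" by blast
qed

text \<open>With \<nu> = ell z and y = z - \<nu> X0, the equation T z = 0 says that y lives on the
  modes 1 and -1 and that the dNLS residual of the corresponding pair is 2\<nu> times the
  eigenvector. Simplicity gives \<nu> = 0 and makes z a multiple of X0, and ell z = 0 then makes the
  multiple zero.\<close>

lemma T_injective:
  assumes Tz: "T z = 0"
  shows "z = 0"
proof -
  define \<nu> where "\<nu> = ell z"
  define y where "y = z - mul z X0"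
  have b: "(bp, bm) \<in> ell2 \<times> ell2" using b_ell2 by simp
  have eq: "coord (k0 y) (m, n) + crit m * (2 * \<i> * of_int m * (\<nu> * unemb X0 m n)) = 0" for m n
    using arg_cong[OF Tz, of "\<lambda>x. coord x (m, n)"]
    by (simp add: T_apply y_def[symmetric] coord_k1) (simp add: unemb_def coord_mul \<nu>_def)
  \<comment> \<open>Off the critical modes the equation reads (1 - m^2) y_m = 0 with a nonzero
    factor.\<close>
  have y0: "unemb y m n = 0" if "m \<noteq> 1" "m \<noteq> - 1" for m n
  proof -
    have "(real_of_int m)\<^sup>2 \<noteq> 1" using that by (simp add: power2_eq_1_iff)
    then have "of_real (1 - (real_of_int m)\<^sup>2) \<noteq> (0 :: complex)" unfolding of_real_eq_0_iff by simp
    then show ?thesis using eq[of m n] that by (simp add: coord_k0 crit_def)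
  qed
  define c where "c = ((\<lambda>n. (unemb y 1 n + unemb y (- 1) n) / 2), (\<lambda>n. (unemb y 1 n - unemb y (- 1) n) / (2 * \<i>)))"
  have c: "c \<in> ell2 \<times> ell2"
  proof -
    have "(\<lambda>n. 1/2 * (unemb y 1 n + 1 * unemb y (- 1) n)) \<in> ell2"
      "(\<lambda>n. 1/(2 * \<i>) * (unemb y 1 n + (- 1) * unemb y (- 1) n)) \<in> ell2"
      by (intro ell2_cmult(1) ell2_i_comb unemb_in_ell2)+
    then show ?thesis by (simp add: c_def)
  qed
  have Y: "fst c n + \<i> * snd c n = unemb y 1 n" "fst c n + (- \<i>) * snd c n = unemb y (- 1) n" for n
    by (simp_all add: c_def field_simps)
  have "unemb y = unemb (vec c)"
    unfolding unemb_vec[OF c] Y by (intro ext) (auto simp: two_mode_def y0)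
  then have yc: "y = vec c" by (metis emb_unemb)
  define r where "r = shifted (dnls_matrix p \<Omega> \<A>) (2 * \<Lambda>) c"
  have X0u: "unemb X0 1 n = bp n + \<i> * bm n" "unemb X0 (- 1) n = bp n - \<i> * bm n" for n
    by (simp_all add: X0_def unemb_vec[OF b] two_mode_def)
  have e1: "snd r n - \<i> * fst r n + 2 * \<i> * (\<nu> * (bp n + \<i> * bm n)) = 0"
    and e2: "snd r n + \<i> * fst r n - 2 * \<i> * (\<nu> * (bp n - \<i> * bm n)) = 0" for n
    using eq[of 1 n] eq[of "- 1" n] unfolding yc coord_k0_vec[OF c] X0u r_def[symmetric]
    by (simp_all add: crit_def)
  have "fst r n = 2 * \<nu> * bp n \<and> snd r n = 2 * \<nu> * bm n" for n
  proof -
    \<comment> \<open>Sum and difference of the two mode equations undo the change of variables and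
      separate the components of the residual.\<close>
    have "2 * (snd r n - 2 * \<nu> * bm n) = (snd r n - \<i> * fst r n + 2 * \<i> * (\<nu> * (bp n + \<i> * bm n)))
       + (snd r n + \<i> * fst r n - 2 * \<i> * (\<nu> * (bp n - \<i> * bm n)))"
      by (simp add: algebra_simps)
    moreover have "2 * \<i> * (fst r n - 2 * \<nu> * bp n) = (snd r n + \<i> * fst r n - 2 * \<i> * (\<nu> * (bp n - \<i> * bm n)))
       - (snd r n - \<i> * fst r n + 2 * \<i> * (\<nu> * (bp n + \<i> * bm n)))"
      by (simp add: algebra_simps)
    ultimately show ?thesis unfolding e1 e2 by simp
  qed
  then have "shifted (dnls_matrix p \<Omega> \<A>) (2 * \<Lambda>) c = pair_scale (2 * \<nu>) (bp, bm)"
    unfolding r_def[symmetric] by (simp add: pair_scale_def prod_eq_iff fun_eq_iff)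
  note line = generalized_eigenspace_line[OF c this]
  have \<nu>: "\<nu> = 0" using line(2) by simp
  then have yz: "y = z"
    unfolding y_def by (intro l2_eqI) (simp add: coord_mul \<nu>_def)
  obtain \<kappa> where \<kappa>: "c = pair_scale \<kappa> (bp, bm)" using line(1) by blast
  have z: "coord z i = \<kappa> * coord X0 i" for i
    unfolding yz[symmetric] yc X0_def
    by (cases i) (simp add: coord_vec[OF c] coord_vec[OF b] two_mode_def,
        simp add: \<kappa> pair_scale_def algebra_simps)
  then have "\<kappa> = 0" using \<nu> i0 by (simp add: \<nu>_def ell_def)
  then show ?thesis by (intro l2_eqI) (simp add: z)
qed

end

section \<open>Invertibility of the limiting operator\<close>

text \<open>N points of the level set contribute at least N \<theta>^2 to the squared norm. This is
  the decay of the potential: outside finitely many sites it is small.\<close>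

lemma ell2_finite_level_set:
  fixes u :: "'i \<Rightarrow> 'a::real_normed_vector"
  assumes u: "u \<in> ell2" and "0 < \<theta>"
  shows "finite {i. \<theta> \<le> norm (u i)}"
proof (rule ccontr)
  assume inf: "infinite {i. \<theta> \<le> norm (u i)}"
  let ?M = "\<Sum>\<^sub>\<infinity>i. (norm (u i))\<^sup>2"
  obtain N :: nat where N: "?M / \<theta>\<^sup>2 < real N" using reals_Archimedean2 by blast
  obtain F where F: "F \<subseteq> {i. \<theta> \<le> norm (u i)}" "finite F" "card F = N"
    using infinite_arbitrarily_large[OF inf] by blast
  have "real N * \<theta>\<^sup>2 = (\<Sum>i\<in>F. \<theta>\<^sup>2)" using F by simp
  also have "\<dots> \<le> (\<Sum>i\<in>F. (norm (u i))\<^sup>2)"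
    using F assms(2) by (intro sum_mono power_mono) auto
  also have "\<dots> \<le> ?M"
    using u F by (intro finite_sum_le_infsum) (auto simp: ell2_iff)
  finally show False using N assms(2) by (simp add: field_simps)
qed

context dnls_eigenvalue
begin

text \<open>The limit \<open>k0\<close> with its potential dropped: a multiplier in the mode
  variable plus the free lattice Laplacian on the critical modes.\<close>

definition D0 :: "(int \<times> (int ^ 'd)) l2 \<Rightarrow>\<^sub>L (int \<times> (int ^ 'd)) l2" where
  "D0 = L0 + (P1 o\<^sub>L (\<Omega> *\<^sub>R Q2 + (Q\<Lambda> - (lap_op o\<^sub>L Rw))))"

lemma coord_D0: "coord (D0 X) (m, n) = of_real (1 - (real_of_int m)\<^sup>2) * unemb X m n
    + crit m * (of_real \<Omega> * ((of_int m)\<^sup>2 * unemb X m n) + (\<Lambda> * (2 * \<i> * of_int m * unemb X m n)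
      - laplacian (unemb X m) n))"
  by (simp add: D0_def blinfun.add_left blinfun.diff_left blinfun.scaleR_left coord_L0 coord_P1 coord_Q2
      coord_Q\<Lambda> coord_lap_Rw scaleR_conv_of_real)

text \<open>On mode 1 the operator is half of -\<Delta> - z with z = -\<Omega> - 2i\<Lambda>, on
  mode -1 the same with +2i\<Lambda>. That 2\<Lambda> avoids the two segments says that neither z
  lies in [0, 4d], so a unit phase for each mode rotates the numerical range into a right
  half-plane.\<close>

lemma D0_coercive:
  obtains c \<alpha> where "0 < \<alpha>" "\<And>m. cmod (c m) = 1"
    "\<And>X. \<alpha> * (norm X)\<^sup>2 \<le> mode_mult c (blinfun_apply D0 X) \<bullet> X"
proof -
  let ?d = "real CARD('d)"
  have z1: "- of_real \<Omega> - 2 * \<i> * \<Lambda> \<notin> of_real ` {0..4 * ?d}"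
  proof
    assume "- of_real \<Omega> - 2 * \<i> * \<Lambda> \<in> of_real ` {0..4 * ?d}"
    then obtain s where s: "- of_real \<Omega> - 2 * \<i> * \<Lambda> = of_real s" "0 \<le> s" "s \<le> 4 * ?d" by auto
    have "2 * \<Lambda> = \<i> * (- 2 * \<i> * \<Lambda>)" by simp
    also have "- 2 * \<i> * \<Lambda> = (- of_real \<Omega> - 2 * \<i> * \<Lambda>) + of_real \<Omega>" by simp
    also have "\<dots> = of_real (\<Omega> + s)" unfolding s(1) by simp
    finally have "2 * \<Lambda> \<in> (\<lambda>s. \<i> * complex_of_real s) ` {\<Omega>..\<Omega> + 4 * ?d}"
      using s by (intro image_eqI[of _ _ "\<Omega> + s"]) auto
    then show False using outside by blast
  qed
  have z2: "- of_real \<Omega> + 2 * \<i> * \<Lambda> \<notin> of_real ` {0..4 * ?d}"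
  proof
    assume "- of_real \<Omega> + 2 * \<i> * \<Lambda> \<in> of_real ` {0..4 * ?d}"
    then obtain s where s: "- of_real \<Omega> + 2 * \<i> * \<Lambda> = of_real s" "0 \<le> s" "s \<le> 4 * ?d" by auto
    have "2 * \<Lambda> = - \<i> * (2 * \<i> * \<Lambda>)" by simp
    also have "2 * \<i> * \<Lambda> = of_real (\<Omega> + s)" using s(1) by (simp add: algebra_simps)
    finally have "2 * \<Lambda> \<in> (\<lambda>s. - \<i> * complex_of_real s) ` {\<Omega>..\<Omega> + 4 * ?d}"
      using s by (intro image_eqI[of _ _ "\<Omega> + s"]) auto
    then show False using outside by blast
  qed
  obtain c1 \<alpha>1 where c1: "cmod c1 = 1" "0 < \<alpha>1"
    "\<alpha>1 \<le> Re (- (c1 * (- of_real \<Omega> - 2 * \<i> * \<Lambda>))) + 4 * ?d * min (Re c1) 0"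
    by (rule separating_phase[OF z1]) auto
  obtain c2 \<alpha>2 where c2: "cmod c2 = 1" "0 < \<alpha>2"
    "\<alpha>2 \<le> Re (- (c2 * (- of_real \<Omega> + 2 * \<i> * \<Lambda>))) + 4 * ?d * min (Re c2) 0"
    by (rule separating_phase[OF z2]) auto
  define c where "c m = (if m = 1 then c1 else if m = - 1 then c2 else if m = 0 then 1 else - 1)" for m :: int
  \<comment> \<open>The halves come from the weight 2 at m = 1 and m = -1; 3/5 is (m^2 - 1)/(m^2 +
    1) at |m| = 2, its smallest value for |m| \<ge> 2.\<close>
  define \<alpha> where "\<alpha> = min (min (\<alpha>1 / 2) (\<alpha>2 / 2)) (3 / 5)"
  define dm where "dm m = of_real ((1 - (real_of_int m)\<^sup>2) / wt m)
    + crit m * (of_real \<Omega> / 2 + \<Lambda> * (\<i> * of_int m))" for m :: int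
  \<comment> \<open>After the phase, \<open>c m * dm m\<close> is the diagonal symbol and e the
    factor in front of minus the Laplacian.\<close>
  define e where "e m = c m * crit m / 2" for m :: int
  have cm: "cmod (c m) = 1" for m using c1 c2 by (simp add: c_def)
  have \<alpha>: "0 < \<alpha>" using c1 c2 by (simp add: \<alpha>_def)
  have wt1: "wt 1 = 2" "wt (- 1) = 2" "wt 0 = 1" by (simp_all add: wt_def)
  have half: "min (Re w / 2) 0 = min (Re w) 0 / 2" for w by (auto simp: min_def)
  have pos: "\<alpha> \<le> Re (c m * dm m) + 4 * ?d * min (Re (e m)) 0" for m
  proof -
    consider "m = 1" | "m = - 1" | "m = 0" | "m \<noteq> 1" "m \<noteq> - 1" "m \<noteq> 0" by blast
    then show ?thesis
    proof cases
      case 1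
      have "Re (c m * dm m) = Re (- (c1 * (- of_real \<Omega> - 2 * \<i> * \<Lambda>))) / 2"
        using 1 by (simp add: c_def dm_def crit_def wt1 algebra_simps)
      moreover have "4 * ?d * min (Re (e m)) 0 = 4 * ?d * min (Re c1) 0 / 2"
        using 1 half by (simp add: e_def c_def crit_def)
      moreover have "\<alpha> \<le> \<alpha>1 / 2" by (simp add: \<alpha>_def)
      ultimately show ?thesis using c1(3) by linarith
    next
      case 2
      have "Re (c m * dm m) = Re (- (c2 * (- of_real \<Omega> + 2 * \<i> * \<Lambda>))) / 2"
        using 2 by (simp add: c_def dm_def crit_def wt1 algebra_simps)
      moreover have "4 * ?d * min (Re (e m)) 0 = 4 * ?d * min (Re c2) 0 / 2"
        using 2 half by (simp add: e_def c_def crit_def)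
      moreover have "\<alpha> \<le> \<alpha>2 / 2" by (simp add: \<alpha>_def)
      ultimately show ?thesis using c2(3) by linarith
    next
      case 3
      then show ?thesis by (simp add: c_def dm_def e_def crit_def wt1 \<alpha>_def)
    next
      case 4
      have "2 \<le> \<bar>m\<bar>" using 4 by linarith
      then have "2 \<le> \<bar>real_of_int m\<bar>" by linarith
      from power_mono[OF this, of 2] have "4 \<le> (real_of_int m)\<^sup>2" by simp
      then have "3 / 5 \<le> ((real_of_int m)\<^sup>2 - 1) / wt m"
        using wt_pos[of m] by (simp add: wt_def field_simps)
      moreover have "Re (c m * dm m) = ((real_of_int m)\<^sup>2 - 1) / wt m"
        using 4 by (simp add: c_def dm_def crit_def minus_divide_left)
      moreover have "4 * ?d * min (Re (e m)) 0 = 0" using 4 by (simp add: e_def crit_def)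
      moreover have "\<alpha> \<le> 3 / 5" by (simp add: \<alpha>_def)
      ultimately show ?thesis by linarith
    qed
  qed
  have e_le: "cmod (e m) \<le> 1 / 2" for m
    using cm[of m] by (simp add: e_def norm_mult norm_divide crit_def)
  have cd_le: "cmod (c m * dm m) \<le> 1 + (\<bar>\<Omega>\<bar> / 2 + cmod \<Lambda>)" for m
  proof -
    have "cmod (of_real ((1 - (real_of_int m)\<^sup>2) / wt m)) \<le> 1"
      unfolding norm_of_real by (rule wt_bounds)
    moreover have "cmod (crit m * (of_real \<Omega> / 2 + \<Lambda> * (\<i> * of_int m))) \<le> \<bar>\<Omega>\<bar> / 2 + cmod \<Lambda>"
    proof (cases "m = 1 \<or> m = - 1")
      case True
      then have "cmod (\<Lambda> * (\<i> * of_int m)) = cmod \<Lambda>" by (auto simp: norm_mult)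
      then show ?thesis
        using norm_triangle_ineq[of "of_real \<Omega> / 2" "\<Lambda> * (\<i> * of_int m)"] True
        by (simp add: crit_def norm_divide)
    qed (auto simp: crit_def)
    ultimately show ?thesis
      unfolding norm_mult[of "c m"] cm mult_1 dm_def by (rule norm_triangle_mono)
  qed
  define F where "F = (mode_mult (\<lambda>m. c m * dm m) :: (int \<times> (int ^ 'd)) l2 \<Rightarrow>\<^sub>L (int \<times> (int ^ 'd)) l2)"
  define E' where "E' = (mode_mult (\<lambda>m. of_real (min (Re (e m)) 0)) :: (int \<times> (int ^ 'd)) l2 \<Rightarrow>\<^sub>L (int \<times> (int ^ 'd)) l2)"
  have cF: "coord (F X) (m, n) = c m * dm m * coord X (m, n)" for X m n
    unfolding F_def by (rule coord_mode_mult[OF cd_le])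
  have e'_le: "cmod (of_real (min (Re (e m)) 0)) \<le> 1 / 2" for m
    using abs_Re_le_cmod[of "e m"] e_le[of m] by (auto simp: min_def)
  have cE': "coord (E' X) (m, n) = of_real (min (Re (e m)) 0) * coord X (m, n)" for X m n
    unfolding E'_def by (rule coord_mode_mult[OF e'_le])
  have split: "mode_mult c (D0 X) = F X + mode_mult e (- lap_op X)" for X
  proof (rule l2_eqI)
    fix i :: "int \<times> (int ^ 'd)"
    obtain m n where i: "i = (m, n)" by (cases i)
    have l: "laplacian (unemb X m) n = laplacian (\<lambda>n. coord X (m, n)) n / of_real (wt m)" for m
      using laplacian_cmult[of "1 / of_real (wt m)" "\<lambda>n. coord X (m, n)" n]
      by (simp add: unemb_def[abs_def])
    consider "m = 1" | "m = - 1" | "m \<noteq> 1" "m \<noteq> - 1" by blast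
    then show "coord (mode_mult c (D0 X)) i = coord (F X + mode_mult e (- lap_op X)) i"
      by cases (simp_all add: i coord_mode_mult[where K = 1] cm coord_mode_mult[OF e_le] cF coord_D0 coord_lap_op
          l crit_def dm_def e_def wt1 unemb_def field_simps)
  qed
  have "\<alpha> * (norm X)\<^sup>2 \<le> mode_mult c (D0 X) \<bullet> X" for X
  proof -
    have "(\<alpha> *\<^sub>R X) \<bullet> X \<le> (F X + (4 * ?d) *\<^sub>R E' X) \<bullet> X"
    proof (rule inner_l2_mono)
      fix i :: "int \<times> (int ^ 'd)"
      obtain m n where i: "i = (m, n)" by (cases i)
      have in_e: "(w * z) \<bullet> z = Re w * (z \<bullet> z)" for w z :: complex
        by (simp add: inner_complex_def algebra_simps)
      have "coord (F X + (4 * ?d) *\<^sub>R E' X) i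
          = (c m * dm m + of_real (4 * ?d * min (Re (e m)) 0)) * coord X i"
        by (simp add: i cF cE' scaleR_conv_of_real algebra_simps)
      then have "coord (F X + (4 * ?d) *\<^sub>R E' X) i \<bullet> coord X i
          = (Re (c m * dm m) + 4 * ?d * min (Re (e m)) 0) * (coord X i \<bullet> coord X i)"
        by (simp only: in_e plus_complex.sel Re_complex_of_real)
      moreover have "coord (\<alpha> *\<^sub>R X) i \<bullet> coord X i = \<alpha> * (coord X i \<bullet> coord X i)" by simp
      ultimately show "coord (\<alpha> *\<^sub>R X) i \<bullet> coord X i \<le> coord (F X + (4 * ?d) *\<^sub>R E' X) i \<bullet> coord X i"
        using mult_right_mono[OF pos[of m] inner_ge_zero[of "coord X i"]] by simp
    qed
    moreover have "4 * ?d * (E' X \<bullet> X) \<le> mode_mult e (- lap_op X) \<bullet> X"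
      unfolding E'_def by (rule inner_lap_op_ge[OF e_le])
    ultimately show ?thesis unfolding split by (simp add: inner_add_left power2_norm_eq_inner)
  qed
  note coercive = this
  show thesis by (rule that[where \<alpha> = \<alpha> and c = c]) (rule \<alpha> cm coercive)+
qed

lemma T_invertible:
  obtains S :: "(int \<times> (int ^ 'd)) l2 \<Rightarrow>\<^sub>L (int \<times> (int ^ 'd)) l2"
  where "\<And>x. S (T x) = x" "\<And>x. T (S x) = x"
proof -
  obtain c \<alpha> where \<alpha>: "0 < \<alpha>" and cm: "\<And>m. cmod (c m) = 1"
    and coer: "\<And>X. \<alpha> * (norm X)\<^sup>2 \<le> mode_mult c (blinfun_apply D0 X) \<bullet> X"
    by (rule D0_coercive) (rule that)
  define W where "W = (blinfun_pow hop (2 * p) o\<^sub>L Rw)"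
  define q where "q = 1 + 2 * real p"
  \<comment> \<open>Where |\<A>| < \<theta> \<le> 1 also |\<A>|^(2p) \<le> \<theta>, so the
    potential restricted to these sites has operator norm at most q \<theta> norm W \<le>
    \<alpha>/2, half of the coercivity constant.\<close>
  define \<theta> where "\<theta> = min 1 (\<alpha> / (2 * q * (norm W + 1)))"
  have q: "0 < q" by (simp add: q_def)
  have \<theta>: "0 < \<theta>" "\<theta> \<le> 1" using \<alpha> q by (auto simp: \<theta>_def intro!: divide_pos_pos mult_pos_pos add_nonneg_pos)
  define S where "S = {n. \<theta> \<le> norm (\<A> n)}"
  have S: "finite S" unfolding S_def by (rule ell2_finite_level_set[OF \<A> \<theta>(1)])
  \<comment> \<open>The potential splits into a small tail, absorbed by coercivity, and a head on
    finitely many sites, which has finite rank because only two modes are involved.\<close>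
  define atail where "atail n = (if n \<in> S then 0 else of_real q * Ac n ^ (2 * p))" for n
  define ahead where "ahead n = (if n \<in> S then of_real q * Ac n ^ (2 * p) else 0)" for n
  have atail: "cmod (atail n) \<le> q * \<theta>" for n
  proof (cases "n \<in> S")
    case False
    then have "\<bar>\<A> n\<bar> < \<theta>" by (simp add: S_def)
    then have "\<bar>\<A> n\<bar> ^ (2 * p) \<le> \<theta> ^ (2 * p)" by (intro power_mono) auto
    also have "\<dots> \<le> \<theta> ^ 1" using \<theta> p by (intro power_decreasing) auto
    finally show ?thesis using False q by (simp add: atail_def norm_mult norm_power Ac_def)
  qed (use q \<theta> in \<open>simp add: atail_def\<close>)
  have ahead: "cmod (ahead n) \<le> q * ell2_norm \<A> ^ (2 * p)" for n
    using q power_mono[OF ell2_norm_coord_le[OF \<A>, of n] norm_ge_zero, of "2 * p"]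
    by (auto simp: ahead_def norm_mult norm_power Ac_def ell2_norm_nonneg)
  define Tt where "Tt = (P1 o\<^sub>L (site_mult atail o\<^sub>L W))"
  define Hh where "Hh = (P1 o\<^sub>L (site_mult ahead o\<^sub>L W))"
  have cHh: "coord (Hh X) (m, n) = crit m * (ahead n * coord (W X) (m, n))" for X m n
    by (simp add: Hh_def coord_P1 coord_site_mult[OF ahead])
  have cTt: "coord (Tt X) (m, n) = crit m * (atail n * coord (W X) (m, n))" for X m n
    by (simp add: Tt_def coord_P1 coord_site_mult[OF atail])
  have k0_split: "k0 X = D0 X + Tt X + Hh X" for X
  proof (rule l2_eqI)
    fix i :: "int \<times> (int ^ 'd)"
    obtain m n where i: "i = (m, n)" by (cases i)
    show "coord (k0 X) i = coord (D0 X + Tt X + Hh X) i"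
      by (simp add: i coord_k0 coord_Nlim coord_D0 cTt cHh W_def atail_def ahead_def q_def algebra_simps)
  qed
  have "norm Tt \<le> 1 * (q * \<theta> * norm W)"
    unfolding Tt_def P1_def
    by (rule order_trans[OF norm_blinfun_compose], rule mult_mono[OF norm_mode_mult_le[OF cmod_crit]],
        rule order_trans[OF norm_blinfun_compose], rule mult_right_mono[OF norm_site_mult_le[OF atail]]) auto
  also have "\<dots> \<le> \<alpha> / 2"
  proof -
    have "q * \<theta> * norm W \<le> q * (\<alpha> / (2 * q * (norm W + 1))) * (norm W + 1)"
      using q \<theta> \<alpha> by (intro mult_mono mult_left_mono) (auto simp: \<theta>_def)
    also have "\<dots> = \<alpha> / (2 * (q * (norm W + 1))) * (q * (norm W + 1))" by (simp add: mult_ac)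
    also have "\<dots> = \<alpha> / 2"
    proof -
      have cancel: "\<alpha> / (2 * u) * u = \<alpha> / 2" if "0 < u" for u :: real
        using that by simp
      show ?thesis
        by (rule cancel) (use q in \<open>auto intro!: mult_pos_pos add_nonneg_pos\<close>)
    qed
    finally show ?thesis by simp
  qed
  finally have Tt: "norm Tt \<le> \<alpha> / 2" .
  define C where "C = (mode_mult c :: (int \<times> (int ^ 'd)) l2 \<Rightarrow>\<^sub>L (int \<times> (int ^ 'd)) l2)"
  have cC: "coord (C X) (m, n) = c m * coord X (m, n)" for X m n
    unfolding C_def by (rule coord_mode_mult[where K = 1]) (simp add: cm)
  have C1: "norm C \<le> 1" unfolding C_def by (rule norm_mode_mult_le) (simp add: cm)
  define D where "D = D0 + Tt"
  have CD: "\<alpha> / 2 * (norm X)\<^sup>2 \<le> (C o\<^sub>L D) X \<bullet> X" for X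
  proof -
    have "norm (C (Tt X)) \<le> 1 * (\<alpha> / 2 * norm X)"
      by (rule order_trans[OF norm_blinfun], rule mult_mono[OF C1], rule order_trans[OF norm_blinfun],
          rule mult_right_mono[OF Tt]) auto
    then have "norm (C (Tt X)) * norm X \<le> \<alpha> / 2 * norm X * norm X" by (intro mult_right_mono) auto
    moreover have "- (norm (C (Tt X)) * norm X) \<le> C (Tt X) \<bullet> X"
      using Cauchy_Schwarz_ineq2[of "C (Tt X)" X] by linarith
    moreover have "(C o\<^sub>L D) X \<bullet> X = C (D0 X) \<bullet> X + C (Tt X) \<bullet> X"
      by (simp add: D_def blinfun.add_left blinfun.add_right inner_add_left)
    moreover have "\<alpha> * (norm X)\<^sup>2 = \<alpha> / 2 * (norm X)\<^sup>2 + \<alpha> / 2 * norm X * norm X"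
      by (simp add: power2_eq_square)
    ultimately show ?thesis using coer[of X, folded C_def] by linarith
  qed
  obtain R :: "(int \<times> (int ^ 'd)) l2 \<Rightarrow>\<^sub>L (int \<times> (int ^ 'd)) l2"
    where R: "\<And>x. R ((C o\<^sub>L D) x) = x" "\<And>x. (C o\<^sub>L D) (R x) = x"
    by (rule coercive_invertible[OF half_gt_zero[OF \<alpha>] CD]) (rule that)
  have C_inj: "x = y" if "C x = C y" for x y
  proof (rule l2_eqI)
    fix i :: "int \<times> (int ^ 'd)"
    obtain m n where i: "i = (m, n)" by (cases i)
    have "c m \<noteq> 0" using cm[of m] by auto
    then show "coord x i = coord y i" using arg_cong[OF that, of "\<lambda>x. coord x i"] by (simp add: i cC)
  qed
  \<comment> \<open>Coercivity was obtained only after multiplying by the phases; since C is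
    injective, the inverse of C D followed after C is a two-sided inverse of D.\<close>
  have R': "(R o\<^sub>L C) (D x) = x" "D ((R o\<^sub>L C) x) = x" for x
    using R(1)[of x] R(2)[of "C x"] by (auto intro: C_inj)
  define I0 where "I0 = {1, - 1 :: int} \<times> S"
  \<comment> \<open>The complex rank-one term has two real directions, the images of X0 and of i
    X0.\<close>
  define X1 where "X1 = (mode_mult (\<lambda>_. \<i>) X0 :: (int \<times> (int ^ 'd)) l2)"
  \<comment> \<open>Left indices enumerate the real coordinates of the head \<open>Hh\<close>, right
    indices the real and imaginary part of \<open>ell\<close>.\<close>
  define \<phi> where "\<phi> j = (case j of
      Inl q \<Rightarrow> Blinfun (\<lambda>x. if snd q then Re (coord (Hh x) (fst q)) else Im (coord (Hh x) (fst q)))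
    | Inr s \<Rightarrow> Blinfun (\<lambda>x. if s then Re (ell x) else Im (ell x)))" for j :: "((int \<times> (int ^ 'd)) \<times> bool) + bool"
  define b where "b j = (case j of
      Inl q \<Rightarrow> unit_l2 (fst q) (if snd q then 1 else \<i>)
    | Inr s \<Rightarrow> (k1 - k0) (if s then X0 else X1))" for j :: "((int \<times> (int ^ 'd)) \<times> bool) + bool"
  have \<phi>1: "\<phi> (Inl q) x = (if snd q then Re (coord (Hh x) (fst q)) else Im (coord (Hh x) (fst q)))" for q x
  proof -
    have "bounded_linear (\<lambda>x. coord (Hh x) (fst q))"
      by (rule bounded_linear_compose[OF bounded_linear_coord blinfun.bounded_linear_right])
    then have "bounded_linear (\<lambda>x. if snd q then Re (coord (Hh x) (fst q)) else Im (coord (Hh x) (fst q)))"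
      by (cases "snd q") (auto intro: bounded_linear_compose[OF bounded_linear_Re] bounded_linear_compose[OF bounded_linear_Im])
    then show ?thesis by (simp add: \<phi>_def bounded_linear_Blinfun_apply)
  qed
  have \<phi>2: "\<phi> (Inr s) x = (if s then Re (ell x) else Im (ell x))" for s x
  proof -
    have "bounded_linear ell"
      unfolding ell_def divide_inverse
      by (rule bounded_linear_compose[OF bounded_linear_mult_left bounded_linear_coord])
    then have "bounded_linear (\<lambda>x. if s then Re (ell x) else Im (ell x))"
      by (cases s) (auto intro: bounded_linear_compose[OF bounded_linear_Re] bounded_linear_compose[OF bounded_linear_Im])
    then show ?thesis by (simp add: \<phi>_def bounded_linear_Blinfun_apply)
  qed
  have T_split: "T x = D x + (\<Sum>j\<in>(I0 \<times> UNIV) <+> UNIV. \<phi> j x *\<^sub>R b j)" for x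
  proof -
    have H: "Hh x = (\<Sum>q\<in>I0 \<times> UNIV. \<phi> (Inl q) x *\<^sub>R b (Inl q))"
    proof -
      have "coord (Hh x) i = 0" if "i \<notin> I0" for i
        using that by (cases i) (auto simp: cHh I0_def crit_def ahead_def)
      from finite_support_expansion[OF _ this] S
      show ?thesis by (simp add: \<phi>1 b_def I0_def cong: if_cong)
    qed
    have "mul x X0 = Re (ell x) *\<^sub>R X0 + Im (ell x) *\<^sub>R X1"
    proof (rule l2_eqI)
      fix i :: "int \<times> (int ^ 'd)"
      have "coord X1 i = \<i> * coord X0 i"
        unfolding X1_def by (cases i) (simp add: coord_mode_mult[where K = 1])
      then show "coord (mul x X0) i = coord (Re (ell x) *\<^sub>R X0 + Im (ell x) *\<^sub>R X1) i"
        by (simp add: coord_mul scaleR_conv_of_real) (subst complex_eq[of "ell x"], simp add: algebra_simps)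
    qed
    then have "(k1 - k0) (mul x X0) = (\<Sum>s\<in>UNIV. \<phi> (Inr s) x *\<^sub>R b (Inr s))"
      by (simp add: UNIV_bool \<phi>2 b_def blinfun.add_right blinfun.scaleR_right)
    moreover have "T x = D x + Hh x + (k1 - k0) (mul x X0)"
      by (simp add: T_apply blinfun.diff_right blinfun.diff_left k0_split[of x] D_def blinfun.add_left)
    moreover have "(\<Sum>j\<in>(I0 \<times> UNIV) <+> UNIV. \<phi> j x *\<^sub>R b j)
        = (\<Sum>q\<in>I0 \<times> UNIV. \<phi> (Inl q) x *\<^sub>R b (Inl q)) + (\<Sum>s\<in>UNIV. \<phi> (Inr s) x *\<^sub>R b (Inr s))"
      using S by (subst sum.Plus) (auto simp: I0_def)
    ultimately show ?thesis unfolding H by (simp add: add.assoc)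
  qed
  have "finite ((I0 \<times> (UNIV :: bool set)) <+> (UNIV :: bool set))"
    using S unfolding I0_def by (intro finite_Plus finite_cartesian_product) auto
  from this R' T_split T_injective show thesis
    by (rule finite_rank_perturbation_invertible) (assumption, rule that)
qed

end

section \<open>The Klein--Gordon pencil\<close>

text \<open>Complex scalar multiplication, made explicit because the vector space structure on
  \<open>l2\<close> is the real one.\<close>

definition cs :: "complex \<Rightarrow> (int \<times> 'n) l2 \<Rightarrow> (int \<times> 'n) l2" where
  "cs c x = mode_mult (\<lambda>_. c) x"

lemma coord_cs: "coord (cs c x) i = c * coord x i"
  unfolding cs_def by (cases i) (simp add: coord_mode_mult[OF order_refl])

lemma norm_cs_le: "norm (cs c x) \<le> cmod c * norm x"
proof -
  have "norm (cs c x) \<le> norm (mode_mult (\<lambda>_. c) :: (int \<times> 'a) l2 \<Rightarrow>\<^sub>L (int \<times> 'a) l2) * norm x"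
    unfolding cs_def by (rule norm_blinfun)
  also have "\<dots> \<le> cmod c * norm x"
    by (rule mult_right_mono[OF norm_mode_mult_le norm_ge_zero]) simp
  finally show ?thesis .
qed

lemma cs_add: "cs c (x + y) = cs c x + cs c y" and cs_diff: "cs c (x - y) = cs c x - cs c y"
  and cs_scaleR: "cs c (r *\<^sub>R x) = r *\<^sub>R cs c x" and cs_cs: "cs c (cs d x) = cs (c * d) x"
  and cs_one: "cs 1 x = x" and cs_zero: "cs 0 x = 0" and cs_zero_right: "cs c 0 = 0"
  by (rule l2_eqI, simp add: coord_cs algebra_simps)+

lemma unemb_cs: "unemb (cs c x) m n = c * unemb x m n"
  by (simp add: unemb_def coord_cs)

text \<open>Operators are only real-linear by type.\<close>

definition clin :: "((int \<times> 'n) l2 \<Rightarrow>\<^sub>L (int \<times> 'n) l2) \<Rightarrow> bool" where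
  "clin M \<longleftrightarrow> (\<forall>c x. M (cs c x) = cs c (M x))"

lemma clin_add: "clin M \<Longrightarrow> clin N \<Longrightarrow> clin (M + N)"
  and clin_diff: "clin M \<Longrightarrow> clin N \<Longrightarrow> clin (M - N)"
  and clin_scaleR: "clin M \<Longrightarrow> clin (r *\<^sub>R M)"
  and clin_compose: "clin M \<Longrightarrow> clin N \<Longrightarrow> clin (M o\<^sub>L N)"
  and clin_id: "clin id_blinfun"
  by (simp_all add: clin_def blinfun.add_left blinfun.diff_left blinfun.scaleR_left cs_add cs_diff cs_scaleR)

lemma clin_pow: "clin M \<Longrightarrow> clin (blinfun_pow M j)"
  by (induction j) (simp_all add: clin_id clin_compose)

lemma clin_mode_mult:
  assumes "\<And>m. cmod (f m) \<le> K"
  shows "clin (mode_mult f)"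
  unfolding clin_def
  by (intro allI l2_eqI) (simp add: coord_cs split_paired_all coord_mode_mult[OF assms])

lemma clin_conv_op:
  fixes A :: "int \<Rightarrow> 'n \<Rightarrow> complex"
  assumes "wiener A"
  shows "clin (conv_op A)"
  unfolding clin_def
proof (intro allI l2_eqI)
  fix c and x :: "(int \<times> 'n) l2" and i :: "int \<times> 'n"
  obtain m n where i: "i = (m, n)" by (cases i)
  have "((\<lambda>k. c * (A k n * coord x (m - k, n))) has_sum c * coord (conv_op A x) (m, n)) UNIV"
    by (rule has_sum_cmult_right[OF coord_conv_op[OF assms]])
  moreover have "(\<lambda>k. c * (A k n * coord x (m - k, n))) = (\<lambda>k. A k n * coord (cs c x) (m - k, n))"
    by (simp add: coord_cs mult_ac)
  ultimately have "((\<lambda>k. A k n * coord (cs c x) (m - k, n)) has_sum c * coord (conv_op A x) (m, n)) UNIV"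
    by simp
  from has_sum_unique[OF coord_conv_op[OF assms] this]
  show "coord (conv_op A (cs c x)) i = coord (cs c (conv_op A x)) i"
    by (simp add: i coord_cs)
qed

lemma clin_lap_op: "clin lap_op"
  unfolding clin_def
  by (intro allI l2_eqI) (simp add: coord_cs split_paired_all coord_lap_op laplacian_cmult)

locale breather = dnls_eigenvalue p \<Omega> \<A> \<Lambda> bp bm
  for p :: nat and \<Omega> :: real and \<A> :: "int ^ 'd \<Rightarrow> real" and \<Lambda> :: complex
    and bp bm :: "int ^ 'd \<Rightarrow> complex" +
  fixes \<epsilon>\<^sub>1 C :: real and A :: "real \<Rightarrow> int \<Rightarrow> int ^ 'd \<Rightarrow> complex"
  assumes \<epsilon>1: "0 < \<epsilon>\<^sub>1" and branch: "breather_branch p \<Omega> \<A> \<epsilon>\<^sub>1 C A"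
begin

text \<open>Keeps 1 - \<epsilon>\<Omega> \<ge> 1/2, so that the frequency is a real square root
  analytic in \<epsilon>.\<close>

definition e1 :: real where
  "e1 = min \<epsilon>\<^sub>1 (1 / (2 * (\<bar>\<Omega>\<bar> + 1)))"

lemma e1: "0 < e1" "e1 \<le> \<epsilon>\<^sub>1" "e1 * \<bar>\<Omega>\<bar> \<le> 1 / 2"
proof -
  show "0 < e1" "e1 \<le> \<epsilon>\<^sub>1" using \<epsilon>1 by (auto simp: e1_def)
  have "e1 * \<bar>\<Omega>\<bar> \<le> 1 / (2 * (\<bar>\<Omega>\<bar> + 1)) * (\<bar>\<Omega>\<bar> + 1)"
    by (rule mult_mono) (auto simp: e1_def)
  also have "\<dots> = 1 / 2" by (simp add: field_simps)
  finally show "e1 * \<bar>\<Omega>\<bar> \<le> 1 / 2" .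
qed

lemma A_props:
  assumes "\<epsilon> \<in> {0<..<e1}"
  shows "A \<epsilon> \<in> ell22" "A \<epsilon> (- m) n = A \<epsilon> m n"
    "ell2_norm (A \<epsilon> 0) + ell2_norm (\<lambda>n. A \<epsilon> 1 n - of_real (\<A> n))
          + (\<Sum>\<^sub>\<infinity>m\<in>{2..}. ell2_norm (A \<epsilon> m)) \<le> C * \<epsilon>"
proof -
  have "\<epsilon> \<in> {0<..<\<epsilon>\<^sub>1}" using assms e1 by auto
  then show "A \<epsilon> \<in> ell22"
    "ell2_norm (A \<epsilon> 0) + ell2_norm (\<lambda>n. A \<epsilon> 1 n - of_real (\<A> n))
          + (\<Sum>\<^sub>\<infinity>m\<in>{2..}. ell2_norm (A \<epsilon> m)) \<le> C * \<epsilon>"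
    using branch unfolding breather_branch_def by blast+
  have "\<forall>m n. A \<epsilon> m n = A \<epsilon> (- m) n"
    using branch \<open>\<epsilon> \<in> {0<..<\<epsilon>\<^sub>1}\<close> unfolding breather_branch_def by blast
  then show "A \<epsilon> (- m) n = A \<epsilon> m n" by metis
qed

text \<open>Multiplication by the breather. Written as the image of
  \<open>emb (A \<epsilon>)\<close> under a bounded linear map, so that analyticity transfers at
  once; on the branch it is \<open>conv_op (A \<epsilon>)\<close>.\<close>

definition M :: "real \<Rightarrow> (int \<times> (int ^ 'd)) l2 \<Rightarrow>\<^sub>L (int \<times> (int ^ 'd)) l2" where
  "M \<epsilon> = conv_op (unemb (emb (A \<epsilon>)))"

lemma M_eq: "\<epsilon> \<in> {0<..<e1} \<Longrightarrow> M \<epsilon> = conv_op (A \<epsilon>)"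
  by (simp add: M_def unemb_emb A_props)

lemma A0_ell22: "A0 \<in> ell22"
  unfolding A0_def by (intro two_mode_ell22 Ac)

text \<open>The operator norm is at most the sum of the mode norms over all integers. The breather
  estimate covers the modes m \<ge> 0, and evenness in m supplies the others at the price of a
  factor 2.\<close>

lemma norm_M_diff:
  assumes \<epsilon>: "\<epsilon> \<in> {0<..<e1}"
  shows "norm (M \<epsilon> - conv_op A0) \<le> 2 * C * \<epsilon>"
proof -
  define g where "g k = ell2_norm (\<lambda>n. A \<epsilon> k n - A0 k n)" for k
  have diff: "(\<lambda>k n. A \<epsilon> k n - A0 k n) = unemb (emb (A \<epsilon>) - emb A0)"
    by (intro ext) (simp add: unemb_def coord_emb A_props[OF \<epsilon>] A0_ell22 diff_divide_distrib)
  have w: "wiener (\<lambda>k n. A \<epsilon> k n - A0 k n)" unfolding diff by (rule wiener_unemb)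
  have s: "g summable_on X" for X
    using w unfolding wiener_def g_def by (blast intro: summable_on_subset)
  have even: "g (- k) = g k" for k
    by (simp add: g_def A_props[OF \<epsilon>] A0_def two_mode_def)
  have "infsum g {..- 2} = infsum g {2..}"
    by (rule infsum_reindex_bij_witness[of _ uminus uminus]) (auto simp: even)
  moreover have "(UNIV :: int set) = {2..} \<union> {..- 2} \<union> {- 1, 0, 1}" by auto
  then have "infsum g UNIV = infsum g ({2..} \<union> {..- 2}) + infsum g {- 1, 0, 1}"
    using infsum_Un_disjoint[OF s s, of "{2..} \<union> {..- 2}" "{- 1, 0, 1}"] by auto
  moreover have "infsum g ({2..} \<union> {..- 2}) = infsum g {2..} + infsum g {..- 2}"
    by (rule infsum_Un_disjoint[OF s s]) auto
  moreover have "infsum g {- 1, 0, 1} = g 0 + 2 * g 1" by (simp add: even)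
  moreover have "g 0 = ell2_norm (A \<epsilon> 0)" "g 1 = ell2_norm (\<lambda>n. A \<epsilon> 1 n - of_real (\<A> n))"
    by (simp_all add: g_def A0_def two_mode_def Ac_def)
  moreover have "infsum g {2..} = (\<Sum>\<^sub>\<infinity>m\<in>{2..}. ell2_norm (A \<epsilon> m))"
    by (rule infsum_cong) (simp add: g_def A0_def two_mode_def)
  moreover have "0 \<le> g 0" by (simp add: g_def ell2_norm_nonneg)
  ultimately have "infsum g UNIV \<le> 2 * (C * \<epsilon>)" using A_props(3)[OF \<epsilon>] by linarith
  moreover have "norm (M \<epsilon> - conv_op A0) \<le> infsum g UNIV"
    using norm_conv_op_le[OF w]
    unfolding M_eq[OF \<epsilon>] g_def conv_op_diff[OF wiener_ell22[OF A_props(1)[OF \<epsilon>]] wiener_ell22[OF A0_ell22] w] .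
  ultimately show ?thesis by simp
qed

lemma regular_branch_M: "regular_branch e1 M (conv_op A0)"
  unfolding regular_branch_def
proof (intro conjI ballI)
  show "\<exists>K\<ge>0. \<forall>\<epsilon>\<in>{0<..<e1}. norm (M \<epsilon> - conv_op A0) \<le> K * \<epsilon>"
  proof (intro exI[of _ "2 * \<bar>C\<bar>"] conjI ballI)
    fix \<epsilon> assume \<epsilon>: "\<epsilon> \<in> {0<..<e1}"
    have "2 * C * \<epsilon> \<le> 2 * \<bar>C\<bar> * \<epsilon>" using \<epsilon> by (intro mult_right_mono) auto
    then show "norm (M \<epsilon> - conv_op A0) \<le> 2 * \<bar>C\<bar> * \<epsilon>" using norm_M_diff[OF \<epsilon>] by linarith
  qed simp
  fix \<epsilon> assume \<epsilon>: "\<epsilon> \<in> {0<..<e1}"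
  have "real_analytic_ell22 A {0<..<\<epsilon>\<^sub>1}" using branch by (simp add: breather_branch_def)
  then have "analytic_near (\<lambda>\<epsilon>. emb (A \<epsilon>)) \<epsilon>" by (rule analytic_near_emb) (use \<epsilon> e1 in auto)
  then show "analytic_near M \<epsilon>"
    unfolding M_def[abs_def] by (rule analytic_near_bounded_linear[OF bounded_linear_conv_op_unemb])
qed

section \<open>The pencil at positive parameter\<close>

definition Q\<Lambda>2 :: "(int \<times> (int ^ 'd)) l2 \<Rightarrow>\<^sub>L (int \<times> (int ^ 'd)) l2" where
  "Q\<Lambda>2 = mode_mult (\<lambda>m. \<Lambda>\<^sup>2 * of_real (1 / wt m))"
definition R\<Lambda> :: "(int \<times> (int ^ 'd)) l2 \<Rightarrow>\<^sub>L (int \<times> (int ^ 'd)) l2" where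
  "R\<Lambda> = mode_mult (\<lambda>m. 2 * \<Lambda> * of_real (1 / wt m))"
text \<open>The spectral equation has the form (1 - m^2) B + \<epsilon> E = 0. Off the critical
  modes the factor \<epsilon> stays; on them the first term vanishes and \<epsilon> is divided
  out.\<close>

definition G :: "real \<Rightarrow> (int \<times> (int ^ 'd)) l2 \<Rightarrow>\<^sub>L (int \<times> (int ^ 'd)) l2" where
  "G \<epsilon> = P1 + \<epsilon> *\<^sub>R (id_blinfun - P1)"
definition N :: "real \<Rightarrow> (int \<times> (int ^ 'd)) l2 \<Rightarrow>\<^sub>L (int \<times> (int ^ 'd)) l2" where
  "N \<epsilon> = \<Omega> *\<^sub>R Q2 + (\<epsilon> *\<^sub>R Q\<Lambda>2 + (sqrt (1 - \<epsilon> * \<Omega>) *\<^sub>R Q\<Lambda>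
     + ((1 + 2 * real p) *\<^sub>R (blinfun_pow (M \<epsilon>) (2 * p) o\<^sub>L Rw) + (- 1) *\<^sub>R (lap_op o\<^sub>L Rw))))"
text \<open>\<open>K0\<close>, \<open>K1\<close>, \<open>K2\<close> are the coefficients of 1,
  \<nu>, \<nu>^2 after the substitution \<mu> = \<Lambda> + \<nu>.\<close>

definition K0 :: "real \<Rightarrow> (int \<times> (int ^ 'd)) l2 \<Rightarrow>\<^sub>L (int \<times> (int ^ 'd)) l2" where
  "K0 \<epsilon> = L0 + (G \<epsilon> o\<^sub>L N \<epsilon>)"
definition K1 :: "real \<Rightarrow> (int \<times> (int ^ 'd)) l2 \<Rightarrow>\<^sub>L (int \<times> (int ^ 'd)) l2" where
  "K1 \<epsilon> = G \<epsilon> o\<^sub>L (\<epsilon> *\<^sub>R R\<Lambda> + sqrt (1 - \<epsilon> * \<Omega>) *\<^sub>R Q1)"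
definition K2 :: "real \<Rightarrow> (int \<times> (int ^ 'd)) l2 \<Rightarrow>\<^sub>L (int \<times> (int ^ 'd)) l2" where
  "K2 \<epsilon> = G \<epsilon> o\<^sub>L (\<epsilon> *\<^sub>R Rw)"

lemma regular_branch_G: "regular_branch e1 G (P1 + 0 *\<^sub>R (id_blinfun - P1))"
  unfolding G_def[abs_def] by (intro regular_branch_add regular_branch_const regular_branch_scaleR regular_branch_ident)

lemma regular_branch_K0: "regular_branch e1 K0 k0"
proof -
  have "regular_branch e1 (\<lambda>\<epsilon>. (1 + 2 * real p) *\<^sub>R (blinfun_pow (M \<epsilon>) (2 * p) o\<^sub>L Rw))
      ((1 + 2 * real p) *\<^sub>R (blinfun_pow (conv_op A0) (2 * p) o\<^sub>L Rw))"
    by (rule regular_branch_bilinear[OF bounded_bilinear_scaleR regular_branch_const])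
      (intro regular_branch_compose regular_branch_pow regular_branch_M regular_branch_const)
  then have "regular_branch e1 N (\<Omega> *\<^sub>R Q2 + (0 *\<^sub>R Q\<Lambda>2 + (1 *\<^sub>R Q\<Lambda>
     + ((1 + 2 * real p) *\<^sub>R (blinfun_pow (conv_op A0) (2 * p) o\<^sub>L Rw) + (- 1) *\<^sub>R (lap_op o\<^sub>L Rw)))))"
    unfolding N_def[abs_def]
    by (intro regular_branch_add regular_branch_const regular_branch_scaleR regular_branch_ident
        regular_branch_sqrt[OF e1(1,3)])
  from regular_branch_add[OF regular_branch_const regular_branch_compose[OF regular_branch_G this], of L0]
  show ?thesis by (simp add: K0_def[abs_def] k0_def Nlim_def)
qed

lemma regular_branch_K1: "regular_branch e1 K1 k1"
proof -
  have "regular_branch e1 (\<lambda>\<epsilon>. \<epsilon> *\<^sub>R R\<Lambda> + sqrt (1 - \<epsilon> * \<Omega>) *\<^sub>R Q1) (0 *\<^sub>R R\<Lambda> + 1 *\<^sub>R Q1)"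
    by (intro regular_branch_add regular_branch_scaleR regular_branch_ident regular_branch_sqrt[OF e1(1,3)])
  from regular_branch_compose[OF regular_branch_G this]
  show ?thesis by (simp add: K1_def[abs_def] k1_def)
qed

lemma regular_branch_K2: "regular_branch e1 K2 0"
proof -
  have "regular_branch e1 (\<lambda>\<epsilon>. \<epsilon> *\<^sub>R Rw) (0 *\<^sub>R Rw)"
    by (intro regular_branch_scaleR regular_branch_ident)
  from regular_branch_compose[OF regular_branch_G this]
  show ?thesis by (simp add: K2_def[abs_def])
qed

lemma Q\<Lambda>2_bound: "cmod (\<Lambda>\<^sup>2 * of_real (1 / wt m)) \<le> cmod (\<Lambda>\<^sup>2) * 1"
  unfolding norm_mult[of "\<Lambda>\<^sup>2"] norm_of_real by (intro mult_left_mono wt_bounds) simp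

lemma R\<Lambda>_bound: "cmod (2 * \<Lambda> * of_real (1 / wt m)) \<le> cmod (2 * \<Lambda>) * 1"
  unfolding norm_mult[of "2 * \<Lambda>"] norm_of_real by (intro mult_left_mono wt_bounds) simp

lemma coord_Q\<Lambda>2: "coord (Q\<Lambda>2 X) (m, n) = \<Lambda>\<^sup>2 * unemb X m n"
  unfolding Q\<Lambda>2_def by (subst coord_mode_mult[OF Q\<Lambda>2_bound]) (simp add: unemb_def)

lemma coord_R\<Lambda>: "coord (R\<Lambda> X) (m, n) = 2 * \<Lambda> * unemb X m n"
  unfolding R\<Lambda>_def by (subst coord_mode_mult[OF R\<Lambda>_bound]) (simp add: unemb_def)

lemma coord_G: "coord (G \<epsilon> X) (m, n) = (crit m + of_real \<epsilon> * (1 - crit m)) * coord X (m, n)"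
  by (simp add: G_def blinfun.add_left blinfun.diff_left blinfun.scaleR_left coord_P1
      scaleR_conv_of_real algebra_simps)

lemma clin_ops: "clin P1" "clin Rw" "clin L0" "clin Q1" "clin Q\<Lambda>" "clin Q2" "clin Q\<Lambda>2" "clin R\<Lambda>"
  "clin (conv_op A0)" "clin (M \<epsilon>)"
proof -
  show "clin Q\<Lambda>"
  proof -
    have "cmod (\<Lambda> * (\<i> * of_real (2 * real_of_int m / wt m))) \<le> cmod \<Lambda> * 1" for m
      unfolding norm_mult norm_of_real norm_ii mult_1 by (intro mult_left_mono wt_bounds) simp
    then show ?thesis unfolding Q\<Lambda>_def by (rule clin_mode_mult)
  qed
  show "clin Q1" unfolding Q1_def
    by (rule clin_mode_mult[where K = 1], unfold norm_mult norm_of_real norm_ii mult_1, rule wt_bounds)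
  show "clin Rw" "clin L0" "clin Q2" unfolding Rw_def L0_def Q2_def
    by (rule clin_mode_mult[where K = 1], unfold norm_of_real, rule wt_bounds)+
  show "clin P1" unfolding P1_def by (rule clin_mode_mult[OF cmod_crit])
  show "clin Q\<Lambda>2" unfolding Q\<Lambda>2_def by (rule clin_mode_mult[OF Q\<Lambda>2_bound])
  show "clin R\<Lambda>" unfolding R\<Lambda>_def by (rule clin_mode_mult[OF R\<Lambda>_bound])
  show "clin (conv_op A0)" by (rule clin_conv_op[OF wiener_ell22[OF A0_ell22]])
  show "clin (M \<epsilon>)" unfolding M_def by (rule clin_conv_op[OF wiener_unemb])
qed

lemma clin_k0: "clin k0"
  unfolding k0_def Nlim_def by (intro clin_add clin_compose clin_scaleR clin_pow clin_ops clin_lap_op)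

lemma clin_K: "clin (K0 \<epsilon>)" "clin (K1 \<epsilon>)" "clin (K2 \<epsilon>)"
  unfolding K0_def K1_def K2_def G_def N_def
  by (intro clin_add clin_diff clin_compose clin_scaleR clin_pow clin_ops clin_lap_op clin_id)+

text \<open>Expanding the square and inserting \<omega>^2 = 1 - \<epsilon>\<Omega> leaves 1 - m^2
  plus a multiple of \<epsilon>. The pencil differs from the spectral equation only by dividing the
  critical modes by \<epsilon>, which is reversible for \<epsilon> > 0.\<close>

lemma kg_iff:
  assumes \<epsilon>: "\<epsilon> \<in> {0<..<e1}"
  shows "kg_eigenpair p \<epsilon> (breather_freq \<Omega> \<epsilon>) (fourier_series (A \<epsilon>)) (of_real \<epsilon> * (\<Lambda> + \<nu>)) (unemb x)
    \<longleftrightarrow> x \<noteq> 0 \<and> K0 \<epsilon> x + K1 \<epsilon> (cs \<nu> x) + K2 \<epsilon> (cs \<nu> (cs \<nu> x)) = 0"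
proof -
  define \<omega> where "\<omega> = sqrt (1 - \<epsilon> * \<Omega>)"
  define B where "B = unemb x"
  have "\<epsilon> * \<Omega> \<le> \<epsilon> * \<bar>\<Omega>\<bar>" using \<epsilon> by (intro mult_left_mono) auto
  also have "\<dots> \<le> e1 * \<bar>\<Omega>\<bar>" using \<epsilon> by (intro mult_right_mono) auto
  finally have "0 \<le> 1 - \<epsilon> * \<Omega>" using e1(3) by linarith
  then have "\<omega>\<^sup>2 = 1 - \<epsilon> * \<Omega>" by (simp add: \<omega>_def)
  from arg_cong[OF this, of complex_of_real]
  have \<omega>: "(of_real \<omega>)\<^sup>2 = 1 - of_real \<epsilon> * (of_real \<Omega> :: complex)" by simp
  have \<epsilon>0: "complex_of_real \<epsilon> \<noteq> 0" using \<epsilon> by simp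
  define h where "h m n = coord (blinfun_pow (conv_op (A \<epsilon>)) (2 * p) (Rw x)) (m, n)" for m n
  have int: "integral {-pi..pi}
      (\<lambda>\<tau>. fourier_series (A \<epsilon>) \<tau> n ^ (2 * p) * fourier_series B \<tau> n * cis (- (of_int m * \<tau>)))
    = 2 * of_real pi * h m n" for m n
    unfolding h_def
  proof (rule fourier_coefficient_conv_op_pow[OF wiener_ell22[OF A_props(1)[OF \<epsilon>]]])
    show "coord (Rw x) (m, n) = B m n" for m by (simp add: coord_Rw B_def)
    show "(\<lambda>m. cmod (coord (Rw x) (m, n))) summable_on UNIV"
      unfolding coord_Rw
      by (rule summable_on_comparison_test[OF unemb_norm_summable]) (auto intro: ell2_norm_coord_le unemb_in_ell2)
  qed
  define E where "E m n = of_real \<Omega> * ((of_int m)\<^sup>2 * B m n) + (of_real \<epsilon> * (\<Lambda>\<^sup>2 * B m n)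
     + (of_real \<omega> * (\<Lambda> * (2 * \<i> * of_int m * B m n)) + ((1 + 2 * of_nat p) * h m n - laplacian (B m) n)))
     + (of_real \<epsilon> * (2 * \<Lambda> * (\<nu> * B m n)) + of_real \<omega> * (2 * \<i> * of_int m * (\<nu> * B m n)))
     + of_real \<epsilon> * (\<nu> * (\<nu> * B m n))" for m n
  have kg: "(1 + (of_real \<epsilon> * (\<Lambda> + \<nu>) + \<i> * of_int m * of_real \<omega>)\<^sup>2) * B m n
        + of_real (\<epsilon> * (1 + 2 * real p) / (2 * pi)) * (2 * of_real pi * h m n) - of_real \<epsilon> * laplacian (B m) n
      = of_real (1 - (real_of_int m)\<^sup>2) * B m n + of_real \<epsilon> * E m n" for m n
  proof -
    have "(of_real \<epsilon> * (\<Lambda> + \<nu>) + \<i> * of_int m * of_real \<omega>)\<^sup>2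
        = (of_real \<epsilon>)\<^sup>2 * (\<Lambda> + \<nu>)\<^sup>2 + 2 * of_real \<epsilon> * (\<Lambda> + \<nu>) * (\<i> * of_int m * of_real \<omega>)
          - (of_int m)\<^sup>2 * (of_real \<omega>)\<^sup>2"
      by (simp add: power2_eq_square algebra_simps)
    also have "(of_int m)\<^sup>2 * (of_real \<omega>)\<^sup>2 = (of_int m :: complex)\<^sup>2 - (of_int m)\<^sup>2 * of_real \<epsilon> * of_real \<Omega>"
      unfolding \<omega> by (simp add: algebra_simps)
    finally have sq: "(of_real \<epsilon> * (\<Lambda> + \<nu>) + \<i> * of_int m * of_real \<omega>)\<^sup>2
        = (of_real \<epsilon>)\<^sup>2 * (\<Lambda> + \<nu>)\<^sup>2 + 2 * of_real \<epsilon> * (\<Lambda> + \<nu>) * (\<i> * of_int m * of_real \<omega>)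
          - ((of_int m)\<^sup>2 - (of_int m)\<^sup>2 * of_real \<epsilon> * of_real \<Omega>)" .
    have c: "of_real (\<epsilon> * (1 + 2 * real p) / (2 * pi)) * (2 * of_real pi * h m n)
        = of_real \<epsilon> * ((1 + 2 * of_nat p) * h m n)" by simp
    show ?thesis unfolding sq c E_def by (simp add: power2_eq_square algebra_simps)
  qed
  let ?P = "K0 \<epsilon> x + K1 \<epsilon> (cs \<nu> x) + K2 \<epsilon> (cs \<nu> (cs \<nu> x))"
  have P: "coord ?P (m, n) = of_real (1 - (real_of_int m)\<^sup>2) * B m n
      + (crit m + of_real \<epsilon> * (1 - crit m)) * E m n" for m n
    unfolding K0_def K1_def K2_def E_def h_def B_def M_eq[OF \<epsilon>, symmetric] \<omega>_def
    by (simp add: blinfun.add_left blinfun.diff_left blinfun.scaleR_left coord_L0 coord_G N_def coord_Q2 coord_Q\<Lambda>2 coord_Q\<Lambda>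
        coord_R\<Lambda> coord_Q1 coord_Rw coord_lap_Rw unemb_cs scaleR_conv_of_real algebra_simps)
  \<comment> \<open>On the critical modes 1 - m^2 = 0, so the two forms of the equation differ by
    the nonzero factor \<epsilon>.\<close>
  have crit_sq: "of_real (1 - (real_of_int m)\<^sup>2) * B m n = 0" if "crit m \<noteq> 0" for m n
    using that by (auto simp: crit_def split: if_splits)
  have iff: "coord ?P (m, n) = 0 \<longleftrightarrow> of_real (1 - (real_of_int m)\<^sup>2) * B m n + of_real \<epsilon> * E m n = 0" for m n
  proof (cases "crit m = 0")
    case False
    then have "crit m = 1" by (auto simp: crit_def split: if_splits)
    then show ?thesis unfolding P crit_sq[OF False] using \<epsilon>0 by simp
  next
    case True
    then show ?thesis unfolding P by simp
  qed
  have ext0: "Y = 0 \<longleftrightarrow> (\<forall>m n. coord Y (m, n) = 0)" for Y :: "(int \<times> (int ^ 'd)) l2"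
    by (auto intro!: l2_eqI)
  have P0: "?P = 0 \<longleftrightarrow> (\<forall>m n. of_real (1 - (real_of_int m)\<^sup>2) * B m n + of_real \<epsilon> * E m n = 0)"
    unfolding ext0[of ?P] iff ..
  have "B \<noteq> (\<lambda>m n. 0) \<longleftrightarrow> x \<noteq> 0"
  proof -
    have "x = 0" if "B = (\<lambda>m n. 0)"
    proof (rule l2_eqI)
      fix i :: "int \<times> (int ^ 'd)"
      obtain m n where i: "i = (m, n)" by (cases i)
      show "coord x i = coord 0 i" using fun_cong[OF fun_cong[OF that], of m n] by (simp add: B_def unemb_def i)
    qed
    moreover have "B = (\<lambda>m n. 0)" if "x = 0" using that by (intro ext) (simp add: B_def unemb_def)
    ultimately show ?thesis by blast
  qed
  then show ?thesis
    unfolding kg_eigenpair_def B_def[symmetric] int breather_freq_def \<omega>_def[symmetric] P0 kg[symmetric]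
      right_minus_eq
    using unemb_in_ell22[of x] by (auto simp: B_def)
qed

end

section \<open>The spectral branch\<close>

context breather
begin

text \<open>The eigenvector encoded by z: X0 plus the part of z on which \<open>ell\<close>
  vanishes, so that \<open>ell (nrm z) = 1\<close> always.\<close>

definition nrm :: "(int \<times> (int ^ 'd)) l2 \<Rightarrow> (int \<times> (int ^ 'd)) l2" where
  "nrm z = X0 + z - mul z X0"

lemma pencil_eq: "pencil blinfun_apply mul X0 (K0 \<epsilon>) (K1 \<epsilon>) (K2 \<epsilon>) z
    = K0 \<epsilon> (nrm z) + K1 \<epsilon> (cs (ell z) (nrm z)) + K2 \<epsilon> (cs (ell z) (cs (ell z) (nrm z)))"
  by (simp add: pencil_def Let_def mul_def cs_def nrm_def)

lemma mul_cs: "mul z y = cs (ell z) y"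
  by (simp add: mul_def cs_def)

lemma ell_cs: "ell (cs c x) = c * ell x"
  by (simp add: ell_def coord_cs)

lemma unemb_X0: "unemb X0 m n = two_mode (\<lambda>n. bp n + \<i> * bm n) (\<lambda>n. bp n + (- \<i>) * bm n) m n"
  unfolding X0_def using b_ell2 by (subst unemb_vec) auto

lemma norm_ell_le: "cmod (ell z) \<le> norm z / cmod (coord X0 i0)"
  unfolding ell_def norm_divide by (intro divide_right_mono norm_coord_le) simp

text \<open>
  An eigenvector \<open>x\<close> for an eigenvalue near \<open>\<epsilon>\<Lambda>\<close> is close to a multiple of \<open>X0\<close>: the component
  \<open>w = x - ell x X0\<close> satisfies \<open>T w = k0 x\<close>, and \<open>k0 x\<close> is small because \<open>K0 \<epsilon>\<close> is close to \<open>k0\<close>.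
\<close>

lemma eigenvector_near_X0:
  assumes S: "\<And>x. blinfun_apply S (T x) = x"
    and K: "norm (K0 \<epsilon> - k0) \<le> a" "norm (K1 \<epsilon>) \<le> b" "norm (K2 \<epsilon>) \<le> b'" "cmod \<nu> \<le> v"
    and small: "norm S * (a + b * v + b' * (v * v)) \<le> \<delta>" "\<delta> \<le> 1 / 2"
    and x: "x \<noteq> 0" "K0 \<epsilon> x + K1 \<epsilon> (cs \<nu> x) + K2 \<epsilon> (cs \<nu> (cs \<nu> x)) = 0"
  shows "ell x \<noteq> 0" "norm (cs (1 / ell x) x - X0) \<le> 2 * \<delta> * norm X0"
proof -
  define w where "w = x - cs (ell x) X0"
  have nonneg: "0 \<le> a" "0 \<le> b" "0 \<le> b'" "0 \<le> v"
    using K norm_ge_zero order_trans by blast+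
  have kX: "k0 (cs c X0) = 0" for c
    using clin_k0 k0_X0 by (simp add: clin_def cs_zero_right)
  have "ell w = 0" by (simp add: w_def ell_diff ell_cs ell_X0)
  then have "T w = k0 w" by (simp add: T_apply mul_cs cs_zero)
  also have "\<dots> = k0 x" by (simp add: w_def blinfun.diff_right kX)
  also have "\<dots> = - ((K0 \<epsilon> - k0) x + (K1 \<epsilon> (cs \<nu> x) + K2 \<epsilon> (cs \<nu> (cs \<nu> x))))"
    using x(2) by (simp add: blinfun.diff_left algebra_simps add_eq_0_iff)
  finally have Tw: "T w = - ((K0 \<epsilon> - k0) x + (K1 \<epsilon> (cs \<nu> x) + K2 \<epsilon> (cs \<nu> (cs \<nu> x))))" .
  have app: "norm (blinfun_apply F y) \<le> f * g" if "norm F \<le> f" "norm y \<le> g" for F :: "(int \<times> (int ^ 'd)) l2 \<Rightarrow>\<^sub>L (int \<times> (int ^ 'd)) l2" and y f g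
  proof -
    have "0 \<le> f" by (rule order_trans[OF norm_ge_zero that(1)])
    then show ?thesis
      by (intro order_trans[OF norm_blinfun] mult_mono that norm_ge_zero)
  qed
  have cs1: "norm (cs \<nu> x) \<le> v * norm x"
    using norm_cs_le[of \<nu> x] mult_right_mono[OF K(4) norm_ge_zero[of x]] by linarith
  have cs2: "norm (cs \<nu> (cs \<nu> x)) \<le> v * (v * norm x)"
    by (rule order_trans[OF norm_cs_le mult_mono[OF K(4) cs1 nonneg(4) norm_ge_zero]])
  have "norm (T w) \<le> a * norm x + (b * (v * norm x) + b' * (v * (v * norm x)))"
    unfolding Tw norm_minus_cancel
    by (intro norm_triangle_mono app K cs1 cs2 order_refl)
  then have Tw_le: "norm (T w) \<le> (a + b * v + b' * (v * v)) * norm x" by (simp add: algebra_simps)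
  have "norm w = norm (S (T w))" by (simp add: S)
  also have "\<dots> \<le> norm S * ((a + b * v + b' * (v * v)) * norm x)"
    by (rule order_trans[OF norm_blinfun mult_left_mono[OF Tw_le norm_ge_zero]])
  also have "\<dots> = norm S * (a + b * v + b' * (v * v)) * norm x" by simp
  also have "\<dots> \<le> \<delta> * norm x" by (intro mult_right_mono small) simp
  finally have w: "norm w \<le> \<delta> * norm x" .
  have \<delta>: "0 \<le> \<delta>"
    by (rule order_trans[OF _ small(1)]) (use nonneg in simp)
  \<comment> \<open>Absorption: with \<delta> \<le> 1/2 the remainder w moves to the left-hand side,
    so ell x controls the whole norm of x and cannot vanish.\<close>
  have "norm x = norm (w + cs (ell x) X0)" by (simp add: w_def)
  also have "\<dots> \<le> \<delta> * norm x + cmod (ell x) * norm X0"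
    by (rule norm_triangle_mono[OF w norm_cs_le])
  also have "\<dots> \<le> (1 / 2) * norm x + cmod (ell x) * norm X0"
    using mult_right_mono[OF small(2) norm_ge_zero[of x]] by simp
  finally have x_le: "norm x \<le> 2 * (cmod (ell x) * norm X0)" by linarith
  show l: "ell x \<noteq> 0"
  proof
    assume "ell x = 0"
    then show False using x_le x(1) by simp
  qed
  have "cs (1 / ell x) x - X0 = cs (1 / ell x) w"
    using l by (simp add: w_def cs_diff cs_cs cs_one)
  then have "norm (cs (1 / ell x) x - X0) \<le> 1 / cmod (ell x) * norm w"
    using norm_cs_le[of "1 / ell x" w] by (simp add: norm_divide)
  also have "\<dots> \<le> 1 / cmod (ell x) * (\<delta> * (2 * (cmod (ell x) * norm X0)))"
    using w mult_left_mono[OF x_le \<delta>] by (intro mult_left_mono) auto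
  also have "\<dots> = 2 * \<delta> * norm X0" using l by simp
  finally show "norm (cs (1 / ell x) x - X0) \<le> 2 * \<delta> * norm X0" .
qed

lemma regular_branch_bound:
  assumes "regular_branch e1 F f"
  obtains K where "0 \<le> K" "\<And>\<epsilon>. \<epsilon> \<in> {0<..<e1} \<Longrightarrow> norm (F \<epsilon> - f) \<le> K * \<epsilon>"
  using assms unfolding regular_branch_def by blast

text \<open>Existence reads \<nu> and the eigenvector off the pencil branch. For uniqueness, an
  eigenvalue within C_0 \<epsilon>^2 of \<epsilon>\<Lambda> has |\<nu>| \<le> C_0 \<epsilon>; its
  eigenvector, rescaled to ell = 1, is then close enough to X0 to lie in the uniqueness ball.
  Therefore C_0 is fixed before \<epsilon>_0.\<close>

lemma spectral_branch:
  "\<exists>\<epsilon>\<^sub>0>0. \<exists>C\<^sub>0>0. \<epsilon>\<^sub>0 \<le> \<epsilon>\<^sub>1 \<and>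
    (\<exists>ev B. kg_spectral_branch p \<Omega> A \<Lambda> (bp, bm) \<epsilon>\<^sub>0 C\<^sub>0 ev B \<and>
      (\<forall>\<epsilon>\<^sub>2 ev' B'. 0 < \<epsilon>\<^sub>2 \<and> \<epsilon>\<^sub>2 \<le> \<epsilon>\<^sub>0
          \<and> kg_spectral_branch p \<Omega> A \<Lambda> (bp, bm) \<epsilon>\<^sub>2 C\<^sub>0 ev' B' \<longrightarrow>
        (\<forall>\<epsilon>\<in>{0<..<\<epsilon>\<^sub>2}. ev' \<epsilon> = ev \<epsilon> \<and>
          (\<exists>c. c \<noteq> 0 \<and> (\<forall>m n. B' \<epsilon> m n = c * B \<epsilon> m n)))))"
proof -
  obtain S :: "(int \<times> (int ^ 'd)) l2 \<Rightarrow>\<^sub>L (int \<times> (int ^ 'd)) l2"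
    where S: "\<And>x. S (T x) = x" "\<And>x. T (S x) = x"
    by (rule T_invertible) (rule that)
  obtain c0 where c0: "0 \<le> c0" "\<And>\<epsilon>. \<epsilon> \<in> {0<..<e1} \<Longrightarrow> norm (K0 \<epsilon> - k0) \<le> c0 * \<epsilon>"
    by (rule regular_branch_bound[OF regular_branch_K0]) (rule that)
  obtain c1 where c1: "0 \<le> c1" "\<And>\<epsilon>. \<epsilon> \<in> {0<..<e1} \<Longrightarrow> norm (K1 \<epsilon> - k1) \<le> c1 * \<epsilon>"
    by (rule regular_branch_bound[OF regular_branch_K1]) (rule that)
  obtain c2 where c2: "0 \<le> c2" "\<And>\<epsilon>. \<epsilon> \<in> {0<..<e1} \<Longrightarrow> norm (K2 \<epsilon> - 0) \<le> c2 * \<epsilon>"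
    by (rule regular_branch_bound[OF regular_branch_K2]) (rule that)
  define Mx where "Mx = c0 + c1 + c2"
  have KM: "norm (K0 \<epsilon> - k0) \<le> Mx * \<epsilon>" "norm (K1 \<epsilon> - k1) \<le> Mx * \<epsilon>" "norm (K2 \<epsilon>) \<le> Mx * \<epsilon>"
    if "\<epsilon> \<in> {0<..<e1}" for \<epsilon>
  proof -
    have "c0 * \<epsilon> \<le> Mx * \<epsilon>" "c1 * \<epsilon> \<le> Mx * \<epsilon>" "c2 * \<epsilon> \<le> Mx * \<epsilon>"
      using that c0(1) c1(1) c2(1) by (auto intro!: mult_right_mono simp: Mx_def)
    then show "norm (K0 \<epsilon> - k0) \<le> Mx * \<epsilon>" "norm (K1 \<epsilon> - k1) \<le> Mx * \<epsilon>" "norm (K2 \<epsilon>) \<le> Mx * \<epsilon>"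
      using c0(2)[OF that] c1(2)[OF that] c2(2)[OF that] by auto
  qed
  have Mx: "0 \<le> Mx" using c0 c1 c2 by (simp add: Mx_def)
  have an: "analytic_near K0 \<epsilon> \<and> analytic_near K1 \<epsilon> \<and> analytic_near K2 \<epsilon>" if "\<epsilon> \<in> {0<..<e1}" for \<epsilon>
    using that regular_branch_K0 regular_branch_K1 regular_branch_K2 unfolding regular_branch_def by blast
  have ST: "S (k0 (z - mul z X0) + k1 (mul z X0)) = z" for z
    using S(1)[of z] by (simp only: T_apply)
  have Sinj: "x = 0" if "S x = 0" for x
    using S(2)[of x] that by simp
  obtain e2 \<rho> C' z where e2: "0 < e2" "e2 \<le> e1" and \<rho>: "0 < \<rho>" and C': "0 \<le> C'"
    and z0: "\<And>\<epsilon>. \<epsilon> \<in> {0<..<e2} \<Longrightarrow> pencil blinfun_apply mul X0 (K0 \<epsilon>) (K1 \<epsilon>) (K2 \<epsilon>) (z \<epsilon>) = 0"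
    and zC: "\<And>\<epsilon>. \<epsilon> \<in> {0<..<e2} \<Longrightarrow> norm (z \<epsilon>) \<le> C' * \<epsilon>"
    and za: "\<And>\<epsilon>. \<epsilon> \<in> {0<..<e2} \<Longrightarrow> analytic_near z \<epsilon>"
    and zu: "\<And>\<epsilon> z'. \<epsilon> \<in> {0<..<e2} \<Longrightarrow> norm z' \<le> \<rho> \<Longrightarrow>
       pencil blinfun_apply mul X0 (K0 \<epsilon>) (K1 \<epsilon>) (K2 \<epsilon>) z' = 0 \<Longrightarrow> z' = z \<epsilon>"
    by (rule pencil_analytic_branch[where mul = mul and ?X0.0 = X0 and S = S and ?k0.0 = k0 and ?k1.0 = k1
          and ?K0.0 = K0 and ?K1.0 = K1 and ?K2.0 = K2 and M = Mx and ?\<epsilon>1.0 = e1,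
          OF bounded_bilinear_mul e1(1) KM an ST Sinj k0_X0])
        (assumption, assumption, assumption, assumption, assumption, rule that)
  have bl: "bounded_linear (\<lambda>z. z - mul z X0)"
    by (intro bounded_linear_sub bounded_linear_ident bounded_bilinear.bounded_linear_left[OF bounded_bilinear_mul])
  obtain h where h: "0 < h" "\<And>z. norm (z - mul z X0) \<le> norm z * h"
    using bounded_linear.pos_bounded[OF bl] by blast
  define s where "s = 1 / cmod (coord X0 i0)"
  have s: "0 < s" using i0 by (simp add: s_def)
  \<comment> \<open>Large enough for the three estimates of the branch: s C' for the eigenvalue, 2 h
    C' for the two critical modes, (1 + \<open>inv_wt_sum\<close>) h C' for mode 0 and the
    tail.\<close>
  define C\<^sub>0 where "C\<^sub>0 = 1 + s * C' + (3 + inv_wt_sum) * (h * C')"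
  have C0: "0 < C\<^sub>0" "s * C' \<le> C\<^sub>0" "2 * (h * C') \<le> C\<^sub>0" "(1 + inv_wt_sum) * (h * C') \<le> C\<^sub>0"
    using s C' h inv_wt_sum_nonneg by (auto simp: C\<^sub>0_def distrib_right intro!: add_pos_nonneg)
  \<comment> \<open>The quantity a + b v + b' v^2 of \<open>eigenvector_near_X0\<close> at v = C_0
    \<epsilon> is at most \<kappa>\<epsilon>; surplus factors \<epsilon> are estimated by e1. Its
    \<delta> is then \<sigma>\<epsilon>.\<close>
  define \<kappa> where "\<kappa> = Mx + (norm k1 + Mx * e1) * C\<^sub>0 + Mx * e1 * (C\<^sub>0 * (C\<^sub>0 * e1))"
  have \<kappa>: "0 \<le> \<kappa>" unfolding \<kappa>_def using Mx C0 e1 by (intro add_nonneg_nonneg mult_nonneg_nonneg) auto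
  define \<sigma> where "\<sigma> = norm S * \<kappa>"
  have \<sigma>: "0 \<le> \<sigma>" using \<kappa> by (simp add: \<sigma>_def)
  \<comment> \<open>A competing eigenpair corresponds to a z' of norm at most \<tau>\<epsilon>:
    2\<sigma> accounts for the eigenvector and C_0 for the eigenvalue. The choice of \<epsilon>_0
    makes \<sigma>\<epsilon> \<le> 1/2 and \<tau>\<epsilon> \<le> \<rho>.\<close>
  define \<tau> where "\<tau> = (2 * \<sigma> + C\<^sub>0) * norm X0"
  have \<tau>: "0 \<le> \<tau>" using \<sigma> C0 by (simp add: \<tau>_def)
  define \<epsilon>\<^sub>0 where "\<epsilon>\<^sub>0 = min e2 (min (1 / (2 * (\<sigma> + 1))) (\<rho> / (\<tau> + 1)))"
  have \<epsilon>0: "0 < \<epsilon>\<^sub>0" "\<epsilon>\<^sub>0 \<le> e2" using e2 \<rho> \<sigma> \<tau> by (auto simp: \<epsilon>\<^sub>0_def intro!: divide_pos_pos add_nonneg_pos)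
  have in2: "\<epsilon> \<in> {0<..<e2}" "\<epsilon> \<in> {0<..<e1}" if "\<epsilon> \<in> {0<..<\<epsilon>\<^sub>0}" for \<epsilon> using that \<epsilon>0 e2 by auto
  have \<sigma>\<epsilon>: "\<sigma> * \<epsilon> \<le> 1 / 2" and \<tau>\<epsilon>: "\<tau> * \<epsilon> \<le> \<rho>" if "\<epsilon> \<in> {0<..<\<epsilon>\<^sub>0}" for \<epsilon>
  proof -
    have "\<sigma> * \<epsilon> \<le> (\<sigma> + 1) * (1 / (2 * (\<sigma> + 1)))"
      using that \<sigma> by (intro mult_mono) (auto simp: \<epsilon>\<^sub>0_def)
    also have "\<dots> = 1 / 2" using \<sigma> by (simp add: field_simps)
    finally show "\<sigma> * \<epsilon> \<le> 1 / 2" .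
    have "\<tau> * \<epsilon> \<le> (\<tau> + 1) * (\<rho> / (\<tau> + 1))"
      using that \<tau> \<rho> by (intro mult_mono) (auto simp: \<epsilon>\<^sub>0_def)
    also have "\<dots> = \<rho>" using \<tau> by simp
    finally show "\<tau> * \<epsilon> \<le> \<rho>" .
  qed
  define x where "x \<epsilon> = nrm (z \<epsilon>)" for \<epsilon>
  define ev where "ev \<epsilon> = \<epsilon> *\<^sub>R (\<Lambda> + ell (z \<epsilon>))" for \<epsilon>
  define B where "B \<epsilon> = unemb (x \<epsilon>)" for \<epsilon>
  have ell_nrm: "ell (nrm y) = 1" for y by (simp add: nrm_def ell_add ell_diff mul_cs ell_cs ell_X0)
  have xX: "x \<epsilon> - X0 = z \<epsilon> - mul (z \<epsilon>) X0" for \<epsilon> by (simp add: x_def nrm_def)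
  have xX_le: "norm (x \<epsilon> - X0) \<le> h * C' * \<epsilon>" if "\<epsilon> \<in> {0<..<\<epsilon>\<^sub>0}" for \<epsilon>
  proof -
    have "norm (x \<epsilon> - X0) \<le> norm (z \<epsilon>) * h" unfolding xX by (rule h(2))
    also have "\<dots> \<le> (C' * \<epsilon>) * h" using h(1) by (intro mult_right_mono zC in2[OF that]) auto
    finally show ?thesis by (simp add: mult_ac)
  qed
  have x_an: "analytic_near x \<epsilon>" if "\<epsilon> \<in> {0<..<\<epsilon>\<^sub>0}" for \<epsilon>
  proof -
    have "analytic_near (\<lambda>\<epsilon>. X0 + (z \<epsilon> - mul (z \<epsilon>) X0)) \<epsilon>"
      by (intro analytic_near_add analytic_near_const analytic_near_bounded_linear[OF bl] za in2[OF that])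
    then show ?thesis by (simp add: x_def[abs_def] nrm_def add_diff_eq)
  qed
  have bl_ell: "bounded_linear ell"
    unfolding ell_def[abs_def] divide_inverse
    by (rule bounded_linear_compose[OF bounded_linear_mult_left bounded_linear_coord])
  have ev_an: "analytic_near ev \<epsilon>" if "\<epsilon> \<in> {0<..<\<epsilon>\<^sub>0}" for \<epsilon>
    unfolding ev_def[abs_def]
    by (intro analytic_near_bilinear[OF bounded_bilinear_scaleR] analytic_near_ident analytic_near_add
        analytic_near_const analytic_near_bounded_linear[OF bl_ell] za in2[OF that])
  have kg: "kg_eigenpair p \<epsilon> (breather_freq \<Omega> \<epsilon>) (fourier_series (A \<epsilon>)) (ev \<epsilon>) (B \<epsilon>)"
    if "\<epsilon> \<in> {0<..<\<epsilon>\<^sub>0}" for \<epsilon>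
  proof -
    have "x \<epsilon> \<noteq> 0" using ell_nrm[of "z \<epsilon>"] by (auto simp: x_def ell_def)
    moreover have "K0 \<epsilon> (x \<epsilon>) + K1 \<epsilon> (cs (ell (z \<epsilon>)) (x \<epsilon>)) + K2 \<epsilon> (cs (ell (z \<epsilon>)) (cs (ell (z \<epsilon>)) (x \<epsilon>))) = 0"
      using z0[OF in2(1)[OF that]] by (simp only: pencil_eq x_def)
    ultimately show ?thesis
      using kg_iff[OF in2(2)[OF that], of "ell (z \<epsilon>)" "x \<epsilon>"] by (simp add: ev_def B_def scaleR_conv_of_real)
  qed
  have diff: "ell2_norm (\<lambda>n. B \<epsilon> m n - unemb X0 m n) \<le> h * C' * \<epsilon>" if "\<epsilon> \<in> {0<..<\<epsilon>\<^sub>0}" for \<epsilon> m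
  proof -
    have "(\<lambda>n. B \<epsilon> m n - unemb X0 m n) = unemb (x \<epsilon> - X0) m"
      by (auto simp: B_def unemb_def diff_divide_distrib)
    then have "ell2_norm (\<lambda>n. B \<epsilon> m n - unemb X0 m n) \<le> norm (x \<epsilon> - X0) * (1 / wt m)"
      using unemb_norm_le[of "x \<epsilon> - X0" m] by simp
    also have "\<dots> \<le> norm (x \<epsilon> - X0) * 1"
      using wt_bounds(1)[of m] wt_pos[of m] by (intro mult_left_mono) auto
    finally show ?thesis using xX_le[OF that] by simp
  qed
  have br: "kg_spectral_branch p \<Omega> A \<Lambda> (bp, bm) \<epsilon>\<^sub>0 C\<^sub>0 ev B"
    unfolding kg_spectral_branch_def
  proof (intro conjI ballI)
    show "real_analytic_complex ev {0<..<\<epsilon>\<^sub>0}" by (rule real_analytic_complexI[OF ev_an])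
    show "real_analytic_ell22 B {0<..<\<epsilon>\<^sub>0}"
      unfolding B_def[abs_def] by (rule real_analytic_ell22_unemb[OF x_an])
    fix \<epsilon> assume \<epsilon>: "\<epsilon> \<in> {0<..<\<epsilon>\<^sub>0}"
    then have pos: "0 \<le> \<epsilon>" by simp
    show "kg_eigenpair p \<epsilon> (breather_freq \<Omega> \<epsilon>) (fourier_series (A \<epsilon>)) (ev \<epsilon>) (B \<epsilon>)" by (rule kg[OF \<epsilon>])
    have "cmod (ev \<epsilon> - of_real \<epsilon> * \<Lambda>) = \<epsilon> * cmod (ell (z \<epsilon>))"
      using pos by (simp add: ev_def scaleR_conv_of_real distrib_left norm_mult)
    also have "\<dots> \<le> \<epsilon> * (C' * \<epsilon> * s)"
      using norm_ell_le[of "z \<epsilon>"] mult_right_mono[OF zC[OF in2(1)[OF \<epsilon>]], of s] s pos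
      by (intro mult_left_mono) (auto simp: s_def)
    also have "\<dots> = (s * C') * \<epsilon>\<^sup>2" by (simp add: power2_eq_square)
    also have "\<dots> \<le> C\<^sub>0 * \<epsilon>\<^sup>2" by (intro mult_right_mono C0) simp
    finally show "cmod (ev \<epsilon> - of_real \<epsilon> * \<Lambda>) \<le> C\<^sub>0 * \<epsilon>\<^sup>2" .
    have scale: "c * \<epsilon> \<le> C\<^sub>0 * \<epsilon>" if "c \<le> C\<^sub>0" for c using pos that by (rule mult_right_mono[rotated])
    have "(\<lambda>n. B \<epsilon> 1 n - fst (bp, bm) n - \<i> * snd (bp, bm) n) = (\<lambda>n. B \<epsilon> 1 n - unemb X0 1 n)"
      "(\<lambda>n. B \<epsilon> (-1) n - fst (bp, bm) n + \<i> * snd (bp, bm) n) = (\<lambda>n. B \<epsilon> (-1) n - unemb X0 (-1) n)"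
      by (auto simp: unemb_X0 two_mode_def)
    then show "ell2_norm (\<lambda>n. B \<epsilon> 1 n - fst (bp, bm) n - \<i> * snd (bp, bm) n)
          + ell2_norm (\<lambda>n. B \<epsilon> (-1) n - fst (bp, bm) n + \<i> * snd (bp, bm) n) \<le> C\<^sub>0 * \<epsilon>"
      using diff[OF \<epsilon>, of 1] diff[OF \<epsilon>, of "-1"] scale[OF C0(3)] by (simp add: mult.assoc)
    have "B \<epsilon> 0 = (\<lambda>n. B \<epsilon> 0 n - unemb X0 0 n)" by (auto simp: unemb_X0 two_mode_def)
    then have "ell2_norm (B \<epsilon> 0) \<le> h * C' * \<epsilon>" using diff[OF \<epsilon>, of 0] by simp
    moreover have "(\<Sum>\<^sub>\<infinity>m\<in>{m. 2 \<le> \<bar>m\<bar>}. ell2_norm (B \<epsilon> m)) \<le> (h * C' * \<epsilon>) * inv_wt_sum"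
    proof -
      have "(\<Sum>\<^sub>\<infinity>m\<in>{m. 2 \<le> \<bar>m\<bar>}. ell2_norm (B \<epsilon> m)) = (\<Sum>\<^sub>\<infinity>m\<in>{m. 2 \<le> \<bar>m\<bar>}. ell2_norm (unemb (x \<epsilon> - X0) m))"
      proof (rule infsum_cong)
        fix m :: int assume "m \<in> {m. 2 \<le> \<bar>m\<bar>}"
        then have "unemb X0 m n = 0" for n by (auto simp: unemb_X0 two_mode_def)
        then have "B \<epsilon> m = unemb (x \<epsilon> - X0) m"
          by (intro ext) (simp add: B_def unemb_def diff_divide_distrib)
        then show "ell2_norm (B \<epsilon> m) = ell2_norm (unemb (x \<epsilon> - X0) m)" by simp
      qed
      also have "\<dots> \<le> norm (x \<epsilon> - X0) * inv_wt_sum" by (rule unemb_norm_infsum_le)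
      also have "\<dots> \<le> (h * C' * \<epsilon>) * inv_wt_sum" by (rule mult_right_mono[OF xX_le[OF \<epsilon>] inv_wt_sum_nonneg])
      finally show ?thesis .
    qed
    moreover have "h * C' * \<epsilon> + (h * C' * \<epsilon>) * inv_wt_sum = (1 + inv_wt_sum) * (h * C') * \<epsilon>"
      by (simp add: algebra_simps)
    ultimately show "ell2_norm (B \<epsilon> 0) + (\<Sum>\<^sub>\<infinity>m\<in>{m. 2 \<le> \<bar>m\<bar>}. ell2_norm (B \<epsilon> m)) \<le> C\<^sub>0 * \<epsilon>"
      using scale[OF C0(4)] by linarith
  qed
  have uniq: "ev' \<epsilon> = ev \<epsilon> \<and> (\<exists>c. c \<noteq> 0 \<and> (\<forall>m n. B' \<epsilon> m n = c * B \<epsilon> m n))"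
    if "\<epsilon>\<^sub>2 \<le> \<epsilon>\<^sub>0" and br': "kg_spectral_branch p \<Omega> A \<Lambda> (bp, bm) \<epsilon>\<^sub>2 C\<^sub>0 ev' B'" and \<epsilon>2: "\<epsilon> \<in> {0<..<\<epsilon>\<^sub>2}"
    for \<epsilon>\<^sub>2 ev' B' \<epsilon>
  proof -
    have \<epsilon>: "\<epsilon> \<in> {0<..<\<epsilon>\<^sub>0}" using that by auto
    have pos: "0 < \<epsilon>" "\<epsilon> < e1" using in2(2)[OF \<epsilon>] by auto
    have kg': "kg_eigenpair p \<epsilon> (breather_freq \<Omega> \<epsilon>) (fourier_series (A \<epsilon>)) (ev' \<epsilon>) (B' \<epsilon>)"
      and ev': "cmod (ev' \<epsilon> - of_real \<epsilon> * \<Lambda>) \<le> C\<^sub>0 * \<epsilon>\<^sup>2"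
      using br' \<epsilon>2 unfolding kg_spectral_branch_def by blast+
    define \<nu> where "\<nu> = ev' \<epsilon> / of_real \<epsilon> - \<Lambda>"
    have ev_eq: "ev' \<epsilon> = of_real \<epsilon> * (\<Lambda> + \<nu>)" using pos by (simp add: \<nu>_def)
    have "\<epsilon> * cmod \<nu> \<le> \<epsilon> * (C\<^sub>0 * \<epsilon>)"
      using ev' pos by (simp add: ev_eq distrib_left norm_mult power2_eq_square mult_ac)
    then have \<nu>: "cmod \<nu> \<le> C\<^sub>0 * \<epsilon>" using pos by simp
    have B22: "B' \<epsilon> \<in> ell22" using kg' by (simp add: kg_eigenpair_def)
    define y where "y = emb (B' \<epsilon>)"
    have yB: "unemb y = B' \<epsilon>" unfolding y_def by (rule unemb_emb[OF B22])
    have y: "y \<noteq> 0" "K0 \<epsilon> y + K1 \<epsilon> (cs \<nu> y) + K2 \<epsilon> (cs \<nu> (cs \<nu> y)) = 0"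
      using kg_iff[OF in2(2)[OF \<epsilon>], of \<nu> y] kg' by (auto simp: yB ev_eq)
    have K1_le: "norm (K1 \<epsilon>) \<le> norm k1 + Mx * e1"
    proof -
      have "norm (K1 \<epsilon>) \<le> norm (K1 \<epsilon> - k1) + norm k1" using norm_triangle_ineq[of "K1 \<epsilon> - k1" k1] by simp
      moreover have "Mx * \<epsilon> \<le> Mx * e1" using Mx pos by (intro mult_left_mono) auto
      ultimately show ?thesis using KM(2)[OF in2(2)[OF \<epsilon>]] by linarith
    qed
    have "norm S * (Mx * \<epsilon> + (norm k1 + Mx * e1) * (C\<^sub>0 * \<epsilon>) + Mx * \<epsilon> * ((C\<^sub>0 * \<epsilon>) * (C\<^sub>0 * \<epsilon>))) \<le> \<sigma> * \<epsilon>"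
    proof -
      have "Mx * \<epsilon> * ((C\<^sub>0 * \<epsilon>) * (C\<^sub>0 * \<epsilon>)) \<le> Mx * e1 * ((C\<^sub>0 * e1) * (C\<^sub>0 * \<epsilon>))"
        using Mx pos C0 by (intro mult_mono mult_nonneg_nonneg) auto
      then have "Mx * \<epsilon> + (norm k1 + Mx * e1) * (C\<^sub>0 * \<epsilon>) + Mx * \<epsilon> * ((C\<^sub>0 * \<epsilon>) * (C\<^sub>0 * \<epsilon>))
          \<le> Mx * \<epsilon> + (norm k1 + Mx * e1) * (C\<^sub>0 * \<epsilon>) + Mx * e1 * ((C\<^sub>0 * e1) * (C\<^sub>0 * \<epsilon>))"
        by (rule add_left_mono)
      also have "\<dots> = \<kappa> * \<epsilon>" by (simp add: \<kappa>_def algebra_simps)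
      finally have "norm S * (Mx * \<epsilon> + (norm k1 + Mx * e1) * (C\<^sub>0 * \<epsilon>) + Mx * \<epsilon> * ((C\<^sub>0 * \<epsilon>) * (C\<^sub>0 * \<epsilon>)))
          \<le> norm S * (\<kappa> * \<epsilon>)" by (rule mult_left_mono) simp
      then show ?thesis by (simp add: \<sigma>_def mult.assoc)
    qed
    note nx = eigenvector_near_X0[OF S(1) KM(1)[OF in2(2)[OF \<epsilon>]] K1_le KM(3)[OF in2(2)[OF \<epsilon>]] \<nu> this \<sigma>\<epsilon>[OF \<epsilon>] y]
    have l: "ell y \<noteq> 0" by (rule nx(1))
    have near: "norm (cs (1 / ell y) y - X0) \<le> 2 * (\<sigma> * \<epsilon>) * norm X0" by (rule nx(2))
    define y' where "y' = cs (1 / ell y) y"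
    \<comment> \<open>This inverts the encoding: \<open>ell z'\<close> is \<nu> and
      \<open>nrm z'\<close> is the rescaled eigenvector.\<close>
    define z' where "z' = y' - X0 + cs \<nu> X0"
    have ell_z': "ell z' = \<nu>"
      using l by (simp add: z'_def y'_def ell_add ell_diff ell_cs ell_X0)
    have nrm_z': "nrm z' = y'" by (simp add: nrm_def mul_cs ell_z') (simp add: z'_def)
    have "norm z' \<le> 2 * (\<sigma> * \<epsilon>) * norm X0 + (C\<^sub>0 * \<epsilon>) * norm X0"
      unfolding z'_def y'_def
      by (rule norm_triangle_mono[OF near order_trans[OF norm_cs_le mult_right_mono[OF \<nu> norm_ge_zero]]])
    also have "\<dots> = \<tau> * \<epsilon>" by (simp add: \<tau>_def algebra_simps)
    finally have "norm z' \<le> \<rho>" using \<tau>\<epsilon>[OF \<epsilon>] by linarith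
    moreover have "pencil blinfun_apply mul X0 (K0 \<epsilon>) (K1 \<epsilon>) (K2 \<epsilon>) z' = 0"
    proof -
      have "cs \<nu> y' = cs (1 / ell y) (cs \<nu> y)" "cs \<nu> (cs \<nu> y') = cs (1 / ell y) (cs \<nu> (cs \<nu> y))"
        by (simp_all add: y'_def cs_cs mult_ac)
      then have "K0 \<epsilon> y' + K1 \<epsilon> (cs \<nu> y') + K2 \<epsilon> (cs \<nu> (cs \<nu> y'))
          = cs (1 / ell y) (K0 \<epsilon> y + K1 \<epsilon> (cs \<nu> y) + K2 \<epsilon> (cs \<nu> (cs \<nu> y)))"
        using clin_K[of \<epsilon>] unfolding clin_def cs_add by (simp only: y'_def)
      then show ?thesis unfolding pencil_eq ell_z' nrm_z' y(2) by (simp add: cs_zero_right)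
    qed
    ultimately have zz: "z' = z \<epsilon>" by (rule zu[OF in2(1)[OF \<epsilon>]])
    have "ev' \<epsilon> = ev \<epsilon>" using zz ell_z' by (simp add: ev_eq ev_def scaleR_conv_of_real)
    moreover have "B' \<epsilon> m n = ell y * B \<epsilon> m n" for m n
    proof -
      have "x \<epsilon> = y'" using zz nrm_z' by (simp add: x_def)
      then have "y = cs (ell y) (x \<epsilon>)" using l by (simp add: y'_def cs_cs cs_one)
      then show ?thesis unfolding yB[symmetric] B_def by (metis unemb_cs)
    qed
    ultimately show ?thesis using l by blast
  qed
  have uniq': "\<forall>\<epsilon>\<^sub>2 ev' B'. 0 < \<epsilon>\<^sub>2 \<and> \<epsilon>\<^sub>2 \<le> \<epsilon>\<^sub>0
          \<and> kg_spectral_branch p \<Omega> A \<Lambda> (bp, bm) \<epsilon>\<^sub>2 C\<^sub>0 ev' B' \<longrightarrow>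
        (\<forall>\<epsilon>\<in>{0<..<\<epsilon>\<^sub>2}. ev' \<epsilon> = ev \<epsilon> \<and>
          (\<exists>c. c \<noteq> 0 \<and> (\<forall>m n. B' \<epsilon> m n = c * B \<epsilon> m n)))"
    by (intro allI impI ballI, elim conjE) (rule uniq)
  have le: "\<epsilon>\<^sub>0 \<le> \<epsilon>\<^sub>1" using \<epsilon>0 e2 e1 by linarith
  show ?thesis
    by (rule exI[of _ \<epsilon>\<^sub>0], rule conjI[OF \<epsilon>0(1)], rule exI[of _ C\<^sub>0], rule conjI[OF C0(1)],
        rule conjI[OF le], rule exI[of _ ev], rule exI[of _ B], rule conjI[OF br uniq'])
qed

end

theorem theorem2:
  fixes p :: nat
    and \<Omega> \<epsilon>\<^sub>1 C :: real
    and \<A> :: "int ^ 'd \<Rightarrow> real"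
    and A :: "real \<Rightarrow> int \<Rightarrow> int ^ 'd \<Rightarrow> complex"
    and \<Lambda> :: complex
    and b\<^sub>p b\<^sub>m :: "int ^ 'd \<Rightarrow> complex"
  assumes "1 \<le> p"
    and "\<Omega> \<notin> {- 4 * real CARD('d)..0}"
    and "\<A> \<in> ell2"
    and "dnls_stationary p \<Omega> \<A>"
    and "\<forall>u\<in>ell2. J_op p \<Omega> \<A> u = (\<lambda>n. 0) \<longrightarrow> u = (\<lambda>n. 0)"
    and "0 < \<epsilon>\<^sub>1"
    and "breather_branch p \<Omega> \<A> \<epsilon>\<^sub>1 C A"
    and "eigenpair (dnls_matrix p \<Omega> \<A>) (2 * \<Lambda>) (b\<^sub>p, b\<^sub>m)"
    and "simple_eigenvalue (dnls_matrix p \<Omega> \<A>) (2 * \<Lambda>)"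
    and "isolated_in_spectrum (dnls_matrix p \<Omega> \<A>) (2 * \<Lambda>)"
    and "2 * \<Lambda> \<notin> (\<lambda>s. \<i> * complex_of_real s) ` {\<Omega>..\<Omega> + 4 * real CARD('d)}
           \<union> (\<lambda>s. - \<i> * complex_of_real s) ` {\<Omega>..\<Omega> + 4 * real CARD('d)}"
  shows "\<exists>\<epsilon>\<^sub>0>0. \<exists>C\<^sub>0>0. \<epsilon>\<^sub>0 \<le> \<epsilon>\<^sub>1 \<and>
    (\<exists>ev B. kg_spectral_branch p \<Omega> A \<Lambda> (b\<^sub>p, b\<^sub>m) \<epsilon>\<^sub>0 C\<^sub>0 ev B \<and>
      (\<forall>\<epsilon>\<^sub>2 ev' B'. 0 < \<epsilon>\<^sub>2 \<and> \<epsilon>\<^sub>2 \<le> \<epsilon>\<^sub>0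
          \<and> kg_spectral_branch p \<Omega> A \<Lambda> (b\<^sub>p, b\<^sub>m) \<epsilon>\<^sub>2 C\<^sub>0 ev' B' \<longrightarrow>
        (\<forall>\<epsilon>\<in>{0<..<\<epsilon>\<^sub>2}. ev' \<epsilon> = ev \<epsilon> \<and>
          (\<exists>c. c \<noteq> 0 \<and> (\<forall>m n. B' \<epsilon> m n = c * B \<epsilon> m n)))))"
proof -
  interpret breather p \<Omega> \<A> \<Lambda> b\<^sub>p b\<^sub>m \<epsilon>\<^sub>1 C A
    by unfold_locales (fact assms)+
  show ?thesis by (rule spectral_branch)
qed

end
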